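(* Let $m \in \{3,5,7,11\}$, and let $k_m = 5$ if $m=3$ and $k_m = m-2$ if $m>3$. Let $\ell$ be an odd prime such that $\ell^{k_m-2} \equiv -1 \pmod m$. Then $$\overline{p}\left(m \ell^3 n\right) \equiv 0 \pmod m$$ for every positive integer $n$ prime to $\ell$.
   Context: $\overline{p}(n)$ denotes the number of overpartitions of $n$; its generating function is $\sum_{n\ge0}\overline{p}(n)q^n=\prod_{n\ge1}\frac{1+q^n}{1-q^n}$. *)

theory Defs
  imports "HOL-Library.Multiset" "HOL-Number_Theory.Number_Theory"
begin

text \<open>
  An overpartition of \<open>n\<close> is a partition of \<open>n\<close> in which the first occurrence of each distinct
  part may be overlined. It is encoded as a pair \<open>(P, S)\<close>, where \<open>P\<close> is the multiset of parts and
  \<open>S\<close> is the set of those part sizes whose first occurrence is overlined.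
\<close>

definition overpartitions :: "nat \<Rightarrow> (nat multiset \<times> nat set) set" where
  "overpartitions n = {(P, S). 0 \<notin># P \<and> \<Sum>\<^sub># P = n \<and> S \<subseteq> set_mset P}"

definition overpartition_count :: "nat \<Rightarrow> nat" where
  "overpartition_count n = card (overpartitions n)"

text \<open>Finiteness, so that \<^const>\<open>card\<close> really counts overpartitions.\<close>

lemma finite_overpartitions: "finite (overpartitions n)"
proof -
  have size_le: "size P \<le> \<Sum>\<^sub># P" if "0 \<notin># P" for P :: "nat multiset"
    using that by (induction P) auto
  have part_le: "x \<le> \<Sum>\<^sub># P" if "x \<in># P" for x and P :: "nat multiset"
    using that by (induction P) auto
  have parts: "P \<in> mset ` {xs. set xs \<subseteq> {..n} \<and> length xs \<le> n}"
    if "0 \<notin># P" "\<Sum>\<^sub># P = n" for P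
  proof -
    obtain xs where xs: "P = mset xs" by (metis ex_mset)
    have "set xs \<subseteq> {..n}" using part_le[of _ P] that xs by (simp add: subset_iff)
    moreover have "length xs \<le> n" using size_le[of P] that xs by simp
    ultimately show ?thesis using xs by blast
  qed
  have "overpartitions n \<subseteq> mset ` {xs. set xs \<subseteq> {..n} \<and> length xs \<le> n} \<times> Pow {..n}"
  proof
    fix z assume "z \<in> overpartitions n"
    then obtain P S where z: "z = (P, S)" and P: "0 \<notin># P" "\<Sum>\<^sub># P = n" and S: "S \<subseteq> set_mset P"
      unfolding overpartitions_def by blast
    have "S \<subseteq> {..n}" using S P(2) part_le[of _ P] by auto
    with parts[OF P] z show "z \<in> mset ` {xs. set xs \<subseteq> {..n} \<and> length xs \<le> n} \<times> Pow {..n}"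
      by (simp only: mem_Sigma_iff Pow_iff)
  qed
  moreover have "finite (mset ` {xs. set xs \<subseteq> {..n} \<and> length xs \<le> n} \<times> Pow {..n})"
    by (intro finite_cartesian_product finite_imageI finite_lists_length_le) auto
  ultimately show ?thesis by (rule finite_subset)
qed

end

(*
  Write theta3 = sum q^(x^2) and theta4 = sum (-q)^(x^2).  By Gauss, sum pbar(n) (-q)^n = 1/theta3.

  Reduction modulo m.  With x = F/theta3^4, where 16 F = theta3^4 - theta4^4, one has
  q dx/dq = x theta4^4, so the operator U_m acts on q-series as the Cartier operator acts on
  differential forms in x.  Together with the Hasse invariant relation
  theta3^(2m-2) * sum_j binomial(2j,j)^2 x^j = 1 (mod m) this makes U_m(1/theta3) congruent to a form
  of positive half-integral weight: theta3^5 for m = 3, theta3^3 for m = 5, U_4(theta3^5) for m = 7, and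
  theta3 (8 E_4(q) + 4 E_4(q^4)) for m = 11.  All identities between theta functions, their derivatives
  and Lambert series which are needed follow from their behaviour under the Landen transformation q -> q^2, from Gauss's
  product and from Ramanujan's formula for E_2^2.

  Hecke relations.  For m = 3, 7, 11 the coefficients are combinations of the sums of c^j (j = 1 or 3)
  over the integral forms [a,b,c] of discriminant D with a < 0 < c.  By an argument of Zagier
  the sum of Q(p,r)^j over the forms Q of discriminant D with a < 0 < Q(p,r) equals r^(2j) times this sum,
  and applying this to the sublattices of index l gives the eigenvalue 1 + l^(2j+1) at discriminants
  exactly divisible by l.  For m = 5, sums of three squares are norms of pure quaternions, and conjugation
  by the Lipschitz quaternions of norm l gives the eigenvalue 1 + l.
*)

theory Submission
  imports Defs "HOL-Computational_Algebra.Formal_Laurent_Series"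
begin

section \<open>Operators on power series and the Landen transformation\<close>

text \<open>The forms congruent to U_m(1/theta3) have weights 5/2, 3/2, 5/2, 9/2, so k_m is twice
  the weight and 1 + l^(k_m - 2) is the Hecke eigenvalue at l^2. The hypothesis on l says exactly
  that this eigenvalue vanishes modulo m. Since n is prime to l, the index l n is exactly divisible
  by l. For such an index the character term and the term at l n / l^2 of the Hecke operator vanish,
  and the relation reduces to c(l^2 (l n)) = (1 + l^(k_m - 2)) c(l n). Relations of this restricted
  kind can be proved by counting sublattices or quaternions. The obstacle is that no
  finite-dimensional space of modular forms is at hand to decide whether two series agree. Its
  substitute is a uniqueness principle: if the difference of two series satisfies a suitable
  functional equation under q -> q^2, then comparing orders of vanishing, or descending from n to
  n/2, shows that it is determined by at most its first two coefficients. The same principle modulo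
  m yields the Hasse invariants.\<close>

lemmas square_simps = power2_eq_square algebra_simps

section \<open>The operators V_k, U_k and q d/dq\<close>

definition fps_V :: "nat \<Rightarrow> 'a :: comm_ring_1 fps \<Rightarrow> 'a fps" where
  "fps_V k f = fps_compose f (fps_X ^ k)"

definition fps_U :: "nat \<Rightarrow> 'a fps \<Rightarrow> 'a fps" where
  "fps_U k f = Abs_fps (\<lambda>n. fps_nth f (k * n))"

definition fps_theta :: "'a :: comm_ring_1 fps \<Rightarrow> 'a fps" where
  "fps_theta f = fps_X * fps_deriv f"

lemma fps_V_nth: "k > 0 \<Longrightarrow> fps_nth (fps_V k f) n = (if k dvd n then fps_nth f (n div k) else 0)"
  unfolding fps_V_def by (simp add: fps_nth_compose_X_power)

lemma fps_U_nth [simp]: "fps_nth (fps_U k f) n = fps_nth f (k * n)"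
  by (simp add: fps_U_def)

lemma fps_theta_nth [simp]: "fps_nth (fps_theta f) n = of_nat n * fps_nth f n"
  by (cases n) (simp_all add: fps_theta_def)

lemma fps_V_add: "fps_V k (f + g) = fps_V k f + fps_V k g"
  and fps_V_diff: "fps_V k (f - g) = fps_V k f - fps_V k g"
  and fps_V_minus: "fps_V k (- f) = - fps_V k f"
  by (simp_all add: fps_V_def fps_compose_add_distrib fps_compose_sub_distrib fps_compose_uminus)

lemma fps_V_mult: "k > 0 \<Longrightarrow> fps_V k (f * g) = fps_V k f * fps_V k (g :: 'a :: idom fps)"
  by (simp add: fps_V_def fps_compose_mult_distrib)

lemma fps_V_power: "k > 0 \<Longrightarrow> fps_V k (f ^ n) = fps_V k (f :: 'a :: idom fps) ^ n"
  by (simp add: fps_V_def fps_compose_power)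

lemma fps_V_0 [simp]: "fps_V k 0 = 0"
  by (simp add: fps_V_def)

lemma fps_V_1 [simp]: "fps_V k 1 = 1"
  by (simp add: fps_V_def)

lemma fps_V_of_int [simp]: "fps_V k (of_int c) = of_int c"
  unfolding fps_V_def fps_of_int[symmetric] by simp

lemma fps_V_numeral [simp]: "fps_V k (numeral c) = numeral c"
  using fps_V_of_int[of k "numeral c"] by simp

lemmas fps_V_simps = fps_V_add fps_V_diff fps_V_minus fps_V_mult fps_V_power

lemma fps_theta_add: "fps_theta (f + g) = fps_theta f + fps_theta g"
  and fps_theta_diff: "fps_theta (f - g) = fps_theta f - fps_theta g"
  by (rule fps_ext; simp add: algebra_simps)+

lemma fps_theta_mult: "fps_theta (f * g) = fps_theta f * g + f * fps_theta g"
  by (simp add: fps_theta_def algebra_simps)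

lemma fps_theta_power: "fps_theta (f ^ n) = of_nat n * f ^ (n - 1) * fps_theta f"
proof (induction n)
  case (Suc n)
  then show ?case by (cases n) (simp_all add: fps_theta_mult algebra_simps)
qed (simp add: fps_theta_def)

lemma fps_theta_numeral [simp]: "fps_theta (numeral c) = 0" "fps_theta 1 = 0" "fps_theta 0 = 0"
  by (simp_all add: fps_theta_def)

lemma fps_theta_V: "k > 0 \<Longrightarrow> fps_theta (fps_V k f) = of_nat k * fps_V k (fps_theta f)"
  by (rule fps_ext) (auto simp: fps_V_nth fps_mult_of_nat_nth mult.assoc elim!: dvdE)

lemma fps_U_add: "fps_U k (f + g) = fps_U k f + fps_U k g"
  and fps_U_diff: "fps_U k (f - g) = fps_U k f - fps_U k g"
  by (rule fps_ext; simp)+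

text \<open>A series in q^k passes through U_k. Modulo a prime m this lets every m-th power leave
  U_m.\<close>

lemma fps_U_V_mult:
  assumes "k > 0"
  shows "fps_U k (fps_V k f * g) = f * fps_U k (g :: 'a :: comm_ring_1 fps)"
proof (rule fps_ext)
  fix n
  have "fps_nth (fps_V k f * g) (k * n) =
      (\<Sum>i\<in>{0..k*n}. (if k dvd i then fps_nth f (i div k) else 0) * fps_nth g (k * n - i))"
    using assms by (simp add: fps_mult_nth fps_V_nth)
  also have "\<dots> = (\<Sum>i\<in>(\<lambda>j. k * j) ` {0..n}. fps_nth f (i div k) * fps_nth g (k * n - i))"
    using assms by (intro sum.mono_neutral_cong_right) (auto elim!: dvdE)
  also have "\<dots> = (\<Sum>j\<in>{0..n}. fps_nth f j * fps_nth g (k * (n - j)))"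
    using assms by (subst sum.reindex) (auto simp: inj_on_def diff_mult_distrib2)
  finally show "fps_nth (fps_U k (fps_V k f * g)) n = fps_nth (f * fps_U k g) n"
    by (simp add: fps_mult_nth)
qed

section \<open>Theta series as sums over squares, and the Landen transformation\<close>

definition sq_series :: "(int \<Rightarrow> int) \<Rightarrow> int fps" where
  "sq_series w = Abs_fps (\<lambda>n. \<Sum>x\<in>{x. x^2 = int n}. w x)"

definition theta3 :: "int fps" where
  "theta3 = sq_series (\<lambda>_. 1)"

definition theta4 :: "int fps" where
  "theta4 = sq_series (\<lambda>x. if even x then 1 else - 1)"

lemma finite_square_le: "finite {x :: int. x^2 \<le> c}"
proof (rule finite_subset)
  show "{x :: int. x^2 \<le> c} \<subseteq> {- \<bar>c\<bar>..\<bar>c\<bar>}"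
  proof
    fix x assume "x \<in> {x :: int. x^2 \<le> c}"
    moreover have "\<bar>x\<bar> \<le> x^2"
      by (metis abs_ge_zero abs_of_nonneg mult_left_mono mult.right_neutral power2_eq_square
          abs_mult_self_eq int_one_le_iff_zero_less linorder_not_le order_le_less mult_zero_left)
    ultimately show "x \<in> {- \<bar>c\<bar>..\<bar>c\<bar>}"
      by auto
  qed
qed auto

lemma finite_square_eq: "finite {x :: int. x^2 = c}"
  by (rule finite_subset[OF _ finite_square_le[of c]]) auto

lemma sq_series_mult_nth:
  "fps_nth (sq_series w * f) n = (\<Sum>x\<in>{x. x^2 \<le> int n}. w x * fps_nth f (nat (int n - x^2)))"
proof -
  have "fps_nth (sq_series w * f) n
      = (\<Sum>i\<in>{0..n}. \<Sum>x\<in>{x. x^2 = int i}. w x * fps_nth f (n - i))"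
    by (simp add: fps_mult_nth sq_series_def sum_distrib_right)
  also have "\<dots> = (\<Sum>(i, x)\<in>Sigma {0..n} (\<lambda>i. {x. x^2 = int i}). w x * fps_nth f (n - i))"
    by (subst sum.Sigma) (auto simp: finite_square_eq)
  also have "\<dots> = (\<Sum>x\<in>{x. x^2 \<le> int n}. w x * fps_nth f (nat (int n - x^2)))"
    by (rule sum.reindex_bij_witness[of _ "\<lambda>x. (nat (x^2), x)" snd])
      (auto simp: nat_diff_distrib simp flip: of_nat_le_iff)
  finally show ?thesis .
qed

lemma finite_sum_two_squares: "finite {(x, y :: int). x^2 + y^2 = c}"
  by (rule finite_subset[of _ "{x. x^2 \<le> c} \<times> {x. x^2 \<le> c}"])
    (auto simp: finite_square_le intro: order_trans[OF _ eq_refl])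

lemma sq_series_mult_sq_series_nth:
  "fps_nth (sq_series w * sq_series v) n = (\<Sum>(x, y)\<in>{(x, y). x^2 + y^2 = int n}. w x * v y)"
proof -
  have "fps_nth (sq_series w * sq_series v) n
     = (\<Sum>x\<in>{x. x^2 \<le> int n}. \<Sum>y\<in>{y. y^2 = int n - x^2}. w x * v y)"
    by (simp add: sq_series_mult_nth sum_distrib_left) (simp add: sq_series_def sum_distrib_left)
  also have "\<dots> = (\<Sum>(x, y)\<in>Sigma {x. x^2 \<le> int n} (\<lambda>x. {y. y^2 = int n - x^2}). w x * v y)"
    by (subst sum.Sigma) (auto simp: finite_square_le finite_square_eq)
  also have "Sigma {x. x^2 \<le> int n} (\<lambda>x. {y. y^2 = int n - x^2}) = {(x, y). x^2 + y^2 = int n}"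
    by (auto simp: algebra_simps) (metis le_add_same_cancel1 zero_le_power2)
  finally show ?thesis .
qed

text \<open>Up to a reflection, (x, y) -> (x + y, x - y) is multiplication by 1 + i. It doubles the
  norm, and it is onto because x and y have equal parity when x^2 + y^2 is even.\<close>

lemma sum_two_squares_double:
  fixes h :: "int \<Rightarrow> int \<Rightarrow> int"
  shows "(\<Sum>(x, y)\<in>{(x, y). x^2 + y^2 = 2 * c}. h x y)
       = (\<Sum>(x, y)\<in>{(x, y). x^2 + y^2 = c}. h (x + y) (x - y))"
proof (rule sum.reindex_bij_witness[of _ "\<lambda>(u, v). (u + v, u - v)" "\<lambda>(x, y). ((x + y) div 2, (x - y) div 2)"], goal_cases)
  case (1 z)
  then obtain x y where z: "z = (x, y)" and e: "x^2 + y^2 = 2 * c" by auto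
  have "even (x^2 + y^2)" by (simp add: e)
  then have "even (x + y)" by simp
  then obtain u where "x + y = 2 * u" by (elim evenE)
  then have "y = 2 * u - x" by simp
  then show ?case by (simp add: z) 
next
  case (2 z)
  then obtain x y where z: "z = (x, y)" and e: "x^2 + y^2 = 2 * c" by auto
  have "even (x^2 + y^2)" by (simp add: e)
  then have "even (x + y)" by simp
  then obtain u where "x + y = 2 * u" by (elim evenE)
  then have y: "y = 2 * u - x" by simp
  have "u^2 + (x - u)^2 = c" using e unfolding y by (simp add: square_simps)
  moreover have "(x - (2 * u - x)) div 2 = x - u" by simp
  ultimately show ?case by (simp add: z y) 
next
  case (5 z)
  then obtain x y where z: "z = (x, y)" and e: "x^2 + y^2 = 2 * c" by auto
  have "even (x^2 + y^2)" by (simp add: e)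
  then have "even (x + y)" by simp
  then obtain u where "x + y = 2 * u" by (elim evenE)
  then have y: "y = 2 * u - x" by simp
  have "(x - (2 * u - x)) div 2 = x - u" by simp
  then show ?case by (simp add: z y) 
qed (auto simp: square_simps)

text \<open>The weights add up to 1 + (-1)^(x + y), which keeps the pairs of even norm; these are
  rotated by \<open>sum_two_squares_double\<close>.\<close>

lemma theta_landen_add: "theta3^2 + theta4^2 = 2 * fps_V 2 (theta3^2)"
proof (rule fps_ext)
  fix n
  define A where "A = {(x, y :: int). x^2 + y^2 = int n}"
  have fin: "finite A" unfolding A_def by (rule finite_sum_two_squares)
  have lhs: "fps_nth (theta3^2 + theta4^2) n = (\<Sum>(x, y)\<in>A. if even (x + y) then 2 else 0)"
    unfolding theta3_def theta4_def power2_eq_square[of "sq_series _"] fps_add_nth sq_series_mult_sq_series_nth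
      A_def[symmetric] sum.distrib[symmetric] by (intro sum.cong) auto
  show "fps_nth (theta3^2 + theta4^2) n = fps_nth (2 * fps_V 2 (theta3^2)) n"
  proof (cases "even n")
    case True
    then obtain k where k: "n = 2 * k" by (elim evenE)
    have "(\<Sum>(x, y)\<in>A. if even (x + y) then 2 else 0 :: int) = (\<Sum>(x, y)\<in>{(x, y). x^2 + y^2 = int k}. 2)"
      unfolding A_def k of_nat_mult by (simp add: sum_two_squares_double)
    then show ?thesis unfolding lhs
      by (simp add: k numeral_fps_const fps_V_nth)
        (simp add: theta3_def power2_eq_square[of "sq_series _"] sq_series_mult_sq_series_nth case_prod_unfold)
  next
    case False
    have "odd (x + y)" if "(x, y) \<in> A" for x y
    proof -
      have "x^2 + y^2 = int n" using that by (simp add: A_def)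
      then have "odd (x^2 + y^2)" using False by simp
      then show ?thesis by simp
    qed
    then have "(\<Sum>(x, y)\<in>A. if even (x + y) then 2 else 0 :: int) = 0"
      by (intro sum.neutral) auto
    then show ?thesis unfolding lhs using False by (simp add: numeral_fps_const fps_V_nth)
  qed
qed

text \<open>For even n the rotation turns the weight (-1)^y into (-1)^(x - y), that of theta4^2. For
  odd n the two squares have opposite parity, so exchanging x and y negates the sum.\<close>

lemma theta_landen_mult: "theta3 * theta4 = fps_V 2 (theta4^2)"
proof (rule fps_ext)
  fix n
  define A where "A = {(x, y :: int). x^2 + y^2 = int n}"
  have fin: "finite A" unfolding A_def by (rule finite_sum_two_squares)
  have lhs: "fps_nth (theta3 * theta4) n = (\<Sum>(x, y)\<in>A. if even y then 1 else - 1)"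
    unfolding theta3_def theta4_def sq_series_mult_sq_series_nth A_def[symmetric]
    by (intro sum.cong) auto
  show "fps_nth (theta3 * theta4) n = fps_nth (fps_V 2 (theta4^2)) n"
  proof (cases "even n")
    case True
    then obtain k where k: "n = 2 * k" by (elim evenE)
    have "(\<Sum>(x, y)\<in>A. if even y then 1 else - 1 :: int)
        = (\<Sum>(x, y)\<in>{(x, y). x^2 + y^2 = int k}. if even (x - y) then 1 else - 1)"
      unfolding A_def k of_nat_mult by (simp add: sum_two_squares_double)
    also have "\<dots> = fps_nth (theta4^2) k"
      unfolding theta4_def power2_eq_square[of "sq_series _"] sq_series_mult_sq_series_nth
      by (intro sum.cong) auto
    finally show ?thesis unfolding lhs by (simp add: k fps_V_nth)
  next
    case False
    have "odd (x + y)" if "(x, y) \<in> A" for x y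
    proof -
      have "x^2 + y^2 = int n" using that by (simp add: A_def)
      then have "odd (x^2 + y^2)" using False by simp
      then show ?thesis by simp
    qed
    then have "(\<Sum>(x, y)\<in>A. if even y then 1 else - 1 :: int) = (\<Sum>(x, y)\<in>A. - (if even x then 1 else - 1))"
      by (intro sum.cong) auto
    also have "\<dots> = - (\<Sum>(x, y)\<in>A. if even x then 1 else - 1)"
      by (simp add: sum_negf case_prod_unfold)
    also have "(\<Sum>(x, y)\<in>A. if even x then 1 else - 1 :: int) = (\<Sum>(x, y)\<in>A. if even y then 1 else - 1)"
      by (rule sum.reindex_bij_witness[of _ prod.swap prod.swap]) (auto simp: A_def)
    finally show ?thesis unfolding lhs using False by (simp add: fps_V_nth)
  qed
qed

section \<open>Gauss's product for overpartitions\<close>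

definition overpartitions_le :: "nat \<Rightarrow> nat \<Rightarrow> (nat multiset \<times> nat set) set" where
  "overpartitions_le N n = {(P, S) \<in> overpartitions n. set_mset P \<subseteq> {..N}}"

lemma finite_overpartitions_le: "finite (overpartitions_le N n)"
  by (rule finite_subset[OF _ finite_overpartitions[of n]]) (auto simp: overpartitions_le_def)

text \<open>Three disjoint cases: no part N; a single part N, which is overlined; any other pair
  containing N, from which one copy of N is removed and all marks are kept. They account for the
  terms of (1 - q^N) f_N = (1 + q^N) f_(N-1).\<close>

lemma overpartitions_le_split:
  assumes "N > 0"
  shows "overpartitions_le N n = overpartitions_le (N - 1) n \<union>
    (if N \<le> n then (\<lambda>(P, S). (add_mset N P, insert N S)) ` overpartitions_le (N - 1) (n - N) \<union>
       (\<lambda>(P, S). (add_mset N P, S)) ` overpartitions_le N (n - N) else {})"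
    (is "?L = ?R")
proof (rule subset_antisym; rule subsetI)
  fix z assume "z \<in> ?L"
  then obtain P S where z: "z = (P, S)" and P: "0 \<notin># P" "\<Sum>\<^sub># P = n" "S \<subseteq> set_mset P" "set_mset P \<subseteq> {..N}"
    by (auto simp: overpartitions_le_def overpartitions_def)
  show "z \<in> ?R"
  proof (cases "N \<in># P")
    case False
    have "set_mset P \<subseteq> {..N - 1}"
    proof
      fix x assume x: "x \<in># P"
      then have "x \<le> N" "x \<noteq> N" using P(4) False by auto
      then show "x \<in> {..N - 1}" by simp
    qed
    then show ?thesis using P by (auto simp: z overpartitions_le_def overpartitions_def)
  next
    case True
    then obtain P' where P': "P = add_mset N P'" by (metis insert_DiffM)
    then have N: "N \<le> n" "\<Sum>\<^sub># P' = n - N" using P(2) by auto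
    show ?thesis
    \<comment> \<open>The mark on N has to go together with N exactly when the removed copy is the
      last one.\<close>
    proof (cases "N \<in> S \<and> N \<notin># P'")
      case True
      have "set_mset P' \<subseteq> {..N - 1}"
      proof
        fix x assume x: "x \<in># P'"
        then have "x \<le> N" "x \<noteq> N" using P(4) P' True by auto
        then show "x \<in> {..N - 1}" by simp
      qed
      then have "(P', S - {N}) \<in> overpartitions_le (N - 1) (n - N)"
        using P P' N by (auto simp: overpartitions_le_def overpartitions_def)
      moreover have "z = (\<lambda>(P, S). (add_mset N P, insert N S)) (P', S - {N})"
        using True by (auto simp: z P')
      ultimately have "z \<in> (\<lambda>(P, S). (add_mset N P, insert N S)) ` overpartitions_le (N - 1) (n - N)"
        by (rule rev_image_eqI)
      then show ?thesis using N(1) by simp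
    next
      case False
      then have "(P', S) \<in> overpartitions_le N (n - N)"
        using P P' N by (auto simp: overpartitions_le_def overpartitions_def)
      moreover have "z = (\<lambda>(P, S). (add_mset N P, S)) (P', S)"
        by (auto simp: z P')
      ultimately have "z \<in> (\<lambda>(P, S). (add_mset N P, S)) ` overpartitions_le N (n - N)"
        by (rule rev_image_eqI)
      then show ?thesis using N(1) by simp
    qed
  qed
next
  fix z assume "z \<in> ?R"
  then show "z \<in> ?L" using assms
    by (auto simp: overpartitions_le_def overpartitions_def split: if_splits)
qed

lemma card_overpartitions_le:
  assumes "N > 0"
  shows "card (overpartitions_le N n) = card (overpartitions_le (N - 1) n) +
    (if N \<le> n then card (overpartitions_le (N - 1) (n - N)) + card (overpartitions_le N (n - N)) else 0)"
proof (cases "N \<le> n")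
  case False
  then show ?thesis by (subst overpartitions_le_split[OF assms]) simp
next
  case True
  define A where "A = overpartitions_le (N - 1) n"
  define B where "B = (\<lambda>(P, S). (add_mset N P, insert N S)) ` overpartitions_le (N - 1) (n - N)"
  define C where "C = (\<lambda>(P, S). (add_mset N P, S)) ` overpartitions_le N (n - N)"
  have notin: "N \<notin># P \<and> N \<notin> S" if "(P, S) \<in> overpartitions_le (N - 1) k" for P S k
    using that assms by (auto simp: overpartitions_le_def overpartitions_def)
  have "card (overpartitions_le N n) = card (A \<union> (B \<union> C))"
    using overpartitions_le_split[OF assms, of n] True by (simp add: A_def B_def C_def Un_assoc)
  also have "\<dots> = card A + card (B \<union> C)"
  proof (intro card_Un_disjoint)
    have "N \<in># P" if "(P, S) \<in> B \<union> C" for P S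
      using that by (auto simp: B_def C_def)
    then show "A \<inter> (B \<union> C) = {}" using notin by (fastforce simp: A_def)
  qed (auto simp: A_def B_def C_def finite_overpartitions_le)
  also have "card (B \<union> C) = card B + card C"
  proof (intro card_Un_disjoint)
    have False if "z \<in> B" "z \<in> C" for z
    proof -
      obtain P S where 1: "z = (add_mset N P, insert N S)" "(P, S) \<in> overpartitions_le (N - 1) (n - N)"
        using \<open>z \<in> B\<close> by (auto simp: B_def)
      obtain P' S' where 2: "z = (add_mset N P', S')" "(P', S') \<in> overpartitions_le N (n - N)"
        using \<open>z \<in> C\<close> by (auto simp: C_def)
      have "S' \<subseteq> set_mset P'"
        using 2(2) by (simp add: overpartitions_le_def overpartitions_def)
      then show False using 1(1) 2(1) notin[OF 1(2)] by auto
    qed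
    then show "B \<inter> C = {}" by blast
  qed (auto simp: B_def C_def finite_overpartitions_le)
  also have "card B = card (overpartitions_le (N - 1) (n - N))"
    unfolding B_def by (intro card_image inj_onI) (clarsimp, metis notin[unfolded One_nat_def] insert_ident)
  also have "card C = card (overpartitions_le N (n - N))"
    unfolding C_def by (intro card_image) (auto simp: inj_on_def)
  finally show ?thesis using True by (simp add: A_def)
qed

definition overpartition_le_series :: "nat \<Rightarrow> int fps" where
  "overpartition_le_series N = Abs_fps (\<lambda>n. int (card (overpartitions_le N n)))"

definition overpartition_series :: "int fps" where
  "overpartition_series = Abs_fps (\<lambda>n. int (overpartition_count n))"

lemma overpartition_le_series_0: "overpartition_le_series 0 = 1"
proof (rule fps_ext)
  fix n
  have "overpartitions_le 0 n = (if n = 0 then {({#}, {})} else {})"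
  proof -
    have "P = {#}" if "0 \<notin># P" "set_mset P \<subseteq> {0}" for P :: "nat multiset"
      using that by (metis all_not_in_conv set_mset_eq_empty_iff singletonD subsetD)
    then show ?thesis
      by (auto simp: overpartitions_le_def overpartitions_def) fastforce+
  qed
  then show "fps_nth (overpartition_le_series 0) n = fps_nth 1 n"
    by (simp add: overpartition_le_series_def)
qed

lemma overpartition_le_series_rec:
  assumes "N > 0"
  shows "(1 - fps_X ^ N) * overpartition_le_series N
       = (1 + fps_X ^ N) * overpartition_le_series (N - 1)"
  by (rule fps_ext)
    (simp add: overpartition_le_series_def card_overpartitions_le[OF assms] algebra_simps
      fps_X_power_mult_nth fps_X_power_mult_right_nth)

lemma overpartition_series_nth_eq:
  assumes "n \<le> N"
  shows "fps_nth overpartition_series n = fps_nth (overpartition_le_series N) n"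
proof -
  have part_le: "x \<le> \<Sum>\<^sub># P" if "x \<in># P" for x and P :: "nat multiset"
    using that by (induction P) auto
  have "set_mset P \<subseteq> {..N}" if "\<Sum>\<^sub># P = n" for P
    using part_le[of _ P] that assms by force
  then have "overpartitions_le N n = overpartitions n"
    by (auto simp: overpartitions_le_def overpartitions_def)
  then show ?thesis
    by (simp add: overpartition_series_def overpartition_le_series_def overpartition_count_def)
qed

lemma overpartition_le_series_prod:
  "overpartition_le_series N * (\<Prod>k\<in>{1..N}. 1 - fps_X ^ k) = (\<Prod>k\<in>{1..N}. 1 + fps_X ^ k)"
proof (induction N)
  case (Suc N)
  have "overpartition_le_series (Suc N) * (\<Prod>k\<in>{1..Suc N}. 1 - fps_X ^ k)
      = ((1 - fps_X ^ Suc N) * overpartition_le_series (Suc N)) * (\<Prod>k\<in>{1..N}. 1 - fps_X ^ k)"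
    by (simp add: mult_ac)
  also have "\<dots> = (1 + fps_X ^ Suc N) * (overpartition_le_series N * (\<Prod>k\<in>{1..N}. 1 - fps_X ^ k))"
    using overpartition_le_series_rec[of "Suc N"] by (simp only: diff_Suc_1 zero_less_Suc mult.assoc)
  also have "\<dots> = (\<Prod>k\<in>{1..Suc N}. 1 + fps_X ^ k)"
    unfolding Suc.IH by (simp add: mult.commute)
  finally show ?case .
qed (simp add: overpartition_le_series_0)

section \<open>A finite form of Gauss's product\<close>

definition theta4_partial :: "nat \<Rightarrow> int fps" where
  "theta4_partial n = (\<Sum>x\<in>{- int n..int n}. of_int (if even x then 1 else - 1) * fps_X ^ nat (x^2))"

lemma theta4_partial_nth:
  assumes "i \<le> n"
  shows "fps_nth (theta4_partial n) i = fps_nth theta4 i"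
proof -
  have "fps_nth (theta4_partial n) i
      = (\<Sum>x\<in>{- int n..int n}. if x^2 = int i then if even x then 1 else - 1 else 0)"
    unfolding theta4_partial_def fps_sum_nth
    by (intro sum.cong refl) (auto simp: simp flip: fps_const_neg)
  also have "\<dots> = (\<Sum>x\<in>{x. x^2 = int i}. if even x then 1 else - 1)"
  proof (intro sum.mono_neutral_cong_right)
    show "{x. x^2 = int i} \<subseteq> {- int n..int n}"
    proof
      fix x assume "x \<in> {x. x^2 = int i}"
      then have x: "x^2 = int i" by simp
      have "\<bar>x\<bar> \<le> x^2" using self_le_power[of "\<bar>x\<bar>" 2] by (cases "x = 0") auto
      then show "x \<in> {- int n..int n}" using assms x by auto
    qed
  qed auto
  finally show ?thesis by (simp add: theta4_def sq_series_def)
qed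

lemma theta4_partial_Suc:
  "theta4_partial (Suc n) = theta4_partial n + 2 * (- 1) ^ Suc n * fps_X ^ (Suc n * Suc n)"
proof -
  have "{- int (Suc n)..int (Suc n)} = insert (int (Suc n)) (insert (- int (Suc n)) {- int n..int n})"
    by auto
  moreover have "nat ((int (Suc n))^2) = Suc n * Suc n" "nat ((- int (Suc n))^2) = Suc n * Suc n"
    unfolding power2_eq_square by (simp_all only: minus_mult_minus nat_int flip: of_nat_mult)
  ultimately show ?thesis
    unfolding theta4_partial_def by (cases "even n") (simp_all del: of_nat_Suc power_Suc add: )
qed

text \<open>A telescoping sum in the style of Shanks: passing from \<open>n\<close> to \<open>n + 1\<close> the
  summands on the right change by a difference of consecutive terms.\<close>

lemma theta4_partial_prod:
  "(\<Prod>k\<in>{1..n}. 1 + fps_X ^ k) * theta4_partial n = (\<Prod>k\<in>{1..n}. 1 - fps_X ^ k) +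
     2 * (\<Sum>s\<in>{1..n}. (- 1) ^ s * fps_X ^ (s * Suc n) *
        ((\<Prod>k\<in>{s<..n}. 1 - fps_X ^ k) * (\<Prod>k\<in>{1..<s}. 1 + fps_X ^ k)))"
proof (induction n)
  case 0
  then show ?case by (simp add: theta4_partial_def)
next
  case (Suc n)
  define X :: "int fps" where "X = fps_X"
  define m where "m = Suc n"
  define M where "M k = (\<Prod>k\<in>{1..k}. 1 + X ^ k)" for k :: nat
  define D where "D k = (\<Prod>k\<in>{1..k}. 1 - X ^ k)" for k :: nat
  define T where "T n s = (- 1) ^ s * X ^ (s * Suc n) *
        ((\<Prod>k\<in>{s<..n}. 1 - X ^ k) * (\<Prod>k\<in>{1..<s}. 1 + X ^ k))" for n s :: nat
  define w where "w s = (- 1) ^ s * X ^ (s * m) *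
        ((\<Prod>k\<in>{s..n}. 1 - X ^ k) * (\<Prod>k\<in>{1..<s}. 1 + X ^ k))" for s :: nat
  have IH: "M n * theta4_partial n = D n + 2 * (\<Sum>s\<in>{1..n}. T n s)"
    using Suc.IH by (simp add: M_def D_def T_def X_def)
  have w1: "(1 - X ^ s) * T n s = w s" if "s \<in> {1..n}" for s
  proof -
    have "{s..n} = insert s {s<..n}" using that by auto
    then have "(\<Prod>k\<in>{s..n}. 1 - X ^ k) = (1 - X ^ s) * (\<Prod>k\<in>{s<..n}. 1 - X ^ k)" by simp
    then show ?thesis by (simp add: w_def T_def m_def mult_ac)
  qed
  have w2: "- (X ^ m) * (1 + X ^ s) * T n s = w (Suc s)" if "s \<in> {1..n}" for s
  proof -
    have e1: "{Suc s..n} = {s<..n}" by auto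
    have e2: "{1..<Suc s} = insert s {1..<s}" using that by auto
    have e3: "X ^ (Suc s * m) = X ^ m * X ^ (s * m)" by (simp add: power_add)
    show ?thesis unfolding w_def T_def e1 e2 e3 by (simp add: m_def mult_ac)
  qed
  have T: "T m s = (1 + X ^ m) * T n s + (w (Suc s) - w s)" if s: "s \<in> {1..n}" for s
  proof -
    have e1: "{s<..m} = insert m {s<..n}" using s by (auto simp: m_def)
    have e2: "X ^ (s * Suc m) = X ^ s * X ^ (s * m)" by (simp add: power_add)
    have "T m s = X ^ s * (1 - X ^ m) * T n s"
      unfolding T_def e1 e2 by (simp add: m_def mult_ac)
    then show ?thesis unfolding w1[OF s, symmetric] w2[OF s, symmetric] by (simp add: algebra_simps)
  qed
  have tel: "(\<Sum>s\<in>{1..n}. w (Suc s) - w s) = w m - w 1"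
    using sum_Suc_diff[of 1 n w] by (simp add: m_def)
  \<comment> \<open>The boundary terms finish the induction: \<open>- 2 * w 1\<close> turns
    \<open>D m\<close> into (1 + X^m) \<open>D n\<close>, and \<open>w m + T m m\<close> is
    \<open>M m\<close> times (-1)^m X^(m * m), half of the new term of theta4.\<close>
  have wm: "w m = (- 1) ^ m * X ^ (m * m) * M n"
    unfolding w_def M_def m_def by (simp add: atLeastLessThanSuc_atLeastAtMost)
  have w_1: "w 1 = - (X ^ m) * D n"
    by (simp add: w_def D_def)
  have Tm: "T m m = (- 1) ^ m * X ^ (m * m) * X ^ m * M n"
    unfolding T_def M_def by (simp add: m_def atLeastLessThanSuc_atLeastAtMost power_add mult_ac)
  have sumT: "(\<Sum>s\<in>{1..m}. T m s) = (1 + X ^ m) * (\<Sum>s\<in>{1..n}. T n s) + (w m - w 1) + T m m"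
  proof -
    have "(\<Sum>s\<in>{1..m}. T m s) = (\<Sum>s\<in>{1..n}. T m s) + T m m" by (simp add: m_def)
    also have "(\<Sum>s\<in>{1..n}. T m s) = (\<Sum>s\<in>{1..n}. (1 + X ^ m) * T n s + (w (Suc s) - w s))"
      by (intro sum.cong refl T)
    finally show ?thesis unfolding sum.distrib tel sum_distrib_left .
  qed
  have Mm: "M m = (1 + X ^ m) * M n" and Dm: "D m = (1 - X ^ m) * D n"
    unfolding M_def D_def m_def by (simp_all add: mult.commute)
  have "M m * theta4_partial m = (1 + X ^ m) * (M n * theta4_partial n) +
      2 * ((1 + X ^ m) * ((- 1) ^ m * X ^ (m * m) * M n))"
    unfolding Mm unfolding m_def theta4_partial_Suc X_def by (simp only: algebra_simps)
  also have "\<dots> = D m + 2 * (\<Sum>s\<in>{1..m}. T m s)"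
    unfolding IH sumT Dm wm w_1 Tm by (simp add: algebra_simps)
  finally show ?case unfolding M_def D_def T_def X_def m_def .
qed

text \<open>Division by \<open>D\<close> is possible since its constant term is 1, and it respects
  truncation after the coefficient N.\<close>

lemma fps_mult_truncate_zero:
  fixes D Y :: "int fps"
  assumes "fps_nth D 0 = 1" "\<And>i. i \<le> N \<Longrightarrow> fps_nth (D * Y) i = 0" "i \<le> N"
  shows "fps_nth Y i = 0"
  using assms(3)
proof (induction i rule: less_induct)
  case (less i)
  have "fps_nth (D * Y) i = (\<Sum>j\<in>{0..i}. fps_nth D j * fps_nth Y (i - j))"
    by (simp add: fps_mult_nth)
  also have "\<dots> = (\<Sum>j\<in>{0..i}. if j = 0 then fps_nth Y i else 0)"
    using less assms(1) by (intro sum.cong refl) auto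
  finally show ?case using assms(2)[of i] less.prems by simp
qed

lemma fps_prod_nth_0: "fps_nth (prod f A) 0 = (\<Prod>x\<in>A. fps_nth (f x) 0 :: 'a :: comm_ring_1)"
  by (induction A rule: infinite_finite_induct) simp_all

text \<open>At coefficient N the finite identity for N is already exact: every summand of its
  remainder carries X^(s * Suc N) with s >= 1, and parts larger than N do not occur.\<close>

lemma theta4_mult_overpartition_series: "theta4 * overpartition_series = 1"
proof (rule fps_ext)
  fix N
  define M :: "int fps" where "M = (\<Prod>k\<in>{1..N}. 1 + fps_X ^ k)"
  define D :: "int fps" where "D = (\<Prod>k\<in>{1..N}. 1 - fps_X ^ k)"
  define Y where "Y = theta4_partial N * overpartition_le_series N - 1"
  define R :: "int fps" where "R = (\<Sum>s\<in>{1..N}. (- 1) ^ s * fps_X ^ (s * Suc N) *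
        ((\<Prod>k\<in>{s<..N}. 1 - fps_X ^ k) * (\<Prod>k\<in>{1..<s}. 1 + fps_X ^ k)))"
  have D0: "fps_nth D 0 = 1"
    unfolding D_def fps_prod_nth_0 by (intro prod.neutral) auto
  have R: "fps_nth R i = 0" if "i \<le> N" for i
    unfolding R_def fps_sum_nth
  proof (intro sum.neutral ballI)
    fix s assume s: "s \<in> {1..N}"
    have "Suc N \<le> s * Suc N" using s mult_le_mono1[of 1 s "Suc N"] by simp
    then have "i < s * Suc N" using that by linarith
    then show "fps_nth ((- 1) ^ s * fps_X ^ (s * Suc N) *
        ((\<Prod>k\<in>{s<..N}. 1 - fps_X ^ k) * (\<Prod>k\<in>{1..<s}. 1 + fps_X ^ k))) i = (0 :: int)"
      by (simp only: mult.assoc mult.left_commute[of "(-1) ^ s"] fps_X_power_mult_nth if_True)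
  qed
  have "D * Y = theta4_partial N * (overpartition_le_series N * D) - D"
    by (simp add: Y_def algebra_simps)
  also have "\<dots> = M * theta4_partial N - D"
    using overpartition_le_series_prod[of N] by (simp add: M_def D_def mult.commute)
  also have "\<dots> = 2 * R"
    using theta4_partial_prod[of N] by (simp add: M_def D_def R_def)
  finally have DY: "fps_nth (D * Y) i = 0" if "i \<le> N" for i
    using R[OF that] by (simp add: numeral_fps_const)
  have "fps_nth Y N = 0"
    by (rule fps_mult_truncate_zero[OF D0 DY order_refl])
  moreover have "fps_nth (theta4 * overpartition_series) N
      = fps_nth (theta4_partial N * overpartition_le_series N) N"
    unfolding fps_mult_nth
    by (intro sum.cong refl) (simp add: theta4_partial_nth overpartition_series_nth_eq)
  ultimately show "fps_nth (theta4 * overpartition_series) N = fps_nth 1 N"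
    unfolding Y_def fps_sub_nth by linarith
qed

section \<open>Divisor sums\<close>

definition divisor_series :: "nat \<Rightarrow> int fps" where
  "divisor_series j = Abs_fps (\<lambda>n. \<Sum>d | d dvd n \<and> n > 0. int d ^ j)"

text \<open>The series q^k / (1 - q^k), given by its coefficients so that no division is
  involved.\<close>

definition geo :: "nat \<Rightarrow> int fps" where
  "geo k = Abs_fps (\<lambda>n. if k dvd n \<and> n > 0 then 1 else 0)"

lemma geo_mult: assumes "k > 0" shows "(1 - fps_X ^ k) * geo k = fps_X ^ k"
proof (rule fps_ext)
  fix n
  have "k dvd n - k \<longleftrightarrow> k dvd n" if "k < n" using that by (meson dvd_minus_self nat_less_le not_less)
  then show "fps_nth ((1 - fps_X ^ k) * geo k) n = fps_nth (fps_X ^ k) n"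
    using assms by (auto simp: geo_def algebra_simps fps_X_power_mult_nth dest: dvd_imp_le)
qed

lemma divisor_series_nth_geo:
  assumes "n \<le> N"
  shows "fps_nth (divisor_series j) n = (\<Sum>k\<in>{1..N}. int k ^ j * fps_nth (geo k) n)"
proof -
  have "(\<Sum>k\<in>{1..N}. int k ^ j * fps_nth (geo k) n) = (\<Sum>d | d dvd n \<and> n > 0. int d ^ j)"
  proof (intro sum.mono_neutral_cong_right)
    show "{d. d dvd n \<and> n > 0} \<subseteq> {1..N}"
    proof
      fix d assume "d \<in> {d. d dvd n \<and> n > 0}"
      then show "d \<in> {1..N}" using assms dvd_imp_le[of d n] dvd_pos_nat[of n d] by simp
    qed
  qed (auto simp: geo_def)
  then show ?thesis by (simp add: divisor_series_def)
qed

lemma one_minus_X_power_neq_0: "k > 0 \<Longrightarrow> 1 - fps_X ^ k \<noteq> (0 :: int fps)"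
  by (metis (no_types, opaque_lifting) fps_X_power_nth fps_nonzero_nth_minimal fps_one_nth fps_sub_nth fps_zero_nth diff_0_right neq0_conv zero_neq_one less_not_refl)

text \<open>With x = q^i and y = q^j, clearing denominators leaves (1 - x)(1 - y) + x (1 - y) + y (1
  - x) = 1 - x y.\<close>

lemma geo_mult_geo:
  assumes "i > 0" "j > 0"
  shows "geo i * geo j = geo (i + j) * (1 + geo i + geo j)"
proof -
  define x y :: "int fps" where "x = fps_X ^ i" and "y = fps_X ^ j"
  have xy: "fps_X ^ (i + j) = x * y" by (simp add: x_def y_def power_add)
  have e: "(1 - x) * geo i = x" "(1 - y) * geo j = y" "(1 - x * y) * geo (i + j) = x * y"
    using geo_mult[OF assms(1)] geo_mult[OF assms(2)] geo_mult[of "i + j"] assms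
    unfolding xy by (simp_all add: x_def y_def)
  have nz: "(1 - x) * (1 - y) * (1 - x * y) \<noteq> 0"
    unfolding xy[symmetric] unfolding x_def y_def using assms by (simp add: one_minus_X_power_neq_0 del: right_minus_eq)
  have "((1 - x) * (1 - y) * (1 - x * y)) * (geo i * geo j)
      = (1 - x * y) * (((1 - x) * geo i) * ((1 - y) * geo j))" by (simp only: mult_ac)
  also have "\<dots> = (x * y) * ((1 - x) * (1 - y) + x * (1 - y) + y * (1 - x))"
    unfolding e by (simp add: algebra_simps)
  also have "\<dots> = ((1 - x * y) * geo (i + j)) * ((1 - x) * (1 - y) + ((1 - x) * geo i) * (1 - y) + ((1 - y) * geo j) * (1 - x))"
    unfolding e ..
  also have "\<dots> = ((1 - x) * (1 - y) * (1 - x * y)) * (geo (i + j) * (1 + geo i + geo j))"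
    by (simp add: algebra_simps)
  finally show ?thesis using nz by (metis mult_left_cancel)
qed

lemma theta_geo: assumes "k > 0" shows "fps_theta (geo k) = of_nat k * (geo k + geo k ^ 2)"
proof -
  have e: "(1 - fps_X ^ k) * geo k = fps_X ^ k" by (rule geo_mult[OF assms])
  have t: "fps_theta (fps_X ^ k :: int fps) = of_nat k * fps_X ^ k"
    by (rule fps_ext) (simp add: fps_mult_of_nat_nth)
  have t1: "fps_theta (1 - fps_X ^ k :: int fps) = - of_nat k * fps_X ^ k"
    unfolding fps_theta_diff t by simp
  have "(1 - fps_X ^ k) * fps_theta (geo k) = of_nat k * fps_X ^ k * (1 + geo k)"
    using arg_cong[OF e, of fps_theta] unfolding fps_theta_mult t t1 by (simp add: algebra_simps)
  also have "\<dots> = of_nat k * ((1 - fps_X ^ k) * geo k) * (1 + geo k)" unfolding e ..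
  also have "\<dots> = (1 - fps_X ^ k) * (of_nat k * (geo k + geo k ^ 2))"
    by (simp add: square_simps)
  finally show ?thesis using one_minus_X_power_neq_0[OF assms] by (metis mult_left_cancel)
qed

text \<open>The logarithmic derivative of (1 + q^k) / (1 - q^k) is 2 k q^k / (1 - q^(2k)), and q^k /
  (1 - q^(2k)) is \<open>geo k\<close> minus \<open>geo k\<close> at q^2.\<close>

lemma theta_overpartition_le_series:
  "fps_theta (overpartition_le_series N)
     = 2 * (\<Sum>k\<in>{1..N}. of_nat k * (geo k - fps_V 2 (geo k))) * overpartition_le_series N"
proof (induction N)
  case 0
  then show ?case by (simp add: overpartition_le_series_0)
next
  case (Suc N)
  define k where "k = Suc N"
  define C where "C = overpartition_le_series k"
  define B where "B = overpartition_le_series N"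
  define L where "L = (\<Sum>k\<in>{1..N}. of_nat k * (geo k - fps_V 2 (geo k)))"
  define y :: "int fps" where "y = fps_X ^ k"
  have k: "k > 0" by (simp add: k_def)
  have rec: "(1 - y) * C = (1 + y) * B"
    using overpartition_le_series_rec[of k] by (simp add: y_def C_def B_def k_def)
  have ty: "fps_theta y = of_nat k * y"
    unfolding y_def by (rule fps_ext) (simp add: fps_mult_of_nat_nth)
  have IH: "fps_theta B = 2 * L * B"
    using Suc.IH by (simp add: B_def L_def)
  have g: "(1 - y) * geo k = y" unfolding y_def by (rule geo_mult[OF k])
  have Vy: "fps_V 2 y = y^2"
    unfolding y_def by (rule fps_ext) (auto simp: fps_V_nth simp flip: power_mult)
  have Vg: "(1 - y^2) * fps_V 2 (geo k) = y^2"
    using arg_cong[OF g, of "fps_V 2"] by (simp add: fps_V_simps Vy)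
  have gg: "(1 - y^2) * (geo k - fps_V 2 (geo k)) = y"
  proof -
    have "(1 - y^2) * (geo k - fps_V 2 (geo k)) = (1 + y) * ((1 - y) * geo k) - (1 - y^2) * fps_V 2 (geo k)"
      by (simp add: square_simps)
    then show ?thesis unfolding g Vg by (simp add: square_simps)
  qed
  have "(1 - y) * fps_theta C = of_nat k * y * C + of_nat k * y * B + (1 + y) * fps_theta B"
    using arg_cong[OF rec, of fps_theta] unfolding fps_theta_mult fps_theta_add fps_theta_diff ty
    by (simp add: algebra_simps)
  moreover have "(1 - y^2) * fps_theta C = (1 + y) * ((1 - y) * fps_theta C)"
    by (simp add: square_simps)
  ultimately have "(1 - y^2) * fps_theta C = (1 + y) * (of_nat k * y * C + of_nat k * y * B + (1 + y) * (2 * L * B))"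
    unfolding IH by simp
  also have "\<dots> = of_nat k * y * (1 + y) * C + of_nat k * y * ((1 + y) * B) + 2 * L * (1 + y) * ((1 + y) * B)"
    by (simp add: algebra_simps)
  also have "\<dots> = 2 * of_nat k * y * C + 2 * L * (1 - y^2) * C"
    unfolding rec[symmetric] by (simp add: square_simps)
  also have "\<dots> = 2 * of_nat k * ((1 - y^2) * (geo k - fps_V 2 (geo k))) * C + 2 * L * (1 - y^2) * C"
    unfolding gg ..
  also have "\<dots> = (1 - y^2) * (2 * (L + of_nat k * (geo k - fps_V 2 (geo k))) * C)"
    by (simp add: algebra_simps)
  finally have "fps_theta C = 2 * (L + of_nat k * (geo k - fps_V 2 (geo k))) * C"
    using one_minus_X_power_neq_0[of "k * 2"] k unfolding y_def power_mult[symmetric]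
    by (metis mult_left_cancel mult_pos_pos zero_less_numeral)
  then show ?case by (simp add: L_def C_def k_def)
qed

lemma theta_overpartition_series:
  "fps_theta overpartition_series
     = 2 * (divisor_series 1 - fps_V 2 (divisor_series 1)) * overpartition_series"
proof (rule fps_ext)
  fix N
  have L: "fps_nth (divisor_series 1 - fps_V 2 (divisor_series 1)) i
      = fps_nth (\<Sum>k\<in>{1..N}. of_nat k * (geo k - fps_V 2 (geo k))) i" if "i \<le> N" for i
    using that divisor_series_nth_geo[of i N 1] divisor_series_nth_geo[of "i div 2" N 1]
    by (simp add: fps_sum_nth fps_mult_of_nat_nth fps_V_nth algebra_simps sum_subtractf)
  have "fps_nth (fps_theta overpartition_series) N = fps_nth (fps_theta (overpartition_le_series N)) N"
    by (simp add: overpartition_series_nth_eq)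
  also have "\<dots> = 2 * fps_nth ((\<Sum>k\<in>{1..N}. of_nat k * (geo k - fps_V 2 (geo k))) * overpartition_le_series N) N"
    unfolding theta_overpartition_le_series by (simp add: numeral_fps_const mult.assoc)
  also have "fps_nth ((\<Sum>k\<in>{1..N}. of_nat k * (geo k - fps_V 2 (geo k))) * overpartition_le_series N) N
     = fps_nth ((divisor_series 1 - fps_V 2 (divisor_series 1)) * overpartition_series) N"
    unfolding fps_mult_nth using L
    by (intro sum.cong refl) (simp add: overpartition_series_nth_eq[where N = N])
  finally show "fps_nth (fps_theta overpartition_series) N
     = fps_nth (2 * (divisor_series 1 - fps_V 2 (divisor_series 1)) * overpartition_series) N"
    by (simp add: numeral_fps_const mult.assoc)
qed

lemma sum_square_up_to: "6 * (\<Sum>k\<in>{1..<b}. int k ^ 2) = (int b - 1) * int b * (2 * int b - 1)"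
proof (induction b)
  case (Suc b)
  show ?case
  proof (cases "b = 0")
    case False
    then have "{1..<Suc b} = insert b {1..<b}" by auto
    then have "6 * (\<Sum>k\<in>{1..<Suc b}. int k ^ 2) = 6 * int b ^ 2 + 6 * (\<Sum>k\<in>{1..<b}. int k ^ 2)"
      by simp
    then show ?thesis unfolding Suc.IH by (simp add: square_simps)
  qed simp
qed simp

text \<open>Ramanujan's identity. Writing \<open>4 i j = (i + j)\<^sup>2 - (i - j)\<^sup>2\<close> in the square of
  \<open>\<Sum> k u\<^sub>k\<close>, with \<open>u\<^sub>k = q\<^sup>k / (1 - q\<^sup>k)\<close>, the two sums are evaluated along \<open>i + j = k\<close>
  and \<open>\<bar>i - j\<bar> = k\<close> by means of \<open>u\<^sub>i u\<^sub>j = u\<^sub>i\<^sub>+\<^sub>j (1 + u\<^sub>i + u\<^sub>j)\<close>; the second one telescopes.\<close>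

lemma ramanujan_divisor_series:
  "12 * divisor_series 1 ^ 2 + 6 * fps_theta (divisor_series 1) = 5 * divisor_series 3 + divisor_series 1"
proof (rule fps_ext)
  fix N
  define w where "w i j = fps_nth (geo i * geo j) N" for i j
  define v where "v i = fps_nth (geo i) N" for i
  have geo_small: "fps_nth (geo i) n = 0" if "n < i" for i n
    using that by (auto simp: geo_def dest: dvd_imp_le)
  have w_sym: "w i j = w j i" for i j by (simp add: w_def mult.commute)
  \<comment> \<open>The product of \<open>geo i\<close> and \<open>geo j\<close> starts at q^(i +
    j), so indices up to N suffice.\<close>
  have w0: "w i j = 0" if "N < i + j" for i j
    unfolding w_def fps_mult_nth
  proof (intro sum.neutral ballI)
    fix n assume "n \<in> {0..N}"
    then have "n < i \<or> N - n < j" using that by auto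
    then show "fps_nth (geo i) n * fps_nth (geo j) (N - n) = 0" using geo_small by auto
  qed
  have v0: "v i = 0" if "N < i" for i using that by (simp add: v_def geo_small)
  have rec: "w i j = v (i + j) + w (i + j) i + w (i + j) j" if "i > 0" "j > 0" for i j
    unfolding w_def v_def geo_mult_geo[OF that] by (simp add: algebra_simps)
  have diag: "int k * w k k = int N * v k - int k * v k" if "k > 0" for k
    using arg_cong[OF theta_geo[OF that], of "\<lambda>f. fps_nth f N"]
    unfolding w_def v_def power2_eq_square fps_theta_nth fps_mult_of_nat_nth fps_add_nth distrib_left
    by simp
  define I where "I = {1..N}"
  have fI: "finite I" by (simp add: I_def)

  have plus: "(\<Sum>i\<in>I. \<Sum>j\<in>I. int (i + j) ^ 2 * w i j)
      = (\<Sum>k\<in>I. int k ^ 2 * ((int k - 1) * v k + 2 * (\<Sum>i\<in>{1..<k}. w k i)))"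
  proof -
    have "(\<Sum>i\<in>I. \<Sum>j\<in>I. int (i + j) ^ 2 * w i j) = (\<Sum>(i, j)\<in>I \<times> I. int (i + j) ^ 2 * w i j)"
      by (simp add: sum.cartesian_product)
    also have "\<dots> = (\<Sum>(i, j)\<in>{(i, j). i \<in> I \<and> j \<in> I \<and> i + j \<le> N}. int (i + j) ^ 2 * w i j)"
      by (rule sum.mono_neutral_right) (auto simp: fI, metis w0 not_le)
    also have "\<dots> = (\<Sum>(k, i)\<in>Sigma I (\<lambda>k. {1..<k}). int k ^ 2 * w i (k - i))"
      by (rule sum.reindex_bij_witness[of _ "\<lambda>(k, i). (i, k - i)" "\<lambda>(i, j). (i + j, i)"])
        (auto simp: I_def)
    also have "\<dots> = (\<Sum>k\<in>I. \<Sum>i\<in>{1..<k}. int k ^ 2 * w i (k - i))"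
      by (subst sum.Sigma) (auto simp: fI)
    also have "\<dots> = (\<Sum>k\<in>I. int k ^ 2 * ((int k - 1) * v k + 2 * (\<Sum>i\<in>{1..<k}. w k i)))"
    proof (intro sum.cong refl)
      fix k assume k: "k \<in> I"
      have "(\<Sum>i\<in>{1..<k}. w i (k - i)) = (\<Sum>i\<in>{1..<k}. v k + w k i + w k (k - i))"
        by (intro sum.cong refl) (subst rec, auto)
      also have "\<dots> = (\<Sum>i\<in>{1..<k}. v k) + (\<Sum>i\<in>{1..<k}. w k i) + (\<Sum>i\<in>{1..<k}. w k (k - i))"
        by (simp add: sum.distrib)
      also have "(\<Sum>i\<in>{1..<k}. w k (k - i)) = (\<Sum>i\<in>{1..<k}. w k i)"
        by (rule sum.reindex_bij_witness[of _ "\<lambda>i. k - i" "\<lambda>i. k - i"]) auto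
      also have "(\<Sum>i\<in>{1..<k}. v k) = (int k - 1) * v k"
        using k by (simp add: I_def of_nat_diff)
      finally have "(\<Sum>i\<in>{1..<k}. w i (k - i)) = (int k - 1) * v k + 2 * (\<Sum>i\<in>{1..<k}. w k i)" by simp
      then show "(\<Sum>i\<in>{1..<k}. int k ^ 2 * w i (k - i))
          = int k ^ 2 * ((int k - 1) * v k + 2 * (\<Sum>i\<in>{1..<k}. w k i))"
        by (simp only: sum_distrib_left[symmetric])
    qed
    finally show ?thesis .
  qed

  have minus: "(\<Sum>i\<in>I. \<Sum>j\<in>I. (int i - int j) ^ 2 * w i j)
      = (\<Sum>k\<in>I. int k ^ 2 * (2 * ((\<Sum>i\<in>{1..<k}. w k i) + w k k - (\<Sum>b\<in>{k<..N}. v b))))"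
  proof -
    define G where "G = {(i, j). i \<in> I \<and> j \<in> I \<and> j < i}"
    define L where "L = {(i, j). i \<in> I \<and> j \<in> I \<and> i < j}"
    have finG: "finite G" "finite L"
      by (rule finite_subset[of _ "I \<times> I"]; auto simp: G_def L_def fI)+
    have "(\<Sum>i\<in>I. \<Sum>j\<in>I. (int i - int j) ^ 2 * w i j) = (\<Sum>(i, j)\<in>I \<times> I. (int i - int j) ^ 2 * w i j)"
      by (simp add: sum.cartesian_product)
    also have "\<dots> = (\<Sum>(i, j)\<in>G \<union> L. (int i - int j) ^ 2 * w i j)"
      by (rule sum.mono_neutral_right) (auto simp: fI G_def L_def)
    also have "\<dots> = (\<Sum>(i, j)\<in>G. (int i - int j) ^ 2 * w i j) + (\<Sum>(i, j)\<in>L. (int i - int j) ^ 2 * w i j)"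
      by (rule sum.union_disjoint) (auto simp: finG, auto simp: G_def L_def)
    also have "(\<Sum>(i, j)\<in>L. (int i - int j) ^ 2 * w i j) = (\<Sum>(i, j)\<in>G. (int i - int j) ^ 2 * w i j)"
      by (rule sum.reindex_bij_witness[of _ prod.swap prod.swap])
        (auto simp: G_def L_def w_sym power2_commute)
    also have "(\<Sum>(i, j)\<in>G. (int i - int j) ^ 2 * w i j) = (\<Sum>(k, b)\<in>{(k, b). k \<in> I \<and> b \<in> I \<and> k + b \<le> N}. int k ^ 2 * w (k + b) b)"
      by (rule sum.reindex_bij_witness[of _ "\<lambda>(k, b). (k + b, b)" "\<lambda>(i, j). (i - j, j)"])
        (auto simp: G_def I_def of_nat_diff)
    also have "\<dots> = (\<Sum>(k, b)\<in>I \<times> I. int k ^ 2 * w (k + b) b)"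
      by (rule sum.mono_neutral_left) (auto simp: fI, metis w0 not_le trans_less_add1)
    also have "\<dots> = (\<Sum>k\<in>I. int k ^ 2 * (\<Sum>b\<in>I. w (k + b) b))"
      by (simp add: sum.cartesian_product sum_distrib_left)
    also have "\<dots> = (\<Sum>k\<in>I. int k ^ 2 * ((\<Sum>i\<in>{1..<k}. w k i) + w k k - (\<Sum>b\<in>{k<..N}. v b)))"
    proof (intro sum.cong refl)
      fix k assume k: "k \<in> I"
      have sh: "(\<Sum>b\<in>I. h (k + b)) = (\<Sum>b\<in>{k<..N}. h b)" if "\<And>b. b > N \<Longrightarrow> h b = 0" for h :: "nat \<Rightarrow> int"
      proof -
        have "(\<Sum>b\<in>I. h (k + b)) = (\<Sum>b\<in>{k<..k + N}. h b)"
          by (rule sum.reindex_bij_witness[of _ "\<lambda>b. b - k" "\<lambda>b. k + b"]) (auto simp: I_def)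
        also have "\<dots> = (\<Sum>b\<in>{k<..N}. h b)"
          by (rule sum.mono_neutral_right) (auto simp: that)
        finally show ?thesis .
      qed
      \<comment> \<open>By \<open>rec\<close> the summand is a difference of w at b and at k + b, up
        to v. Summed over b, everything beyond b = k cancels except the tail of v.\<close>
      have "(\<Sum>b\<in>I. w (k + b) b) = (\<Sum>b\<in>I. w k b - v (k + b) - w (k + b) k)"
        using k by (intro sum.cong refl) (subst rec[of k], auto simp: I_def)
      also have "\<dots> = (\<Sum>b\<in>I. w k b) - (\<Sum>b\<in>I. v (k + b)) - (\<Sum>b\<in>I. w (k + b) k)"
        by (simp add: sum_subtractf)
      also have "(\<Sum>b\<in>I. v (k + b)) = (\<Sum>b\<in>{k<..N}. v b)" by (rule sh) (rule v0)
      also have "(\<Sum>b\<in>I. w (k + b) k) = (\<Sum>b\<in>{k<..N}. w b k)" by (rule sh) (rule w0, simp)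
      also have "\<dots> = (\<Sum>b\<in>{k<..N}. w k b)" by (simp add: w_sym)
      also have "(\<Sum>b\<in>I. w k b) = (\<Sum>i\<in>{1..<k}. w k i) + w k k + (\<Sum>b\<in>{k<..N}. w k b)"
      proof -
        have "I = {1..<k} \<union> insert k {k<..N}" using k by (auto simp: I_def)
        then have "(\<Sum>b\<in>I. w k b) = (\<Sum>i\<in>{1..<k}. w k i) + (\<Sum>b\<in>insert k {k<..N}. w k b)"
          by (simp only:) (rule sum.union_disjoint, auto)
        then show ?thesis by simp
      qed
      finally have "(\<Sum>b\<in>I. w (k + b) b) = (\<Sum>i\<in>{1..<k}. w k i) + w k k - (\<Sum>b\<in>{k<..N}. v b)" by simp
      then show "int k ^ 2 * (\<Sum>b\<in>I. w (k + b) b)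
          = int k ^ 2 * ((\<Sum>i\<in>{1..<k}. w k i) + w k k - (\<Sum>b\<in>{k<..N}. v b))" by simp
    qed
    finally show ?thesis by (simp add: sum.distrib[symmetric] algebra_simps)
  qed

  have tail: "6 * (\<Sum>k\<in>I. int k ^ 2 * (\<Sum>b\<in>{k<..N}. v b)) = (\<Sum>b\<in>I. (int b - 1) * int b * (2 * int b - 1) * v b)"
  proof -
    have "(\<Sum>k\<in>I. int k ^ 2 * (\<Sum>b\<in>{k<..N}. v b)) = (\<Sum>(k, b)\<in>Sigma I (\<lambda>k. {k<..N}). int k ^ 2 * v b)"
      by (subst sum.Sigma[symmetric]) (auto simp: fI sum_distrib_left)
    also have "\<dots> = (\<Sum>(b, k)\<in>Sigma I (\<lambda>b. {1..<b}). int k ^ 2 * v b)"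
      by (rule sum.reindex_bij_witness[of _ prod.swap prod.swap]) (auto simp: I_def)
    also have "\<dots> = (\<Sum>b\<in>I. (\<Sum>k\<in>{1..<b}. int k ^ 2) * v b)"
      by (subst sum.Sigma[symmetric]) (auto simp: fI sum_distrib_right)
    finally have e: "(\<Sum>k\<in>I. int k ^ 2 * (\<Sum>b\<in>{k<..N}. v b)) = (\<Sum>b\<in>I. (\<Sum>k\<in>{1..<b}. int k ^ 2) * v b)" .
    show ?thesis
      unfolding e sum_distrib_left[of 6 _ I]
      by (intro sum.cong refl) (simp only: mult.assoc[symmetric] sum_square_up_to)
  qed

  have sq: "fps_nth (divisor_series 1 ^ 2) N = (\<Sum>i\<in>I. \<Sum>j\<in>I. int i * int j * w i j)"
  proof -
    have "fps_nth (divisor_series 1 ^ 2) N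
       = (\<Sum>n\<in>{0..N}. (\<Sum>i\<in>I. int i * fps_nth (geo i) n) * (\<Sum>j\<in>I. int j * fps_nth (geo j) (N - n)))"
      unfolding power2_eq_square fps_mult_nth I_def
      by (intro sum.cong refl arg_cong2[of _ _ _ _ "(*)"]) (subst divisor_series_nth_geo[of _ N], auto)+
    also have "\<dots> = (\<Sum>n\<in>{0..N}. \<Sum>i\<in>I. \<Sum>j\<in>I. int i * int j * (fps_nth (geo i) n * fps_nth (geo j) (N - n)))"
      by (intro sum.cong refl) (simp add: sum_product mult_ac)
    also have "\<dots> = (\<Sum>i\<in>I. \<Sum>j\<in>I. \<Sum>n\<in>{0..N}. int i * int j * (fps_nth (geo i) n * fps_nth (geo j) (N - n)))"
      by (subst sum.swap) (intro sum.cong refl sum.swap)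
    also have "\<dots> = (\<Sum>i\<in>I. \<Sum>j\<in>I. int i * int j * w i j)"
      by (simp add: w_def fps_mult_nth sum_distrib_left)
    finally show ?thesis .
  qed
  have "4 * fps_nth (divisor_series 1 ^ 2) N
      = (\<Sum>i\<in>I. \<Sum>j\<in>I. int (i + j) ^ 2 * w i j) - (\<Sum>i\<in>I. \<Sum>j\<in>I. (int i - int j) ^ 2 * w i j)"
    unfolding sq sum_distrib_left sum_subtractf[symmetric]
    by (intro sum.cong refl) (simp add: square_simps)
  \<comment> \<open>The unknown sums of \<open>w k i\<close> over i < k cancel. There remain
    \<open>w k k\<close>, which \<open>diag\<close> evaluates, and the tails of v, which
    \<open>tail\<close> evaluates.\<close>
  also have "\<dots> = (\<Sum>k\<in>I. int k ^ 2 * (int k - 1) * v k - 2 * int k * (int k * w k k) + 2 * (int k ^ 2 * (\<Sum>b\<in>{k<..N}. v b)))"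
    unfolding plus minus sum_subtractf[symmetric]
    by (intro sum.cong refl) (simp add: square_simps)
  also have "\<dots> = (\<Sum>k\<in>I. int k ^ 2 * (int k - 1) * v k - 2 * int k * (int N * v k - int k * v k)) + 2 * (\<Sum>k\<in>I. int k ^ 2 * (\<Sum>b\<in>{k<..N}. v b))"
    unfolding sum.distrib sum_distrib_left
    by (intro arg_cong2[of _ _ _ _ "(+)"] sum.cong refl) (subst diag, auto simp: I_def)
  finally have "12 * fps_nth (divisor_series 1 ^ 2) N
      = 3 * (\<Sum>k\<in>I. int k ^ 2 * (int k - 1) * v k - 2 * int k * (int N * v k - int k * v k))
        + (\<Sum>b\<in>I. (int b - 1) * int b * (2 * int b - 1) * v b)"
    using tail by simp
  also have "\<dots> = (\<Sum>k\<in>I. 5 * (int k ^ 3 * v k) + int k ^ 1 * v k - 6 * int N * (int k ^ 1 * v k))"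
    unfolding sum_distrib_left sum.distrib[symmetric]
    by (intro sum.cong refl) (simp add: power2_eq_square power3_eq_cube algebra_simps)
  also have "\<dots> = 5 * fps_nth (divisor_series 3) N + fps_nth (divisor_series 1) N - 6 * int N * fps_nth (divisor_series 1) N"
    unfolding sum.distrib sum_subtractf sum_distrib_left[symmetric] divisor_series_nth_geo[OF order_refl] v_def I_def ..
  finally show "fps_nth (12 * divisor_series 1 ^ 2 + 6 * fps_theta (divisor_series 1)) N
      = fps_nth (5 * divisor_series 3 + divisor_series 1) N"
    by (simp add: numeral_fps_const)
qed

section \<open>Derivatives of theta functions and Eisenstein series\<close>

lemma fps_V_V: "j > 0 \<Longrightarrow> k > 0 \<Longrightarrow> fps_V j (fps_V k f) = fps_V (j * k) f"
  by (rule fps_ext)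
    (auto simp: fps_V_nth div_mult2_eq dvd_mult_left elim!: dvdE intro: dvd_mult_right)

text \<open>Descent from n to n/2. With m = 0 it shows that f - f(q^2) determines f up to its
  constant term; with m prime it makes a series that is invariant under q -> q^2 modulo m constant
  modulo m.\<close>

lemma dvd_nth_of_dvd_diff_V2:
  fixes m :: int
  assumes "\<And>n. m dvd fps_nth (f - fps_V 2 f) n" "n > 0"
  shows "m dvd fps_nth f n"
  using assms(2)
proof (induction n rule: less_induct)
  case (less n)
  have d: "m dvd fps_nth f n - (if even n then fps_nth f (n div 2) else 0)"
    using assms(1)[of n] by (simp add: fps_V_nth)
  show ?case
  proof (cases "even n")
    case True
    then have "m dvd fps_nth f (n div 2)" using less by (intro less.IH) auto
    then show ?thesis using d True by (metis dvd_diff_commute dvd_add_right_iff diff_add_cancel)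
  qed (use d in simp)
qed

lemma fps_eq_of_eq_V2:
  fixes f g :: "int fps"
  assumes "f - fps_V 2 f = g - fps_V 2 g" "fps_nth f 0 = fps_nth g 0"
  shows "f = g"
proof (rule fps_ext)
  fix n
  have "(f - g) - fps_V 2 (f - g) = 0" using assms(1) by (simp add: fps_V_diff algebra_simps)
  then show "fps_nth f n = fps_nth g n"
    using dvd_nth_of_dvd_diff_V2[of 0 "f - g" n] assms(2) by (cases "n = 0") auto
qed

text \<open>The same descent; the factor 4 kills the constant term as well.\<close>

lemma fps_eq_0_of_eq_4_V2:
  fixes f :: "int fps"
  assumes "f = 4 * fps_V 2 f"
  shows "f = 0"
proof (rule fps_ext)
  fix n
  have e: "fps_nth f n = (if even n then 4 * fps_nth f (n div 2) else 0)" for n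
    by (subst assms) (simp add: numeral_fps_const fps_V_nth)
  show "fps_nth f n = fps_nth 0 n"
  proof (induction n rule: less_induct)
    case (less n)
    then show ?case using e[of n] by (cases "n = 0") auto
  qed
qed

lemma fps_numeral_cancel: "numeral k * f = numeral k * g \<Longrightarrow> f = (g :: int fps)"
  by simp

section \<open>Inverses and logarithmic derivatives of the theta series\<close>

definition theta3_inv :: "int fps" where
  "theta3_inv = fps_compose overpartition_series (fps_const (- 1) * fps_X)"

lemma theta3_eq_compose: "theta3 = fps_compose theta4 (fps_const (- 1) * fps_X)"
proof (rule fps_ext)
  fix n
  have "(\<Sum>x\<in>{x. x^2 = int n}. (- 1) ^ n * (if even x then 1 else - 1)) = (\<Sum>x\<in>{x. x^2 = int n}. 1 :: int)"
  proof (intro sum.cong refl)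
    fix x assume "x \<in> {x. x^2 = int n}"
    then have "x^2 = int n" by simp
    then have "even x \<longleftrightarrow> even n" by (metis even_of_nat even_power zero_less_numeral)
    then show "(- 1) ^ n * (if even x then 1 else - 1) = (1 :: int)" by auto
  qed
  then show "fps_nth theta3 n = fps_nth (fps_compose theta4 (fps_const (- 1) * fps_X)) n"
    unfolding fps_nth_compose_linear theta3_def theta4_def sq_series_def fps_nth_Abs_fps sum_distrib_left by simp
qed

lemma theta3_mult_inv: "theta3 * theta3_inv = 1"
  unfolding theta3_eq_compose theta3_inv_def
  by (simp flip: fps_compose_mult_distrib add: theta4_mult_overpartition_series)

lemma sq_series_0: "fps_nth (sq_series w) 0 = w 0"
  by (simp add: sq_series_def)

lemma sq_series_1: "fps_nth (sq_series w) 1 = w 1 + w (- 1)"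
proof -
  have "{x :: int. x^2 = 1} = {1, - 1}" by (auto simp: power2_eq_1_iff)
  then show ?thesis by (simp add: sq_series_def)
qed

lemma theta_nths:
  "fps_nth theta3 0 = 1" "fps_nth theta3 1 = 2" "fps_nth theta4 0 = 1" "fps_nth theta4 1 = - 2"
  by (simp_all only: theta3_def theta4_def sq_series_0 sq_series_1) simp_all

abbreviation (input) thA :: "int fps" where "thA \<equiv> theta3^2"
abbreviation (input) thB :: "int fps" where "thB \<equiv> theta4^2"

text \<open>Logarithmic derivatives with respect to q d/dq. Division is multiplication by the
  inverse series, which for theta4 is \<open>overpartition_series\<close>, so everything stays
  integral.\<close>

definition dlog3 :: "int fps" where "dlog3 = theta3_inv * fps_theta theta3"
definition dlog4 :: "int fps" where "dlog4 = overpartition_series * fps_theta theta4"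

lemma fps_theta_theta3: "fps_theta theta3 = dlog3 * theta3"
  using theta3_mult_inv by (simp add: dlog3_def mult_ac)

lemma fps_theta_theta4: "fps_theta theta4 = dlog4 * theta4"
  using theta4_mult_overpartition_series by (simp add: dlog4_def mult_ac)

lemma theta_nonzero: "theta3 \<noteq> 0" "theta4 \<noteq> 0"
  using theta_nths by auto

lemma fps_theta_thA: "fps_theta thA = 2 * dlog3 * thA"
  by (simp add: power2_eq_square fps_theta_mult fps_theta_theta3 algebra_simps)

lemma fps_theta_thB: "fps_theta thB = 2 * dlog4 * thB"
  by (simp add: power2_eq_square fps_theta_mult fps_theta_theta4 algebra_simps)

lemma fps_theta_thA_sq: "fps_theta (thA^2) = 4 * dlog3 * thA^2"
  unfolding power2_eq_square[of thA] fps_theta_mult[of thA] fps_theta_thA by Groebner_Basis.algebra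

lemma fps_theta_thB_sq: "fps_theta (thB^2) = 4 * dlog4 * thB^2"
  unfolding power2_eq_square[of thB] fps_theta_mult[of thB] fps_theta_thB by Groebner_Basis.algebra

lemma V2_thB_sq: "(fps_V 2 thB)^2 = thA * thB"
  unfolding theta_landen_mult[symmetric] by (simp add: power_mult_distrib)

lemma V2_dlog4: "4 * fps_V 2 dlog4 = dlog3 + dlog4"
proof -
  have "fps_theta (fps_V 2 thB) = 2 * fps_V 2 (fps_theta thB)"
    by (simp add: fps_theta_V)
  also have "\<dots> = 4 * fps_V 2 dlog4 * fps_V 2 thB"
    by (simp add: fps_theta_thB fps_V_mult)
  finally have "(4 * fps_V 2 dlog4) * (theta3 * theta4) = (dlog3 + dlog4) * (theta3 * theta4)"
    unfolding theta_landen_mult[symmetric] fps_theta_mult fps_theta_theta3 fps_theta_theta4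
    by (simp add: algebra_simps)
  then show ?thesis using theta_nonzero by simp
qed

lemma V2_dlog3_mult: "2 * fps_V 2 dlog3 * (thA + thB) = dlog3 * thA + dlog4 * thB"
proof -
  have "fps_theta (2 * fps_V 2 thA) = 4 * fps_V 2 (fps_theta thA)"
    by (simp add: fps_theta_V fps_theta_mult)
  also have "\<dots> = 4 * fps_V 2 dlog3 * (2 * fps_V 2 thA)"
    by (simp add: fps_theta_thA fps_V_mult)
  finally have "2 * (2 * fps_V 2 dlog3 * (thA + thB)) = 2 * (dlog3 * thA + dlog4 * thB)"
    unfolding theta_landen_add[symmetric] fps_theta_add fps_theta_thA fps_theta_thB
    by (simp add: algebra_simps)
  then show ?thesis by (rule fps_numeral_cancel)
qed

text \<open>If Y had order n >= 2, the left side of \<open>eq\<close> would have order at least 2 n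
  > n + 1, whereas the right side has order exactly n + 1.\<close>

lemma fps_eq_0_of_landen:
  fixes Y c d :: "int fps"
  assumes eq: "c * fps_V 2 Y = d * Y" and d: "fps_nth d 0 = 0" "fps_nth d 1 \<noteq> 0"
    and Y: "fps_nth Y 0 = 0" "fps_nth Y 1 = 0"
  shows "Y = 0"
proof (rule ccontr)
  assume "Y \<noteq> 0"
  then obtain n where n: "fps_nth Y n \<noteq> 0" "\<And>i. i < n \<Longrightarrow> fps_nth Y i = 0"
    using fps_nonzero_nth_minimal[of Y] by auto
  have "n \<noteq> 0" "n \<noteq> 1" using n(1) Y by metis+
  then have n2: "n \<ge> 2" by simp
  have "fps_nth (c * fps_V 2 Y) (Suc n) = 0"
    unfolding fps_mult_nth using n2 by (intro sum.neutral ballI) (auto simp: fps_V_nth intro!: n(2))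
  moreover
  have "fps_nth (d * Y) (Suc n) = (\<Sum>i\<in>{0..Suc n}. if i = 1 then fps_nth d 1 * fps_nth Y n else 0)"
    unfolding fps_mult_nth
  proof (intro sum.cong refl)
    fix i assume i: "i \<in> {0..Suc n}"
    consider "i = 0" | "i = 1" | "i \<ge> 2" by linarith
    then show "fps_nth d i * fps_nth Y (Suc n - i) = (if i = 1 then fps_nth d 1 * fps_nth Y n else 0)"
      using i d(1) n(2) by cases auto
  qed
  then have "fps_nth (d * Y) (Suc n) = fps_nth d 1 * fps_nth Y n"
    by (subst (asm) sum.delta) auto
  ultimately show False using eq d(2) n(1) by simp
qed

text \<open>The difference of both sides is multiplied by a known factor under \<open>q \<mapsto> q\<^sup>2\<close>; this leaves
  room for a multiple of one series only, which the coefficient of \<open>q\<close> excludes.\<close>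

lemma dlog4_minus_dlog3: "4 * (dlog4 - dlog3) = thB^2 - thA^2"
proof -
  define Y where "Y = 4 * (dlog4 - dlog3) + (thA^2 - thB^2)"
  have "fps_V 2 Y = 4 * (fps_V 2 dlog4 - fps_V 2 dlog3) + ((fps_V 2 thA)^2 - thA * thB)"
    unfolding V2_thB_sq[symmetric] by (simp add: Y_def fps_V_simps)
  then have "4 * (4 * (thA + thB) * fps_V 2 Y) = 4 * ((thA - thB) * Y)"
    using V2_dlog4 V2_dlog3_mult theta_landen_add Y_def by Groebner_Basis.algebra
  then have "4 * (thA + thB) * fps_V 2 Y = (thA - thB) * Y" by (rule fps_numeral_cancel)
  moreover have inv_nths: "fps_nth theta3_inv 0 = 1" "fps_nth overpartition_series 0 = 1"
    using arg_cong[OF theta3_mult_inv, of "\<lambda>f. fps_nth f 0"] theta_nths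
      arg_cong[OF theta4_mult_overpartition_series, of "\<lambda>f. fps_nth f 0"]
    unfolding fps_mult_nth_0 by simp_all
  moreover have "fps_nth Y 0 = 0"
    using theta_nths by (simp add: Y_def dlog3_def dlog4_def power2_eq_square numeral_fps_const)
  moreover have "fps_nth Y 1 = 0"
    using theta_nths inv_nths
    by (simp add: Y_def dlog3_def dlog4_def power2_eq_square numeral_fps_const fps_mult_nth_1)
  moreover have "fps_nth (thA - thB) 0 = 0" "fps_nth (thA - thB) 1 \<noteq> 0"
    using theta_nths by (simp_all add: power2_eq_square fps_mult_nth_1)
  ultimately have "Y = 0" by (intro fps_eq_0_of_landen[of "4 * (thA + thB)" Y "thA - thB"])
  then show ?thesis unfolding Y_def by (simp add: algebra_simps)
qed

section \<open>Eisenstein series and sums of four squares\<close>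

definition eisen2 :: "int fps" where "eisen2 = 1 - 24 * divisor_series 1"

lemma dlog4_eq: "12 * dlog4 = eisen2 - fps_V 2 eisen2"
proof -
  define G where "G = divisor_series 1"
  have "fps_theta (theta4 * overpartition_series) = 0"
    by (simp add: theta4_mult_overpartition_series)
  then have "dlog4 + theta4 * (2 * (G - fps_V 2 G) * overpartition_series) = 0"
    unfolding fps_theta_mult theta_overpartition_series dlog4_def G_def by (simp add: mult.commute)
  then have "dlog4 = - (2 * (G - fps_V 2 G))"
    using theta4_mult_overpartition_series by Groebner_Basis.algebra
  moreover have "fps_V 2 eisen2 = 1 - 24 * fps_V 2 G"
    by (simp add: eisen2_def G_def fps_V_simps)
  ultimately show ?thesis using eisen2_def G_def by Groebner_Basis.algebra
qed

text \<open>A series is determined by its constant term and by its difference with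
  \<open>fps_V 2\<close> of it. That difference is \<open>12 * dlog4\<close> for both sides.\<close>

lemma eisen2_eq: "eisen2 = 24 * dlog4 + 2 * thA^2 - thB^2"
proof -
  define R where "R = 24 * dlog4 + 2 * thA^2 - thB^2"
  have "fps_V 2 R = 24 * fps_V 2 dlog4 + 2 * (fps_V 2 thA)^2 - thA * thB"
    unfolding V2_thB_sq[symmetric] by (simp add: R_def fps_V_simps)
  then have "2 * (R - fps_V 2 R) = 2 * (12 * dlog4)"
    using V2_dlog4 theta_landen_add dlog4_minus_dlog3 R_def by Groebner_Basis.algebra
  then have "R - fps_V 2 R = 12 * dlog4" by (rule fps_numeral_cancel)
  then have "R - fps_V 2 R = eisen2 - fps_V 2 eisen2"
    using dlog4_eq by simp
  moreover have "fps_nth R 0 = fps_nth eisen2 0"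
    using theta_nths by (simp add: R_def eisen2_def divisor_series_def dlog4_def power2_eq_square numeral_fps_const)
  ultimately show ?thesis using fps_eq_of_eq_V2[of R eisen2] by (simp add: R_def)
qed

lemma V2_eisen2: "fps_V 2 eisen2 = 12 * dlog4 + 2 * thA^2 - thB^2"
  using dlog4_eq eisen2_eq by Groebner_Basis.algebra

lemma V4_eisen2: "4 * fps_V 4 eisen2 = 24 * dlog4 + 5 * thA^2 - thB^2"
proof -
  have "fps_V 4 eisen2 = fps_V 2 (eisen2 - 12 * dlog4)"
    using dlog4_eq fps_V_V[of 2 2 eisen2] by simp
  also have "\<dots> = fps_V 2 eisen2 - 12 * fps_V 2 dlog4"
    by (simp add: fps_V_simps)
  finally have "fps_V 4 eisen2 = 12 * dlog4 + 2 * thA^2 - thB^2 - 12 * fps_V 2 dlog4"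
    unfolding V2_eisen2 .
  then show ?thesis using V2_dlog4 dlog4_minus_dlog3 by Groebner_Basis.algebra
qed

text \<open>In 4 E_2(q^4) - E_2(q) the term \<open>dlog4\<close>, which is not a polynomial in theta
  series, cancels and 3 theta3^4 is left.\<close>

lemma jacobi_four_squares: "thA^2 = 1 + 8 * divisor_series 1 - 32 * fps_V 4 (divisor_series 1)"
proof -
  have "3 * thA^2 = 4 * fps_V 4 eisen2 - eisen2"
    using V4_eisen2 eisen2_eq by Groebner_Basis.algebra
  also have "\<dots> = 3 * (1 + 8 * divisor_series 1 - 32 * fps_V 4 (divisor_series 1))"
    by (simp add: eisen2_def fps_V_simps algebra_simps)
  finally show ?thesis by (rule fps_numeral_cancel)
qed

lemma jacobi_four_squares_signed:
  "thB^2 = 1 - 8 * divisor_series 1 + 48 * fps_V 2 (divisor_series 1) - 64 * fps_V 4 (divisor_series 1)"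
proof -
  have "3 * thB^2 = eisen2 - 6 * fps_V 2 eisen2 + 8 * fps_V 4 eisen2"
    using V4_eisen2 V2_eisen2 eisen2_eq by Groebner_Basis.algebra
  also have "\<dots> = 3 * (1 - 8 * divisor_series 1 + 48 * fps_V 2 (divisor_series 1) - 64 * fps_V 4 (divisor_series 1))"
    by (simp add: eisen2_def fps_V_simps algebra_simps)
  finally show ?thesis by (rule fps_numeral_cancel)
qed

lemma V2_dlog3: "8 * fps_V 2 dlog3 = 4 * dlog3 - thB * (thA - thB)"
proof -
  have "(thA + thB) * (8 * fps_V 2 dlog3) = (thA + thB) * (4 * dlog3 - thB * (thA - thB))"
    using V2_dlog3_mult dlog4_minus_dlog3 by Groebner_Basis.algebra
  moreover have "fps_nth (thA + thB) 0 \<noteq> 0" using theta_nths by (simp add: power2_eq_square)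
  then have "thA + thB \<noteq> 0" by (metis fps_zero_nth)
  ultimately show ?thesis by simp
qed

text \<open>The nonlinear form of the hypergeometric equation satisfied by \<open>theta3\<^sup>2\<close>.\<close>

lemma fps_theta_dlog3: "8 * (fps_theta dlog3 - 2 * dlog3^2) = (thA^2 - thB^2) * thB^2"
proof -
  define Z where "Z = 8 * (fps_theta dlog3 - 2 * dlog3^2) - (thA^2 - thB^2) * thB^2"
  have V: "fps_V 2 Z = 8 * (fps_V 2 (fps_theta dlog3) - 2 * (fps_V 2 dlog3)^2)
      - ((fps_V 2 thA)^2 - thA * thB) * (thA * thB)"
    unfolding V2_thB_sq[symmetric] by (simp add: Z_def fps_V_simps)
  have "fps_theta (8 * fps_V 2 dlog3) = 16 * fps_V 2 (fps_theta dlog3)"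
    by (simp add: fps_theta_V fps_theta_mult)
  then have T: "16 * fps_V 2 (fps_theta dlog3) = 4 * fps_theta dlog3
      - (2 * dlog4 * thB * (thA - thB) + thB * (2 * dlog3 * thA - 2 * dlog4 * thB))"
    unfolding V2_dlog3 by (simp add: fps_theta_diff fps_theta_mult[of thB] fps_theta_thA fps_theta_thB fps_theta_mult[of 4])
  have "16 * Z = 16 * (4 * fps_V 2 Z)"
    using V T V2_dlog3 theta_landen_add dlog4_minus_dlog3 Z_def by Groebner_Basis.algebra
  then have "Z = 4 * fps_V 2 Z" by (rule fps_numeral_cancel)
  then have "Z = 0" by (rule fps_eq_0_of_eq_4_V2)
  then show ?thesis by (simp add: Z_def)
qed

lemma fps_theta_dlog4: "8 * (fps_theta dlog4 - 2 * dlog4^2) = - ((thA^2 - thB^2) * thA^2)"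
proof -
  have "fps_theta (4 * (dlog4 - dlog3)) = 4 * (fps_theta dlog4 - fps_theta dlog3)"
    by (simp add: fps_theta_mult fps_theta_diff)
  then have "4 * (fps_theta dlog4 - fps_theta dlog3) = 4 * dlog4 * thB^2 - 4 * dlog3 * thA^2"
    unfolding dlog4_minus_dlog3 fps_theta_diff fps_theta_thA_sq fps_theta_thB_sq by simp
  then show ?thesis using fps_theta_dlog3 dlog4_minus_dlog3 by Groebner_Basis.algebra
qed

definition eisen4 :: "int fps" where "eisen4 = 1 + 240 * divisor_series 3"

text \<open>Ramanujan's differential equation for E_2, a rescaling of
  \<open>ramanujan_divisor_series\<close>. It transfers the knowledge of E_2 and its derivative to
  E_4.\<close>

lemma eisen4_eq_eisen2: "eisen4 = eisen2^2 - 12 * fps_theta eisen2"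
proof -
  have "fps_theta eisen2 = - (24 * fps_theta (divisor_series 1))"
    by (simp add: eisen2_def fps_theta_diff fps_theta_mult)
  then show ?thesis
    using ramanujan_divisor_series eisen4_def eisen2_def by Groebner_Basis.algebra
qed

lemma eisen4_eq: "eisen4 = 16 * thA^4 - 16 * thA^2 * thB^2 + thB^4"
proof -
  have "fps_theta eisen2 = 24 * fps_theta dlog4 + 8 * dlog3 * thA^2 - 4 * dlog4 * thB^2"
    unfolding eisen2_eq fps_theta_diff fps_theta_add fps_theta_mult[of 2] fps_theta_mult[of 24]
      fps_theta_thA_sq fps_theta_thB_sq by simp
  then show ?thesis
    using eisen4_eq_eisen2 eisen2_eq fps_theta_dlog4 dlog4_minus_dlog3 by Groebner_Basis.algebra
qed

lemma V4_eisen4: "16 * fps_V 4 eisen4 = thA^4 + 14 * thA^2 * thB^2 + thB^4"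
proof -
  have "fps_theta (4 * fps_V 4 eisen2) = 16 * fps_V 4 (fps_theta eisen2)"
    by (simp add: fps_theta_V fps_theta_mult)
  then have "16 * fps_V 4 (fps_theta eisen2) = 24 * fps_theta dlog4 + 20 * dlog3 * thA^2 - 4 * dlog4 * thB^2"
    unfolding V4_eisen2 fps_theta_diff fps_theta_add fps_theta_mult[of 5] fps_theta_mult[of 24]
      fps_theta_thA_sq fps_theta_thB_sq by (simp add: mult.assoc)
  moreover have "fps_V 4 eisen4 = (fps_V 4 eisen2)^2 - 12 * fps_V 4 (fps_theta eisen2)"
    by (simp add: eisen4_eq_eisen2 fps_V_simps)
  ultimately show ?thesis
    using V4_eisen2 fps_theta_dlog4 dlog4_minus_dlog3 by Groebner_Basis.algebra
qed

section \<open>Reduction modulo m\<close>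

text \<open>Divisibility in the ring of series lets a congruence be certified by an explicit
  quotient, as in \<open>fps_congI\<close>.\<close>

definition fps_cong :: "nat \<Rightarrow> int fps \<Rightarrow> int fps \<Rightarrow> bool" where
  "fps_cong m f g \<longleftrightarrow> of_nat m dvd f - g"

lemma of_nat_dvd_fps_iff: "(of_nat m :: int fps) dvd f \<longleftrightarrow> (\<forall>n. int m dvd fps_nth f n)"
proof
  assume "\<forall>n. int m dvd fps_nth f n"
  then have "f = of_nat m * Abs_fps (\<lambda>n. fps_nth f n div int m)"
    by (intro fps_ext) (simp add: fps_mult_of_nat_nth)
  then show "of_nat m dvd f" by (rule dvdI)
qed (auto simp: fps_mult_of_nat_nth elim!: dvdE)

lemma fps_cong_iff: "fps_cong m f g \<longleftrightarrow> (\<forall>n. int m dvd fps_nth f n - fps_nth g n)"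
  by (simp add: fps_cong_def of_nat_dvd_fps_iff)

lemma fps_cong_refl [simp]: "fps_cong m f f"
  by (simp add: fps_cong_def)

lemma fps_cong_sym: "fps_cong m f g \<Longrightarrow> fps_cong m g f"
  unfolding fps_cong_def using dvd_minus_iff[of "of_nat m" "f - g"] by simp

lemma fps_cong_trans [trans]: "fps_cong m f g \<Longrightarrow> fps_cong m g h \<Longrightarrow> fps_cong m f h"
  unfolding fps_cong_def using dvd_add[of "of_nat m" "f - g" "g - h"] by simp

lemma fps_cong_add: "fps_cong m f g \<Longrightarrow> fps_cong m f' g' \<Longrightarrow> fps_cong m (f + f') (g + g')"
  unfolding fps_cong_def using dvd_add[of "of_nat m" "f - g" "f' - g'"] by (simp add: algebra_simps)

lemma fps_cong_diff: "fps_cong m f g \<Longrightarrow> fps_cong m f' g' \<Longrightarrow> fps_cong m (f - f') (g - g')"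
  unfolding fps_cong_def using dvd_diff[of "of_nat m" "f - g" "f' - g'"] by (simp add: algebra_simps)

lemma fps_cong_mult:
  assumes "fps_cong m f g" "fps_cong m f' g'"
  shows "fps_cong m (f * f') (g * g')"
proof -
  have "f * f' - g * g' = (f - g) * f' + g * (f' - g')" by (simp add: algebra_simps)
  then show ?thesis using assms unfolding fps_cong_def by (metis dvd_add dvd_mult dvd_mult2)
qed

lemma fps_cong_power: "fps_cong m f g \<Longrightarrow> fps_cong m (f ^ n) (g ^ n)"
  by (induction n) (auto intro: fps_cong_mult)

lemma fps_cong_sum: "(\<And>i. i \<in> A \<Longrightarrow> fps_cong m (f i) (g i)) \<Longrightarrow> fps_cong m (\<Sum>i\<in>A. f i) (\<Sum>i\<in>A. g i)"
  by (induction A rule: infinite_finite_induct) (auto intro: fps_cong_add)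

lemmas fps_cong_intros = fps_cong_add fps_cong_diff fps_cong_mult fps_cong_power fps_cong_refl

lemma fps_congI: "f - g = of_nat m * h \<Longrightarrow> fps_cong m f g"
  by (simp add: fps_cong_def)

lemma freshmans_dream_dvd:
  fixes x y :: "'a :: comm_ring_1"
  assumes "prime m"
  shows "of_nat m dvd (x + y) ^ m - (x ^ m + y ^ m)"
proof -
  have m: "m > 0" using assms by (rule prime_gt_0_nat)
  have "{..m} = insert 0 (insert m {0<..<m})" using m by auto
  then have "(x + y) ^ m = (x ^ m + y ^ m) + (\<Sum>k\<in>{0<..<m}. of_nat (m choose k) * x ^ k * y ^ (m - k))"
    using m by (simp add: binomial_ring add_ac)
  moreover have "of_nat m dvd (of_nat (m choose k) :: 'a)" if "k \<in> {0<..<m}" for k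
    using dvd_choose_prime[of k m] that assms by auto
  then have "of_nat m dvd (\<Sum>k\<in>{0<..<m}. of_nat (m choose k) * x ^ k * y ^ (m - k))"
    by (intro dvd_sum) (simp add: mult.assoc)
  ultimately show ?thesis by (simp add: algebra_simps)
qed

lemma fermat_int_dvd:
  fixes c :: int
  assumes "prime m"
  shows "int m dvd c ^ m - c"
proof -
  have m: "m > 0" using assms by (rule prime_gt_0_nat)
  have step: "int m dvd (x + 1) ^ m - (x + 1) \<longleftrightarrow> int m dvd x ^ m - x" for x
  proof -
    have "(x + 1) ^ m - (x + 1) = ((x + 1) ^ m - (x ^ m + 1 ^ m)) + (x ^ m - x)" by simp
    then show ?thesis using freshmans_dream_dvd[OF assms, of x 1] by (metis dvd_add_right_iff of_nat_id)
  qed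
  show ?thesis
  proof (induction c rule: int_induct[of _ 0])
    case base
    then show ?case using m by (simp add: power_0_left)
  next
    case (step1 i)
    then show ?case using step[of i] by simp
  next
    case (step2 i)
    then show ?case using step[of "i - 1"] by simp
  qed
qed

text \<open>Split f = c + q g. The m-th power is additive modulo m, c^m is congruent to c by Fermat,
  and q^m g^m is covered by the induction hypothesis for g at n - m.\<close>

lemma fps_power_prime_cong:
  assumes "prime m"
  shows "fps_cong m (f ^ m) (fps_V m f)"
proof -
  have m: "m > 0" using assms by (rule prime_gt_0_nat)
  have "int m dvd fps_nth (f ^ m) n - fps_nth (fps_V m f) n" for n
  proof (induction n arbitrary: f rule: less_induct)
    case (less n)
    define c where "c = fps_nth f 0"
    define g where "g = fps_shift 1 f"
    have f: "f = fps_const c + fps_X * g"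
      by (rule fps_ext) (auto simp: c_def g_def)
    have "of_nat m dvd f ^ m - (fps_const c ^ m + (fps_X * g) ^ m)"
      unfolding f by (rule freshmans_dream_dvd[OF assms])
    then have 1: "int m dvd fps_nth (f ^ m) n - fps_nth (fps_const c ^ m + (fps_X * g) ^ m) n"
      unfolding of_nat_dvd_fps_iff fps_sub_nth by blast
    have "int m dvd fps_nth (fps_const c ^ m + (fps_X * g) ^ m) n - fps_nth (fps_V m f) n"
    proof (cases "n < m")
      case True
      then show ?thesis using m fermat_int_dvd[OF assms, of c]
        by (auto simp: fps_V_nth power_mult_distrib fps_X_power_mult_nth fps_const_power c_def power_0_left dest: dvd_imp_le)
    next
      case False
      have "fps_nth (fps_V m f) n = fps_nth (fps_V m g) (n - m)"
      proof (cases "m dvd n")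
        case True
        then obtain k where k: "n = m * k" by (elim dvdE)
        have "k > 0" using False k by (intro gr0I) (use m in auto)
        moreover have "m * k - m = m * (k - 1)" by (simp add: algebra_simps)
        ultimately show ?thesis using m by (simp add: fps_V_nth k g_def)
      next
        case nd: False
        then have "\<not> m dvd n - m" using False by (meson dvd_minus_self not_less)
        then show ?thesis using nd m by (simp add: fps_V_nth)
      qed
      then show ?thesis using False m less.IH[of "n - m" g]
        by (simp add: power_mult_distrib fps_X_power_mult_nth fps_const_power)
    qed
    from dvd_add[OF 1 this] show ?case by simp
  qed
  then show ?thesis by (simp add: fps_cong_iff)
qed

lemma fps_U_cong: "fps_cong m f g \<Longrightarrow> fps_cong m (fps_U k f) (fps_U k g)"
  by (simp add: fps_cong_iff)

lemma fps_cong_numeral_cancel: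
  assumes "fps_cong m (numeral c * f) (numeral c * g)" "coprime (numeral c) m"
  shows "fps_cong m f g"
  unfolding fps_cong_iff
proof
  fix n
  have "int m dvd numeral c * (fps_nth f n - fps_nth g n)"
    using assms(1) unfolding fps_cong_iff by (simp add: numeral_fps_const right_diff_distrib)
  moreover have "coprime (int m) (int (numeral c))"
    using assms(2) by (simp add: coprime_commute del: of_nat_numeral)
  ultimately show "int m dvd fps_nth f n - fps_nth g n"
    by (simp only: of_nat_numeral coprime_dvd_mult_right_iff)
qed

text \<open>The sum of sigma(n) q^n over odd n, an integral expression for (theta3^4 - theta4^4) /
  16.\<close>

definition modular_F :: "int fps" where
  "modular_F = divisor_series 1 - 3 * fps_V 2 (divisor_series 1) + 2 * fps_V 4 (divisor_series 1)"

lemma modular_F_eq: "16 * modular_F = thA^2 - thB^2"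
  unfolding jacobi_four_squares jacobi_four_squares_signed modular_F_def by (simp add: algebra_simps)

text \<open>This is lambda / 16, where lambda = 1 - theta4^4 / theta3^4 is the modular lambda
  function. The scaling makes the coefficients integral.\<close>

definition modular_x :: "int fps" where
  "modular_x = modular_F * theta3_inv ^ 4"

lemma theta3_pow4_mult_x: "thA^2 * modular_x = modular_F"
  using theta3_mult_inv modular_x_def by Groebner_Basis.algebra

lemma one_minus_16_x: "(1 - 16 * modular_x) * thA^2 = thB^2"
proof -
  have "(1 - 16 * modular_x) * thA^2 = thA^2 - 16 * (thA^2 * modular_x)"
    by (simp only: left_diff_distrib mult_1_left mult.assoc mult.commute[of modular_x])
  then show ?thesis unfolding theta3_pow4_mult_x modular_F_eq by simp
qed

lemma inv_mult_one_minus_16_x: "theta3_inv * (1 - 16 * modular_x) = theta3_inv ^ 5 * thB^2"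
  using one_minus_16_x theta3_mult_inv by Groebner_Basis.algebra

lemma fps_theta_modular_x: "fps_theta modular_x = modular_x * thB^2"
proof -
  have "fps_theta (16 * modular_F) = 4 * dlog3 * thA^2 - 4 * dlog4 * thB^2"
    unfolding modular_F_eq by (simp only: fps_theta_diff fps_theta_thA_sq fps_theta_thB_sq)
  then have F: "16 * fps_theta modular_F = 4 * dlog3 * thA^2 - 4 * dlog4 * thB^2"
    by (simp add: fps_theta_mult)
  have "fps_theta (thA^2 * modular_x) = fps_theta modular_F"
    by (simp only: theta3_pow4_mult_x)
  then have xF: "4 * dlog3 * thA^2 * modular_x + thA^2 * fps_theta modular_x = fps_theta modular_F"
    by (simp only: fps_theta_mult fps_theta_thA_sq)
  have "16 * (thA^2 * fps_theta modular_x) = 16 * (thA^2 * (modular_x * thB^2))"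
  proof -
    \<comment> \<open>The elimination is carried out for abstract a = theta3^4, b = theta4^4, y =
      \<open>dlog3\<close>, z = \<open>dlog4\<close>, with f and x standing for
      \<open>modular_F\<close> and \<open>modular_x\<close> and primes for q d/dq.\<close>
    have "16 * (a * x') = 16 * (a * (x * b))"
      if h: "4 * y * a * x + a * x' = f'" "16 * f' = 4 * y * a - 4 * z * b" "16 * f = a - b"
        "a * x = f" "4 * (z - y) = b - a" for a b x x' y z f f' :: "int fps"
    proof -
      have "16 * (a * x') = 16 * f' - 4 * y * (16 * (a * x))"
        unfolding h(1)[symmetric] by (simp add: algebra_simps)
      also have "\<dots> = - ((4 * (z - y)) * b)"
        unfolding h(2) h(3) h(4) by (simp add: algebra_simps)
      also have "\<dots> = (16 * f) * b"
        unfolding h(3) h(5) by (simp add: algebra_simps)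
      finally show ?thesis unfolding h(4)[symmetric] by (simp add: algebra_simps)
    qed
    from this[OF xF F modular_F_eq theta3_pow4_mult_x dlog4_minus_dlog3]
    show ?thesis .
  qed
  then have "thA^2 * fps_theta modular_x = thA^2 * (modular_x * thB^2)"
    by (rule fps_numeral_cancel)
  then show ?thesis using theta_nonzero(1) by simp
qed

text \<open>A divisor of m n that does not divide n is a multiple of m, so sigma(m n) and sigma(n)
  are congruent.\<close>

lemma fps_U_divisor_series_cong:
  assumes "prime m"
  shows "fps_cong m (fps_U m (divisor_series 1)) (divisor_series 1)"
  unfolding fps_cong_iff
proof
  fix n
  have m: "m > 0" using assms by (rule prime_gt_0_nat)
  show "int m dvd fps_nth (fps_U m (divisor_series 1)) n - fps_nth (divisor_series 1) n"
  proof (cases "n = 0")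
    case True
    then show ?thesis by (simp add: divisor_series_def)
  next
    case False
    have fin: "finite {d. d dvd m * n}" using False m by (intro finite_divisors_nat) auto
    have "(\<Sum>d | d dvd m * n. int d) = (\<Sum>d | d dvd n. int d) + (\<Sum>d\<in>{d. d dvd m * n} - {d. d dvd n}. int d)"
      using fin by (intro sum.subset_diff[THEN trans[OF _ add.commute]]) (auto intro: dvd_mult)
    moreover have "int m dvd (\<Sum>d\<in>{d. d dvd m * n} - {d. d dvd n}. int d)"
    proof (rule dvd_sum)
      fix d assume d: "d \<in> {d. d dvd m * n} - {d. d dvd n}"
      then have "\<not> coprime d m" using coprime_dvd_mult_right_iff[of d m n] by auto
      then have "m dvd d" using assms prime_imp_coprime[of m d] coprime_commute by blast
      then show "int m dvd int d" by simp
    qed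
    ultimately show ?thesis using False m by (simp add: divisor_series_def)
  qed
qed

lemma fps_U_V_coprime:
  assumes "coprime m k" "m > 0" "k > 0"
  shows "fps_U m (fps_V k f) = fps_V k (fps_U m f)"
proof (rule fps_ext)
  fix n
  have "k dvd m * n \<longleftrightarrow> k dvd n"
    using assms(1) by (simp add: coprime_commute coprime_dvd_mult_right_iff)
  moreover have "m * n div k = m * (n div k)" if "k dvd n" using that by (rule div_mult_swap[symmetric])
  ultimately show "fps_nth (fps_U m (fps_V k f)) n = fps_nth (fps_V k (fps_U m f)) n"
    using assms by (simp add: fps_V_nth)
qed

lemma fps_V_cong: "k > 0 \<Longrightarrow> fps_cong m f g \<Longrightarrow> fps_cong m (fps_V k f) (fps_V k g)"
  by (simp add: fps_cong_iff fps_V_nth)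

lemma fps_U_numeral_mult: "fps_U k (numeral c * f) = numeral c * fps_U k (f :: int fps)"
  by (rule fps_ext) (simp add: numeral_fps_const)

text \<open>Jacobi's formula writes theta4^4 through the divisor series at q, q^2 and q^4, and U_m
  with m odd commutes with these substitutions. This is the exponent 0 of
  \<open>fps_U_x_power_cong\<close>.\<close>

lemma fps_U_thB_sq_cong:
  assumes "prime m" "odd m"
  shows "fps_cong m (fps_U m (thB^2)) (thB^2)"
proof -
  have m: "m > 0" using assms(1) by (rule prime_gt_0_nat)
  have "coprime m 2" using assms(2) by simp
  then have c: "coprime m 2" "coprime m 4"
    using coprime_power_right_iff[of m 2 2] by simp_all
  have U1: "fps_U m 1 = (1 :: int fps)" using m by (intro fps_ext) simp
  have G: "fps_cong m (fps_U m (divisor_series 1)) (divisor_series 1)"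
    by (rule fps_U_divisor_series_cong[OF assms(1)])
  have "fps_U m (thB^2) = 1 - 8 * fps_U m (divisor_series 1) + 48 * fps_V 2 (fps_U m (divisor_series 1))
     - 64 * fps_V 4 (fps_U m (divisor_series 1))"
    unfolding jacobi_four_squares_signed
    using m c by (simp add: fps_U_add fps_U_diff fps_U_numeral_mult fps_U_V_coprime U1)
  then show ?thesis
    unfolding jacobi_four_squares_signed by (simp only:) (intro fps_cong_intros fps_V_cong G; simp)
qed

text \<open>The form \<open>x\<^sup>i thB\<^sup>2 dq/q = x\<^sup>i dx/x\<close> is exact for \<open>i > 0\<close>, so \<open>U\<^sub>m\<close>, acting as the Cartier
  operator, annihilates it unless \<open>m\<close> divides \<open>i\<close>.\<close>

lemma fps_U_x_power_cong:
  assumes "prime m" "odd m"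
  shows "fps_cong m (fps_U m (modular_x ^ i * thB^2)) (if m dvd i then modular_x ^ (i div m) * thB^2 else 0)"
proof (cases "m dvd i")
  case True
  have m: "m > 0" using assms(1) by (rule prime_gt_0_nat)
  obtain j where i: "i = m * j" using True by (elim dvdE)
  have "fps_cong m (modular_x ^ i * thB^2) (fps_V m (modular_x ^ j) * thB^2)"
    using fps_power_prime_cong[OF assms(1), of "modular_x ^ j"]
    by (intro fps_cong_mult) (simp_all add: i power_mult[symmetric] mult.commute)
  then have "fps_cong m (fps_U m (modular_x ^ i * thB^2)) (fps_U m (fps_V m (modular_x ^ j) * thB^2))"
    by (rule fps_U_cong)
  also have "fps_U m (fps_V m (modular_x ^ j) * thB^2) = modular_x ^ j * fps_U m (thB^2)"
    using m by (rule fps_U_V_mult)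
  also have "fps_cong m \<dots> (modular_x ^ j * thB^2)"
    by (intro fps_cong_mult fps_U_thB_sq_cong assms fps_cong_refl)
  finally show ?thesis using True m by (simp add: i)
next
  case False
  then have "i > 0" by (intro gr0I) auto
  then have "modular_x ^ (i - 1) * modular_x = modular_x ^ i" by (metis power_minus_mult)
  then have e: "fps_theta (modular_x ^ i) = of_nat i * (modular_x ^ i * thB^2)"
    by (simp add: fps_theta_power fps_theta_modular_x mult.assoc[symmetric])
  have "int m dvd fps_nth (fps_U m (modular_x ^ i * thB^2)) n" for n
  proof -
    have "int (m * n) * fps_nth (modular_x ^ i) (m * n) = int i * fps_nth (modular_x ^ i * thB^2) (m * n)"
      using arg_cong[OF e, of "\<lambda>f. fps_nth f (m * n)"] unfolding fps_theta_nth fps_mult_of_nat_nth by simp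
    then have "int m dvd int i * fps_nth (modular_x ^ i * thB^2) (m * n)"
      by (metis dvd_mult2 dvd_triv_left of_nat_mult)
    then show ?thesis using False assms(1) prime_dvd_mult_iff[of "int m"] by simp
  qed
  then show ?thesis using False by (simp add: fps_cong_iff)
qed

text \<open>With L = 1 - 16 x = theta4^4 / theta3^4 one has L^m / theta3 = (theta3^(-5) L^k)
  theta4^4. By W this is y^m times a polynomial in x times theta4^4, and of the polynomial U_m keeps
  only the exponents divisible by m. The powers L^m and y^m leave U_m as L and y, and dividing by L
  turns theta4^4 into theta3^4.\<close>

lemma fps_U_inv_cong:
  assumes m: "prime m" "odd m" "m = Suc k"
    and W: "fps_cong m (theta3_inv ^ 5 * (1 - 16 * modular_x) ^ k)
              (y ^ m * (\<Sum>i\<le>N. of_int (w i) * modular_x ^ i))"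
  shows "fps_cong m (fps_U m theta3_inv) (y * thA^2 * (\<Sum>j\<le>N div m. of_int (w (m * j)) * modular_x ^ j))"
proof -
  define L where "L = 1 - 16 * modular_x"
  define S where "S = (\<Sum>j\<le>N div m. of_int (w (m * j)) * modular_x ^ j)"
  have m0: "m > 0" using m(1) by (rule prime_gt_0_nat)
  have "fps_cong m (fps_V m L * theta3_inv) (L ^ m * theta3_inv)"
    by (intro fps_cong_mult fps_cong_refl fps_cong_sym[OF fps_power_prime_cong[OF m(1)]])
  also have "L ^ m * theta3_inv = (theta3_inv * L) * L ^ k"
    by (simp only: m(3) power_Suc mult_ac)
  also have "\<dots> = (theta3_inv ^ 5 * L ^ k) * thB^2"
    unfolding L_def inv_mult_one_minus_16_x by (simp only: mult_ac)
  also have "fps_cong m \<dots> ((y ^ m * (\<Sum>i\<le>N. of_int (w i) * modular_x ^ i)) * thB^2)"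
    unfolding L_def by (rule fps_cong_mult[OF W fps_cong_refl])
  also have "\<dots> = y ^ m * (\<Sum>i\<le>N. of_int (w i) * (modular_x ^ i * thB^2))"
    by (simp only: sum_distrib_right mult.assoc)
  also have "fps_cong m \<dots> (fps_V m y * (\<Sum>i\<le>N. of_int (w i) * (modular_x ^ i * thB^2)))"
    by (intro fps_cong_mult fps_cong_refl fps_power_prime_cong m(1))
  finally have "fps_cong m (fps_U m (fps_V m L * theta3_inv))
      (fps_U m (fps_V m y * (\<Sum>i\<le>N. of_int (w i) * (modular_x ^ i * thB^2))))"
    by (rule fps_U_cong)
  then have "fps_cong m (L * fps_U m theta3_inv) (y * fps_U m (\<Sum>i\<le>N. of_int (w i) * (modular_x ^ i * thB^2)))"
    using m0 by (simp only: fps_U_V_mult)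
  also have "fps_U m (\<Sum>i\<le>N. of_int (w i) * (modular_x ^ i * thB^2))
     = (\<Sum>i\<le>N. of_int (w i) * fps_U m (modular_x ^ i * thB^2))"
    by (rule fps_ext) (simp add: fps_sum_nth flip: fps_of_int)
  also have "fps_cong m (y * \<dots>) (y * (\<Sum>i\<le>N. of_int (w i) * (if m dvd i then modular_x ^ (i div m) * thB^2 else 0)))"
    by (intro fps_cong_mult fps_cong_refl fps_cong_sum fps_U_x_power_cong m(1,2))
  also have "(\<Sum>i\<le>N. of_int (w i) * (if m dvd i then modular_x ^ (i div m) * thB^2 else 0))
     = (\<Sum>i\<in>{i. i \<le> N \<and> m dvd i}. of_int (w i) * (modular_x ^ (i div m) * thB^2))"
    by (intro sum.mono_neutral_cong_right) auto
  also have "\<dots> = (\<Sum>j\<le>N div m. of_int (w (m * j)) * (modular_x ^ j * thB^2))"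
    using m0 by (intro sum.reindex_bij_witness[of _ "\<lambda>j. m * j" "\<lambda>i. i div m"])
      (auto simp: less_eq_div_iff_mult_less_eq mult.commute div_le_mono)
  also have "\<dots> = S * thB^2"
    by (simp add: S_def sum_distrib_right mult.assoc)
  finally have R: "fps_cong m (L * fps_U m theta3_inv) (y * (S * thB^2))" .
  \<comment> \<open>The factor \<open>thA^2 * overpartition_series ^ 4\<close> is theta3^4 /
    theta4^4, the inverse of \<open>L\<close>.\<close>
  have e1: "thA^2 * overpartition_series ^ 4 * (L * f) = f" for f
    using one_minus_16_x theta4_mult_overpartition_series L_def by Groebner_Basis.algebra
  have e2: "thA^2 * overpartition_series ^ 4 * (y * (S * thB^2)) = y * thA^2 * S"
    using theta4_mult_overpartition_series by Groebner_Basis.algebra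
  from fps_cong_mult[OF fps_cong_refl[of m "thA^2 * overpartition_series ^ 4"] R]
  show ?thesis unfolding e1 e2 unfolding S_def .
qed

text \<open>Horner's scheme: for a concrete coefficient list it unfolds to an expression on which
  polynomial identities can be decided.\<close>

lemma sum_nth_eq_foldr:
  "(\<Sum>i<length w. of_int (w ! i) * x ^ i) = foldr (\<lambda>c g. of_int c + x * g) w (0 :: 'a :: comm_ring_1)"
proof (induction w)
  case (Cons c w)
  have "(\<Sum>i<length (c # w). of_int ((c # w) ! i) * x ^ i) = of_int c + x * (\<Sum>i<length w. of_int (w ! i) * x ^ i)"
    by (simp add: sum.lessThan_Suc_shift sum_distrib_left mult.left_commute del: sum.lessThan_Suc)
  then show ?case by (simp add: Cons.IH)
qed simp

lemma fps_cong_1_of_V2: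
  assumes "fps_cong m f (fps_V 2 f)" "fps_nth f 0 = 1"
  shows "fps_cong m f 1"
proof -
  have "int m dvd fps_nth f n" if "n > 0" for n
    using dvd_nth_of_dvd_diff_V2[of "int m" f n] assms(1) that by (simp add: fps_cong_iff)
  then show ?thesis using assms(2) by (auto simp: fps_cong_iff)
qed

section \<open>Hasse invariants and the explicit congruences\<close>

lemma V2_modular_F: "64 * fps_V 2 modular_F = (thA - thB)^2"
proof -
  have "16 * fps_V 2 modular_F = (fps_V 2 thA)^2 - thA * thB"
    using arg_cong[OF modular_F_eq, of "fps_V 2"] by (simp add: fps_V_simps V2_thB_sq[symmetric])
  then show ?thesis using theta_landen_add by Groebner_Basis.algebra
qed

lemma modular_F_0: "fps_nth modular_F 0 = 0"
  by (simp add: modular_F_def divisor_series_def fps_V_nth numeral_fps_const)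

text \<open>Under q -> q^2, theta3^2 becomes (theta3^2 + theta4^2) / 2 and F becomes (theta3^2 -
  theta4^2)^2 / 64. As \<alpha>, \<beta>, \<gamma> invert 2, 16, 64 modulo m, the hypothesis
  \<open>landen\<close> says that the series is invariant under q -> q^2 modulo m, hence
  constant.\<close>

lemma hasse_invariantI:
  fixes Phi :: "int fps \<Rightarrow> int fps \<Rightarrow> int fps"
  assumes Phi: "\<And>f f' a a'. fps_cong m f f' \<Longrightarrow> fps_cong m a a' \<Longrightarrow> fps_cong m (Phi f a) (Phi f' a')"
    and V: "\<And>f a. fps_V 2 (Phi f a) = Phi (fps_V 2 f) (fps_V 2 a)"
    and zero: "fps_nth (Phi modular_F thA) 0 = 1"
    and inv: "fps_cong m (2 * \<alpha>) 1" "fps_cong m (16 * \<beta>) 1" "fps_cong m (64 * \<gamma>) 1"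
    and landen: "fps_cong m (Phi (\<beta> * (thA^2 - thB^2)) thA) (Phi (\<gamma> * (thA - thB)^2) (\<alpha> * (thA + thB)))"
  shows "fps_cong m (Phi modular_F thA) 1"
proof (rule fps_cong_1_of_V2[OF _ zero])
  have scale: "fps_cong m f (c * (numeral d * f))" if "fps_cong m (numeral d * c) 1" for c d f
    using fps_cong_mult[OF fps_cong_sym[OF that] fps_cong_refl[of m f]] by (simp add: mult_ac)
  have "fps_cong m (Phi modular_F thA) (Phi (\<beta> * (thA^2 - thB^2)) thA)"
    unfolding modular_F_eq[symmetric] by (intro Phi scale inv fps_cong_refl)
  also note landen
  also have "fps_cong m (Phi (\<gamma> * (thA - thB)^2) (\<alpha> * (thA + thB))) (Phi (fps_V 2 modular_F) (fps_V 2 thA))"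
    unfolding V2_modular_F[symmetric] theta_landen_add by (intro Phi fps_cong_sym[OF scale] inv)
  finally show "fps_cong m (Phi modular_F thA) (fps_V 2 (Phi modular_F thA))" unfolding V .
qed

text \<open>Multiplying by the e-th power of the Hasse relation replaces theta3^(-5) by theta3^(2 k
  e - 5) h^e. The equation \<open>exp\<close> makes the power of theta3 an m-th power, as
  \<open>fps_U_inv_cong\<close> requires, with y = theta3^j.\<close>

lemma fps_U_inv_of_hasse_invariant:
  assumes m: "prime m" "odd m" "m = Suc k"
    and hasse: "fps_cong m (theta3 ^ (2 * k) * h) 1"
    and exp: "2 * k * e = j * m + 5"
    and L: "fps_cong m (1 - 16 * modular_x) L"
    and W: "fps_cong m (h ^ e * L ^ k) (foldr (\<lambda>c g. of_int c + modular_x * g) w 0)"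
    and w: "length w = Suc N"
  shows "fps_cong m (fps_U m theta3_inv)
    (theta3 ^ j * thA^2 * (\<Sum>i\<le>N div m. of_int (w ! (m * i)) * modular_x ^ i))"
proof (rule fps_U_inv_cong[OF m])
  have "fps_cong m (theta3_inv ^ 5 * 1 ^ e * (1 - 16 * modular_x) ^ k)
      (theta3_inv ^ 5 * (theta3 ^ (2 * k) * h) ^ e * L ^ k)"
    by (intro fps_cong_mult fps_cong_power fps_cong_refl L fps_cong_sym[OF hasse])
  also have "theta3_inv ^ 5 * (theta3 ^ (2 * k) * h) ^ e * L ^ k = (theta3 ^ j) ^ m * (h ^ e * L ^ k)"
  proof -
    have "theta3_inv ^ 5 * (theta3 ^ (2 * k)) ^ e = (theta3 * theta3_inv) ^ 5 * (theta3 ^ j) ^ m"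
      unfolding power_mult[symmetric] exp by (simp add: power_mult_distrib power_add mult_ac)
    then have "theta3_inv ^ 5 * (theta3 ^ (2 * k)) ^ e = (theta3 ^ j) ^ m" by (simp add: theta3_mult_inv)
    then show ?thesis unfolding power_mult_distrib by (simp only: mult.assoc[symmetric])
  qed
  also have "fps_cong m \<dots> ((theta3 ^ j) ^ m * (\<Sum>i\<le>N. of_int (w ! i) * modular_x ^ i))"
    using fps_cong_mult[OF fps_cong_refl W] sum_nth_eq_foldr[of w modular_x] unfolding w lessThan_Suc_atMost by simp
  finally show "fps_cong m (theta3_inv ^ 5 * (1 - 16 * modular_x) ^ k)
      ((theta3 ^ j) ^ m * (\<Sum>i\<le>N. of_int (w ! i) * modular_x ^ i))" by simp
qed

text \<open>Here and for 7 and 11 the polynomial is the sum of binomial(2j, j)^2 x^j over j <= (m -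
  1) / 2 with its coefficients reduced modulo m.\<close>

lemma hasse_invariant_3: "fps_cong 3 (theta3 ^ (2 * 2) * (1 + modular_x)) 1"
proof -
  define Phi where "Phi f a = a^2 + f" for f a :: "int fps"
  have "fps_cong 3 (Phi modular_F thA) 1"
  proof (rule hasse_invariantI[where \<alpha> = "- 1" and \<beta> = "1" and \<gamma> = "1"])
    have "Phi (1 * (thA^2 - thB^2)) thA - Phi (1 * (thA - thB)^2) ((- 1) * (thA + thB))
        = of_nat 3 * (- (thB^2))"
      unfolding Phi_def of_nat_numeral by Groebner_Basis.algebra
    then show "fps_cong 3 (Phi (1 * (thA^2 - thB^2)) thA) (Phi (1 * (thA - thB)^2) ((- 1) * (thA + thB)))"
      by (rule fps_congI)
    show "fps_cong 3 (2 * (- 1)) 1" by (rule fps_congI[of _ _ _ "- 1"]) simp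
    show "fps_cong 3 (16 * 1) 1" by (rule fps_congI[of _ _ _ "5"]) simp
    show "fps_cong 3 (64 * 1) 1" by (rule fps_congI[of _ _ _ "21"]) simp
    show "fps_V 2 (Phi f a) = Phi (fps_V 2 f) (fps_V 2 a)" for f a
      unfolding Phi_def by (simp add: fps_V_simps)
    show "fps_nth (Phi modular_F thA) 0 = 1"
      unfolding Phi_def by (simp add: modular_F_0 theta_nths fps_power_zeroth numeral_fps_const)
  qed (unfold Phi_def, intro fps_cong_intros, assumption+)
  also have "Phi modular_F thA = theta3 ^ (2 * 2) * (1 + modular_x)"
    unfolding Phi_def theta3_pow4_mult_x[symmetric] by simp Groebner_Basis.algebra
  finally show ?thesis .
qed

text \<open>The exponents are e = 2, j = 1, as 4 * 2 = 3 + 5. The list \<open>w\<close> holds the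
  coefficients of h^e (1 - 16 x)^k modulo m, constant term first; its entries at multiples of m
  survive.\<close>

lemma fps_U_inv_3: "fps_cong 3 (fps_U 3 theta3_inv) (theta3 ^ 5)"
proof -
  define w :: "int list" where "w = [1, 0, 1, 0, 1]"
  have "(1 + modular_x) ^ 2 * (1 - modular_x) ^ 2
        - foldr (\<lambda>c g. of_int c + modular_x * g) w 0
      = of_nat 3 * (- (modular_x^2))"
    unfolding w_def foldr.simps o_apply id_apply of_int_1 of_int_0 of_int_minus of_int_numeral of_nat_numeral
    by Groebner_Basis.algebra
  note W = fps_congI[OF this]
  have L: "fps_cong 3 (1 - 16 * modular_x) (1 - modular_x)"
    by (rule fps_congI[of _ _ _ "- 5 * modular_x"]) simp
  have "fps_cong 3 (fps_U 3 theta3_inv)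
      (theta3 ^ 1 * thA^2 * (\<Sum>i\<le>4 div 3. of_int (w ! (3 * i)) * modular_x ^ i))"
    by (rule fps_U_inv_of_hasse_invariant[OF _ _ _ hasse_invariant_3 _ L W]) (simp_all add: w_def)
  also have "(\<Sum>i\<le>4 div 3. of_int (w ! (3 * i)) * modular_x ^ i) = 1"
  proof -
    have "(4 :: nat) div 3 = Suc 0" by simp
    then show ?thesis by (simp only:) (simp add: w_def)
  qed
  also have "theta3 ^ 1 * thA^2 * (1) = theta3 ^ 5"
    unfolding theta3_pow4_mult_x[symmetric] by Groebner_Basis.algebra
  finally show ?thesis .
qed

lemma hasse_invariant_7: "fps_cong 7 (theta3 ^ (2 * 6) * (1 - 3 * modular_x + modular_x^2 + modular_x^3)) 1"
proof -
  define Phi where "Phi f a = a^6 - 3 * a^4 * f + a^2 * f^2 + f^3" for f a :: "int fps"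
  have "fps_cong 7 (Phi modular_F thA) 1"
  proof (rule hasse_invariantI[where \<alpha> = "- 3" and \<beta> = "- 3" and \<gamma> = "1"])
    have "Phi ((- 3) * (thA^2 - thB^2)) thA - Phi (1 * (thA - thB)^2) ((- 3) * (thA + thB))
        = of_nat 7 * (- 67 * thB^6 - 552 * thA * thB^5 - 1608 * thA^2 * thB^4 - 2224 * thA^3 * thB^3 - 1590 * thA^4 * thB^2 -
          552 * thA^5 * thB - 72 * thA^6)"
      unfolding Phi_def of_nat_numeral by Groebner_Basis.algebra
    then show "fps_cong 7 (Phi ((- 3) * (thA^2 - thB^2)) thA) (Phi (1 * (thA - thB)^2) ((- 3) * (thA + thB)))"
      by (rule fps_congI)
    show "fps_cong 7 (2 * (- 3)) 1" by (rule fps_congI[of _ _ _ "- 1"]) simp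
    show "fps_cong 7 (16 * (- 3)) 1" by (rule fps_congI[of _ _ _ "- 7"]) simp
    show "fps_cong 7 (64 * 1) 1" by (rule fps_congI[of _ _ _ "9"]) simp
    show "fps_V 2 (Phi f a) = Phi (fps_V 2 f) (fps_V 2 a)" for f a
      unfolding Phi_def by (simp add: fps_V_simps)
    show "fps_nth (Phi modular_F thA) 0 = 1"
      unfolding Phi_def by (simp add: modular_F_0 theta_nths fps_power_zeroth numeral_fps_const)
  qed (unfold Phi_def, intro fps_cong_intros, assumption+)
  also have "Phi modular_F thA = theta3 ^ (2 * 6) * (1 - 3 * modular_x + modular_x^2 + modular_x^3)"
    unfolding Phi_def theta3_pow4_mult_x[symmetric] by simp Groebner_Basis.algebra
  finally show ?thesis .
qed

text \<open>The exponents are e = j = 1, as 12 = 7 + 5; the surviving entries of \<open>w\<close>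
  are 1 and 3.\<close>

lemma fps_U_inv_7: "fps_cong 7 (fps_U 7 theta3_inv) (theta3 ^ 5 + 80 * theta3 * modular_F)"
proof -
  define w :: "int list" where "w = [1, - 1, - 1, - 1, - 2, 3, - 1, 3, - 2, 1]"
  have "(1 - 3 * modular_x + modular_x^2 + modular_x^3) ^ 1 * (1 - 2 * modular_x) ^ 6
        - foldr (\<lambda>c g. of_int c + modular_x * g) w 0
      = of_nat 7 * (- 2 * modular_x + 14 * modular_x^2 - 50 * modular_x^3 + 110 * modular_x^4 - 145 * modular_x^5 + 103 * modular_x^6 - 21 * modular_x^7 - 18 * modular_x^8
          + 9 * modular_x^9)"
    unfolding w_def foldr.simps o_apply id_apply of_int_1 of_int_0 of_int_minus of_int_numeral of_nat_numeral
    by Groebner_Basis.algebra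
  note W = fps_congI[OF this]
  have L: "fps_cong 7 (1 - 16 * modular_x) (1 - 2 * modular_x)"
    by (rule fps_congI[of _ _ _ "- 2 * modular_x"]) simp
  have "fps_cong 7 (fps_U 7 theta3_inv)
      (theta3 ^ 1 * thA^2 * (\<Sum>i\<le>9 div 7. of_int (w ! (7 * i)) * modular_x ^ i))"
    by (rule fps_U_inv_of_hasse_invariant[OF _ _ _ hasse_invariant_7 _ L W]) (simp_all add: w_def)
  also have "(\<Sum>i\<le>9 div 7. of_int (w ! (7 * i)) * modular_x ^ i) = 1 + 3 * modular_x"
  proof -
    have "(9 :: nat) div 7 = Suc 0" by simp
    then show ?thesis by (simp only:) (simp add: w_def)
  qed
  also have "theta3 ^ 1 * thA^2 * (1 + 3 * modular_x) = theta3 ^ 5 + 3 * theta3 * modular_F"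
    unfolding theta3_pow4_mult_x[symmetric] by Groebner_Basis.algebra
  \<comment> \<open>The coefficient 3 is replaced by 80 to match U_4(theta3^5) as computed in
    \<open>fps_U4_theta3_pow5\<close>.\<close>
  also have "fps_cong 7 \<dots> (theta3 ^ 5 + 80 * theta3 * modular_F)"
    by (rule fps_congI[of _ _ _ "- 11 * theta3 * modular_F"]) simp
  finally show ?thesis .
qed

lemma hasse_invariant_11: "fps_cong 11 (theta3 ^ (2 * 10) * (1 + 4 * modular_x + 3 * modular_x^2 + 4 * modular_x^3 + 5 * modular_x^4 + modular_x^5)) 1"
proof -
  define Phi where "Phi f a = a^10 + 4 * a^8 * f + 3 * a^6 * f^2 + 4 * a^4 * f^3 + 5 * a^2 * f^4 + f^5" for f a :: "int fps"
  have "fps_cong 11 (Phi modular_F thA) 1"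
  proof (rule hasse_invariantI[where \<alpha> = "- 5" and \<beta> = "- 2" and \<gamma> = "5"])
    have "Phi ((- 2) * (thA^2 - thB^2)) thA - Phi (5 * (thA - thB)^2) ((- 5) * (thA + thB))
        = of_nat 11 * (- 1740338 * thB^10 - 13250000 * thA * thB^9 - 48883530 * thA^2 * thB^8 - 111500000 * thA^3 * thB^7 -
          176721588 * thA^4 * thB^6 - 204900000 * thA^5 * thB^5 - 176721584 * thA^6 * thB^4 -
          111500000 * thA^7 * thB^3 - 48883530 * thA^8 * thB^2 - 13250000 * thA^9 * thB - 1740339 *
          thA^10)"
      unfolding Phi_def of_nat_numeral by Groebner_Basis.algebra
    then show "fps_cong 11 (Phi ((- 2) * (thA^2 - thB^2)) thA) (Phi (5 * (thA - thB)^2) ((- 5) * (thA + thB)))"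
      by (rule fps_congI)
    show "fps_cong 11 (2 * (- 5)) 1" by (rule fps_congI[of _ _ _ "- 1"]) simp
    show "fps_cong 11 (16 * (- 2)) 1" by (rule fps_congI[of _ _ _ "- 3"]) simp
    show "fps_cong 11 (64 * 5) 1" by (rule fps_congI[of _ _ _ "29"]) simp
    show "fps_V 2 (Phi f a) = Phi (fps_V 2 f) (fps_V 2 a)" for f a
      unfolding Phi_def by (simp add: fps_V_simps)
    show "fps_nth (Phi modular_F thA) 0 = 1"
      unfolding Phi_def by (simp add: modular_F_0 theta_nths fps_power_zeroth numeral_fps_const)
  qed (unfold Phi_def, intro fps_cong_intros, assumption+)
  also have "Phi modular_F thA = theta3 ^ (2 * 10) * (1 + 4 * modular_x + 3 * modular_x^2 + 4 * modular_x^3 + 5 * modular_x^4 + modular_x^5)"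
    unfolding Phi_def theta3_pow4_mult_x[symmetric] by simp Groebner_Basis.algebra
  finally show ?thesis .
qed

text \<open>The exponents are e = 3, j = 5, as 20 * 3 = 5 * 11 + 5; the surviving entries of
  \<open>w\<close> are 1, 1 and 0.\<close>

lemma fps_U_inv_11: "fps_cong 11 (fps_U 11 theta3_inv) (theta3 ^ 9 + theta3 ^ 5 * modular_F)"
proof -
  define w :: "int list" where "w = [1, - 5, - 1, 0, - 4, 2, 1, 4, 4, - 5, - 3, 1, 1, 5, 4, - 3, - 4, 3, - 2, 4, 2,
      - 1, 0, - 5, 2, 1]"
  have "(1 + 4 * modular_x + 3 * modular_x^2 + 4 * modular_x^3 + 5 * modular_x^4 + modular_x^5) ^ 3 * (1 - 5 * modular_x) ^ 10
        - foldr (\<lambda>c g. of_int c + modular_x * g) w 0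
      = of_nat 11 * (- 3 * modular_x + 53 * modular_x^2 - 382 * modular_x^3 + 751 * modular_x^4 + 7763 * modular_x^5 - 55844 * modular_x^6 + 75397 * modular_x^7 +
          537466 * modular_x^8 - 2208988 * modular_x^9 + 705733 * modular_x^10 + 10849234 * modular_x^11 - 20138102 *
          modular_x^12 + 6005387 * modular_x^13 + 18116776 * modular_x^14 - 54938386 * modular_x^15 + 40690564 * modular_x^16 +
          55809477 * modular_x^17 + 9346932 * modular_x^18 + 134229261 * modular_x^19 + 123081818 * modular_x^20 +
          75049716 * modular_x^21 + 94140625 * modular_x^22 + 52201705 * modular_x^23 + 11541193 * modular_x^24 + 887784
          * modular_x^25)"
    unfolding w_def foldr.simps o_apply id_apply of_int_1 of_int_0 of_int_minus of_int_numeral of_nat_numeral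
    by Groebner_Basis.algebra
  note W = fps_congI[OF this]
  have L: "fps_cong 11 (1 - 16 * modular_x) (1 - 5 * modular_x)"
    by (rule fps_congI[of _ _ _ "- 1 * modular_x"]) simp
  have "fps_cong 11 (fps_U 11 theta3_inv)
      (theta3 ^ 5 * thA^2 * (\<Sum>i\<le>25 div 11. of_int (w ! (11 * i)) * modular_x ^ i))"
    by (rule fps_U_inv_of_hasse_invariant[OF _ _ _ hasse_invariant_11 _ L W]) (simp_all add: w_def)
  also have "(\<Sum>i\<le>25 div 11. of_int (w ! (11 * i)) * modular_x ^ i) = 1 + modular_x"
  proof -
    have "(25 :: nat) div 11 = Suc (Suc 0)" by simp
    then show ?thesis by (simp only:) (simp add: w_def)
  qed
  also have "theta3 ^ 5 * thA^2 * (1 + modular_x) = theta3 ^ 9 + theta3 ^ 5 * modular_F"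
    unfolding theta3_pow4_mult_x[symmetric] by Groebner_Basis.algebra
  finally show ?thesis .
qed

text \<open>For m = 5 the factor theta3^(-5) is itself an m-th power, so y = 1/theta3 works without
  a Hasse invariant. The polynomial (1 - 16 x)^4 has degree below 5, and only its constant term
  survives.\<close>

lemma fps_U_inv_5: "fps_cong 5 (fps_U 5 theta3_inv) (theta3 ^ 3)"
proof -
  define w :: "int list" where "w = [1, - 64, 1536, - 16384, 65536]"
  have len: "length w = Suc 4" by (simp add: w_def)
  have fold: "(\<Sum>i\<le>4. of_int (w ! i) * x ^ i) = foldr (\<lambda>c g. of_int c + x * g) w 0" for x :: "int fps"
    using sum_nth_eq_foldr[of w x] unfolding len lessThan_Suc_atMost .
  have "(\<Sum>i\<le>4. of_int (w ! i) * x ^ i) = (1 - 16 * x) ^ 4" for x :: "int fps"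
    unfolding fold
    unfolding w_def foldr.simps o_apply id_apply of_int_1 of_int_0 of_int_minus of_int_numeral
    by Groebner_Basis.algebra
  then have "fps_cong 5 (theta3_inv ^ 5 * (1 - 16 * modular_x) ^ 4)
      (theta3_inv ^ 5 * (\<Sum>i\<le>4. of_int (w ! i) * modular_x ^ i))"
    by simp
  then have "fps_cong 5 (fps_U 5 theta3_inv)
      (theta3_inv * thA^2 * (\<Sum>j\<le>4 div 5. of_int (w ! (5 * j)) * modular_x ^ j))"
    by (rule fps_U_inv_cong[rotated 3]) simp_all
  also have "\<dots> = theta3 ^ 3"
    unfolding w_def using theta3_mult_inv by simp Groebner_Basis.algebra
  finally show ?thesis .
qed

text \<open>E_4 has divisor sums as coefficients, which the sums over forms can express. The factor
  16 clears the denominators of F and E_4(q^4) as polynomials in theta3^4 and theta4^4.\<close>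

lemma fps_U_inv_11_eisen4: "fps_cong 11 (fps_U 11 theta3_inv) (theta3 * (8 * eisen4 + 4 * fps_V 4 eisen4))"
proof -
  have "fps_cong 11 (16 * (theta3 ^ 9 + theta3 ^ 5 * modular_F)) (16 * (theta3 * (8 * eisen4 + 4 * fps_V 4 eisen4)))"
  proof -
    have e: "16 * (t * A^2 + t * A * F) - 16 * (t * (8 * e + 4 * v)) = of_nat 11 * (t * (181 * A * B - 185 * A^2 - 12 * B^2))"
      if "e = 16 * A^2 - 16 * A * B + B^2" "16 * v = A^2 + 14 * A * B + B^2" "16 * F = A - B"
      for t A B F e v :: "int fps"
    proof -
      have "16 * (t * A^2 + t * A * F) - 16 * (t * (8 * e + 4 * v))
          = 16 * t * A^2 + t * A * (16 * F) - t * (128 * e + 4 * (16 * v))"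
        by (simp add: algebra_simps)
      then show ?thesis unfolding that by (simp add: square_simps)
    qed
    have p: "theta3 ^ 9 = theta3 * (thA^2)^2" "theta3 ^ 5 = theta3 * thA^2"
      by Groebner_Basis.algebra+
    have e3: "eisen4 = 16 * (thA^2)^2 - 16 * thA^2 * thB^2 + (thB^2)^2"
      by (unfold eisen4_eq) Groebner_Basis.algebra
    have e4: "16 * fps_V 4 eisen4 = (thA^2)^2 + 14 * thA^2 * thB^2 + (thB^2)^2"
      by (unfold V4_eisen4) Groebner_Basis.algebra
    from fps_congI[OF e[OF e3 e4 modular_F_eq, of theta3]] show ?thesis unfolding p .
  qed
  then have "fps_cong 11 (theta3 ^ 9 + theta3 ^ 5 * modular_F) (theta3 * (8 * eisen4 + 4 * fps_V 4 eisen4))"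
  proof (rule fps_cong_numeral_cancel)
    have "coprime (2 ^ 4) (11 :: nat)" by (simp only: coprime_power_left_iff) simp
    then show "coprime 16 (11 :: nat)" by simp
  qed
  with fps_U_inv_11 show ?thesis by (rule fps_cong_trans)
qed

section \<open>Sums over indefinite binary quadratic forms\<close>

text \<open>Zagier's set of forms: negative at infinity and positive at p / r. Homogeneous
  coordinates keep the values integral, at the price of a factor r^(2j) in
  \<open>form_sum\<close>.\<close>

definition indef_forms :: "int \<Rightarrow> int \<Rightarrow> int \<Rightarrow> (int \<times> int \<times> int) set" where
  "indef_forms D p r = {(a, b, c). b^2 - 4 * a * c = D \<and> a < 0 \<and> 0 < a * p^2 + b * p * r + c * r^2}"

definition form_sum :: "nat \<Rightarrow> int \<Rightarrow> int \<Rightarrow> int \<Rightarrow> int" where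
  "form_sum j D p r = (\<Sum>(a, b, c)\<in>indef_forms D p r. (a * p^2 + b * p * r + c * r^2) ^ j)"

definition simple_forms :: "int \<Rightarrow> (int \<times> int \<times> int) set" where
  "simple_forms D = {(a, b, c). b^2 - 4 * a * c = D \<and> a < 0 \<and> 0 < c}"

definition simple_sum :: "nat \<Rightarrow> int \<Rightarrow> int" where
  "simple_sum j D = (\<Sum>(a, b, c)\<in>simple_forms D. c ^ j)"

lemma abs_le_square_int: "\<bar>x :: int\<bar> \<le> x^2"
  using self_le_power[of "\<bar>x\<bar>" 2] by (cases "x = 0") auto

text \<open>With Q = Q(p, r), the identity (2 a p + b r)^2 + 4 (-a) Q = D r^2 has nonnegative terms
  on the left, which bounds a, 2 a p + b r and Q; for r nonzero these determine the form.\<close>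

lemma finite_indef_forms: "finite (indef_forms D p r)"
proof (cases "r = 0")
  case True
  have "indef_forms D p r = {}"
    by (auto simp: indef_forms_def True mult_less_0_iff zero_less_mult_iff)
  then show ?thesis by simp
next
  case False
  define M where "M = \<bar>D * r^2\<bar>"
  define f where "f = (\<lambda>(a, b, c). (a, 2 * a * p + b * r, a * p^2 + b * p * r + c * r^2))"
  have "f ` indef_forms D p r \<subseteq> {- M..M} \<times> {- M..M} \<times> {- M..M}"
  proof (rule image_subsetI)
    fix z assume "z \<in> indef_forms D p r"
    then obtain a b c where z: "z = (a, b, c)" and D: "b^2 - 4 * a * c = D" and a: "a < 0"
      and Q: "0 < a * p^2 + b * p * r + c * r^2"
      by (auto simp: indef_forms_def)
    define y where "y = 2 * a * p + b * r"
    define q where "q = a * p^2 + b * p * r + c * r^2"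
    have e: "y^2 + 4 * (- a) * q = D * r^2"
      unfolding D[symmetric] y_def q_def by (simp add: square_simps)
    have "- a \<le> (- a) * q" "q \<le> (- a) * q"
      using a Q mult_left_mono[of 1 q "- a"] mult_right_mono[of 1 "- a" q] by (auto simp: q_def)
    moreover have "0 \<le> y^2" "\<bar>y\<bar> \<le> y^2" by (auto simp: abs_le_square_int)
    moreover have "y^2 \<le> M" "4 * ((- a) * q) \<le> M"
      using e \<open>- a \<le> (- a) * q\<close> a \<open>0 \<le> y^2\<close> unfolding M_def by linarith+
    ultimately have "\<bar>y\<bar> \<le> M" "\<bar>a\<bar> \<le> M" "\<bar>q\<bar> \<le> M"
      using a Q unfolding q_def[symmetric] by linarith+
    then show "f z \<in> {- M..M} \<times> {- M..M} \<times> {- M..M}"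
      by (auto simp: z f_def y_def q_def)
  qed
  then have "finite (f ` indef_forms D p r)" by (rule finite_subset) auto
  moreover have "inj_on f (indef_forms D p r)"
    using False by (auto simp: inj_on_def f_def)
  ultimately show ?thesis by (rule finite_imageD)
qed

lemma simple_forms_eq: "simple_forms D = indef_forms D 0 1"
  by (simp add: simple_forms_def indef_forms_def)

lemma finite_simple_forms: "finite (simple_forms D)"
  by (simp add: simple_forms_eq finite_indef_forms)

lemma form_sum_0_1: "form_sum j D 0 1 = simple_sum j D"
  by (simp add: form_sum_def simple_sum_def simple_forms_eq)

lemma form_sum_0: "form_sum j D p 0 = 0"
proof -
  have "indef_forms D p 0 = {}"
    by (auto simp: indef_forms_def mult_less_0_iff zero_less_mult_iff)
  then show ?thesis by (simp add: form_sum_def)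
qed

lemma form_sum_shift: "form_sum j D (p + s * r) r = form_sum j D p r"
  unfolding form_sum_def
  by (rule sum.reindex_bij_witness[of _ "\<lambda>(a, b, c). (a, b - 2 * a * s, a * s^2 - b * s + c)"
        "\<lambda>(a, b, c). (a, b + 2 * a * s, a * s^2 + b * s + c)"])
    (auto simp: indef_forms_def square_simps)

lemma form_sum_minus: "form_sum j D (- p) r = form_sum j D p r"
  unfolding form_sum_def
  by (rule sum.reindex_bij_witness[of _ "\<lambda>(a, b, c). (a, - b, c)" "\<lambda>(a, b, c). (a, - b, c)"])
    (auto simp: indef_forms_def)

text \<open>Both sums run over forms positive at (p, r), one with a < 0, the other with c < 0.
  Common forms cancel. The rest have a < 0 < c, or c < 0 < a; negating the latter, with j odd,
  completes the sum over all simple forms. That D is not a square excludes a = 0 and c = 0.\<close>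

lemma form_sum_swap:
  assumes D: "\<And>b. b^2 \<noteq> D" and j: "odd j"
  shows "form_sum j D p r - form_sum j D r p
       = (\<Sum>(a, b, c)\<in>simple_forms D. (a * p^2 + b * p * r + c * r^2) ^ j)"
proof -
  define q where "q = (\<lambda>(a, b, c). a * p^2 + b * p * r + c * r^2)"
  define A where "A = indef_forms D p r"
  define B where "B = {(a, b, c). (c, b, a) \<in> indef_forms D r p}"
  have B_alt: "B = (\<lambda>(a, b, c). (c, b, a)) ` indef_forms D r p"
    by (force simp: B_def)
  have fin: "finite A" "finite B"
    unfolding A_def B_alt by (simp_all add: finite_indef_forms)
  have nz: "a \<noteq> 0 \<and> c \<noteq> 0" if "b^2 - 4 * a * c = D" for a b c :: int
    using that D[of b] by auto
  have "form_sum j D r p = (\<Sum>z\<in>B. q z ^ j)"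
    unfolding form_sum_def
    by (rule sum.reindex_bij_witness[of _ "\<lambda>(a, b, c). (c, b, a)" "\<lambda>(a, b, c). (c, b, a)"])
      (auto simp: B_def q_def algebra_simps)
  moreover have "form_sum j D p r = (\<Sum>z\<in>A. q z ^ j)"
    by (simp add: form_sum_def A_def q_def case_prod_unfold)
  moreover have "(\<Sum>z\<in>A. q z ^ j) - (\<Sum>z\<in>B. q z ^ j) = (\<Sum>z\<in>A - B. q z ^ j) - (\<Sum>z\<in>B - A. q z ^ j)"
    using sum.Int_Diff[OF fin(1), of "\<lambda>z. q z ^ j" B] sum.Int_Diff[OF fin(2), of "\<lambda>z. q z ^ j" A]
    by (simp add: Int_commute)
  moreover have "(\<Sum>z\<in>B - A. q z ^ j) = (\<Sum>z\<in>{z \<in> simple_forms D. q z < 0}. - (q z ^ j))"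
  proof (rule sum.reindex_bij_witness[of _ "\<lambda>(a, b, c). (- a, - b, - c)" "\<lambda>(a, b, c). (- a, - b, - c)"], goal_cases)
    case (2 z)
    obtain a b c where z: "z = (a, b, c)" by (cases z)
    have "b^2 - 4 * a * c = D" "c < 0" "q z > 0" "\<not> a < 0"
      using 2 by (auto simp: B_def A_def indef_forms_def q_def z algebra_simps)
    moreover from this nz[of b a c] have "a > 0" by linarith
    ultimately show ?case by (simp add: simple_forms_def z q_def)
  next
    case (4 z)
    obtain a b c where z: "z = (a, b, c)" by (cases z)
    have "b^2 - 4 * a * c = D" "a < 0" "c > 0" "q z < 0"
      using 4 by (auto simp: simple_forms_def z)
    then show ?case by (auto simp: B_def A_def indef_forms_def q_def z algebra_simps)
  qed (use j in \<open>auto simp: q_def case_prod_unfold algebra_simps simp flip: power_minus_odd\<close>)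
  moreover have "A - B = {z \<in> simple_forms D. q z > 0}"
  proof (rule Set.set_eqI)
    fix z :: "int \<times> int \<times> int"
    obtain a b c where z: "z = (a, b, c)" by (cases z)
    show "z \<in> A - B \<longleftrightarrow> z \<in> {z \<in> simple_forms D. q z > 0}"
      using nz[of b a c] by (auto simp: A_def B_def indef_forms_def simple_forms_def q_def z algebra_simps)
  qed
  moreover have "(\<Sum>z\<in>simple_forms D. q z ^ j)
     = (\<Sum>z\<in>{z \<in> simple_forms D. q z > 0}. q z ^ j) + (\<Sum>z\<in>{z \<in> simple_forms D. q z < 0}. q z ^ j)"
  proof -
    have "(\<Sum>z\<in>simple_forms D. q z ^ j)
        = (\<Sum>z\<in>{z \<in> simple_forms D. q z > 0} \<union> {z \<in> simple_forms D. q z < 0}. q z ^ j)"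
      using j by (intro sum.mono_neutral_right) (auto simp: finite_simple_forms not_less odd_pos)
    then show ?thesis
      by (subst (asm) sum.union_disjoint) (auto simp: finite_simple_forms)
  qed
  ultimately show ?thesis by (simp add: sum_negf q_def case_prod_unfold)
qed

text \<open>This involution preserves the discriminant and the signs. With b -> -b it supplies the
  symmetries of the coefficients of the period polynomial.\<close>

lemma sum_simple_forms_sym:
  "(\<Sum>(a, b, c)\<in>simple_forms D. h a b c) = (\<Sum>(a, b, c)\<in>simple_forms D. h (- c) b (- a))"
  by (rule sum.reindex_bij_witness[of _ "\<lambda>(a, b, c). (- c, b, - a)" "\<lambda>(a, b, c). (- c, b, - a)"])
    (auto simp: simple_forms_def algebra_simps)

lemma sum_simple_forms_odd:
  assumes "\<And>a b c. h a (- b) c = - h a b (c :: int)"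
  shows "(\<Sum>(a, b, c)\<in>simple_forms D. h a b c :: int) = 0"
proof -
  have "(\<Sum>(a, b, c)\<in>simple_forms D. h a b c) = (\<Sum>(a, b, c)\<in>simple_forms D. - h a b c)"
    by (rule sum.reindex_bij_witness[of _ "\<lambda>(a, b, c). (a, - b, c)" "\<lambda>(a, b, c). (a, - b, c)"])
      (auto simp: simple_forms_def assms)
  then show ?thesis by (simp add: sum_negf case_prod_unfold)
qed

text \<open>Euclid's algorithm: the shift replaces p by p mod r and the swap exchanges the
  arguments, at the cost of a period polynomial which by P is that of a constant function. The
  recursion ends at r = 0.\<close>

lemma form_sum_constant:
  assumes D: "\<And>b. b^2 \<noteq> D" and j: "odd j"
    and P: "\<And>p r. (\<Sum>(a, b, c)\<in>simple_forms D. (a * p^2 + b * p * r + c * r^2) ^ j)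
              = (r ^ (2 * j) - p ^ (2 * j)) * simple_sum j D"
  shows "form_sum j D p r = r ^ (2 * j) * simple_sum j D"
proof (induction "nat \<bar>r\<bar>" arbitrary: p r rule: less_induct)
  case less
  show ?case
  proof (cases "r = 0")
    case True
    then show ?thesis using j by (simp add: form_sum_0 odd_pos)
  next
    case False
    have "form_sum j D p r = form_sum j D (p mod r) r"
      using form_sum_shift[of j D "p mod r" "p div r" r] by (simp add: mult.commute)
    also have "\<dots> = form_sum j D r (p mod r) + (r ^ (2 * j) - (p mod r) ^ (2 * j)) * simple_sum j D"
      using form_sum_swap[OF D j, of "p mod r" r] P by simp
    also have "form_sum j D r (p mod r) = (p mod r) ^ (2 * j) * simple_sum j D"
      using abs_mod_less[OF False, of p] by (intro less) simp
    finally show ?thesis by (simp add: algebra_simps)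
  qed
qed

lemma simple_sum_neg: "(\<Sum>(a, b, c)\<in>simple_forms D. a ^ j) = - simple_sum j D" if "odd j"
  unfolding simple_sum_def using sum_simple_forms_sym[of "\<lambda>a b c. a ^ j" D] that
  by (simp add: sum_negf case_prod_unfold)

lemma form_sum_1:
  assumes D: "\<And>b. b^2 \<noteq> D"
  shows "form_sum 1 D p r = r ^ (2 * 1) * simple_sum 1 D"
proof (rule form_sum_constant[OF D])
  fix p r
  have "(\<Sum>(a, b, c)\<in>simple_forms D. (a * p^2 + b * p * r + c * r^2) ^ 1)
      = p^2 * (\<Sum>(a, b, c)\<in>simple_forms D. a ^ 1) + p * r * (\<Sum>(a, b, c)\<in>simple_forms D. b)
        + r^2 * (\<Sum>(a, b, c)\<in>simple_forms D. c ^ 1)"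
    unfolding sum_distrib_left sum.distrib[symmetric] by (intro sum.cong) auto
  also have "(\<Sum>(a, b, c)\<in>simple_forms D. b) = 0"
    by (rule sum_simple_forms_odd) simp
  also have "(\<Sum>(a, b, c)\<in>simple_forms D. a ^ 1) = - simple_sum 1 D" by (rule simple_sum_neg) simp
  also have "(\<Sum>(a, b, c)\<in>simple_forms D. c ^ 1) = simple_sum 1 D" by (simp only: simple_sum_def)
  finally have e: "(\<Sum>(a, b, c)\<in>simple_forms D. (a * p^2 + b * p * r + c * r^2) ^ 1)
      = p^2 * - simple_sum 1 D + p * r * 0 + r^2 * simple_sum 1 D" .
  show "(\<Sum>(a, b, c)\<in>simple_forms D. (a * p^2 + b * p * r + c * r^2) ^ 1)
      = (r ^ (2 * 1) - p ^ (2 * 1)) * simple_sum 1 D"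
    unfolding e by (simp add: square_simps)
qed simp

text \<open>For cubes the period polynomial could also contain a multiple \<open>W\<close> of
  \<open>p\<^sup>2 r\<^sup>4 - p\<^sup>4 r\<^sup>2\<close>; comparing the values at \<open>1/2\<close>, \<open>1/3\<close> and \<open>2/3\<close> excludes it.\<close>

lemma form_sum_3:
  assumes D: "\<And>b. b^2 \<noteq> D"
  shows "form_sum 3 D p r = r ^ (2 * 3) * simple_sum 3 D"
proof -
  define Z where "Z = simple_sum 3 D"
  define W where "W = (\<Sum>(a, b, c)\<in>simple_forms D. a * c^2 + b^2 * c)"
  define P where "P p r = (\<Sum>(a, b, c)\<in>simple_forms D. (a * p^2 + b * p * r + c * r^2) ^ 3)" for p r
  have P: "P p r = (r ^ 6 - p ^ 6) * Z + 3 * (p^2 * r ^ 4 - p ^ 4 * r^2) * W" for p r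
  proof -
    have "P p r = p ^ 6 * (\<Sum>(a, b, c)\<in>simple_forms D. a ^ 3) + r ^ 6 * (\<Sum>(a, b, c)\<in>simple_forms D. c ^ 3)
       + (\<Sum>(a, b, c)\<in>simple_forms D. 3 * a^2 * b * p ^ 5 * r + (6 * a * b * c + b ^ 3) * (p * r) ^ 3 + 3 * b * c^2 * p * r ^ 5)
       + 3 * p ^ 4 * r^2 * (\<Sum>(a, b, c)\<in>simple_forms D. a^2 * c + a * b^2)
       + 3 * p^2 * r ^ 4 * (\<Sum>(a, b, c)\<in>simple_forms D. a * c^2 + b^2 * c)"
      unfolding P_def sum_distrib_left sum.distrib[symmetric]
    proof (intro sum.cong refl)
      fix z assume "z \<in> simple_forms D"
      obtain a b c where z: "z = (a, b, c)" by (cases z)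
      have "(a * p^2 + b * p * r + c * r^2) ^ 3 = p ^ 6 * a ^ 3 + r ^ 6 * c ^ 3 +
        (3 * a^2 * b * p ^ 5 * r + (6 * a * b * c + b ^ 3) * (p * r) ^ 3 + 3 * b * c^2 * p * r ^ 5) +
        3 * p ^ 4 * r^2 * (a^2 * c + a * b^2) + 3 * p^2 * r ^ 4 * (a * c^2 + b^2 * c)"
        by Groebner_Basis.algebra
      then show "(case z of (a, b, c) \<Rightarrow> (a * p^2 + b * p * r + c * r^2) ^ 3) =
         p ^ 6 * (case z of (a, b, c) \<Rightarrow> a ^ 3) + r ^ 6 * (case z of (a, b, c) \<Rightarrow> c ^ 3) +
         (case z of (a, b, c) \<Rightarrow> 3 * a^2 * b * p ^ 5 * r + (6 * a * b * c + b ^ 3) * (p * r) ^ 3 + 3 * b * c^2 * p * r ^ 5) +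
         3 * p ^ 4 * r^2 * (case z of (a, b, c) \<Rightarrow> a^2 * c + a * b^2) +
         3 * p^2 * r ^ 4 * (case z of (a, b, c) \<Rightarrow> a * c^2 + b^2 * c)"
        by (simp only: z prod.case)
    qed
    also have "(\<Sum>(a, b, c)\<in>simple_forms D. 3 * a^2 * b * p ^ 5 * r + (6 * a * b * c + b ^ 3) * (p * r) ^ 3 + 3 * b * c^2 * p * r ^ 5) = 0"
      by (rule sum_simple_forms_odd) (simp add: algebra_simps)
    also have "(\<Sum>(a, b, c)\<in>simple_forms D. a^2 * c + a * b^2) = - W"
      unfolding W_def using sum_simple_forms_sym[of "\<lambda>a b c. a^2 * c + a * b^2" D]
      by (simp add: case_prod_unfold algebra_simps flip: sum_negf)
    also have "(\<Sum>(a, b, c)\<in>simple_forms D. a ^ 3) = - Z"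
      unfolding Z_def by (rule simple_sum_neg) simp
    also have "(\<Sum>(a, b, c)\<in>simple_forms D. c ^ 3) = Z" by (simp add: Z_def simple_sum_def)
    finally show ?thesis unfolding W_def[symmetric] by (simp add: algebra_simps)
  qed
  have exchange: "form_sum 3 D p r = form_sum 3 D r p + P p r" for p r
    using form_sum_swap[OF D, of 3 p r] by (simp add: P_def)
  have at_int: "form_sum 3 D p 1 = Z" for p
    using form_sum_shift[of 3 D 0 p 1] by (simp add: form_sum_0_1 Z_def)
  have "form_sum 3 D 2 3 = form_sum 3 D 1 3"
    using form_sum_shift[of 3 D "- 1" 1 3] form_sum_minus[of 3 D 1 3] by simp
  moreover have "form_sum 3 D 3 2 = form_sum 3 D 1 2"
    using form_sum_shift[of 3 D 1 1 2] by simp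
  ultimately have "P 1 3 = P 1 2 + P 2 3"
    using exchange[of 1 2] exchange[of 1 3] exchange[of 2 3] at_int[of 2] at_int[of 3] by simp
  \<comment> \<open>The multiples of Z agree, 728 = 63 + 665, while those of W give 216 W = 36 W +
    540 W.\<close>
  then have W: "W = 0" unfolding P by simp
  show ?thesis
  proof (rule form_sum_constant[OF D])
    show "(\<Sum>(a, b, c)\<in>simple_forms D. (a * p^2 + b * p * r + c * r^2) ^ 3)
        = (r ^ (2 * 3) - p ^ (2 * 3)) * simple_sum 3 D" for p r
      using P[of p r] unfolding P_def W Z_def by simp
  qed simp
qed

section \<open>Sublattices of index l and the Hecke relation for sums over forms\<close>

lemma square_dvd_of_prime_dvd:
  fixes x l :: int
  assumes "prime l" "l dvd x^2"
  shows "l dvd x"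
  using assms by (simp add: prime_dvd_power_iff)

context
  fixes l D :: int
  assumes l: "prime l" "odd l" and D: "l dvd D" "\<not> l^2 dvd D"
begin

lemma prime_dvd_2_mult: "l dvd 2 * x \<Longrightarrow> l dvd x"
  using l(2) by (simp add: coprime_dvd_mult_right_iff)

text \<open>If l divides A, it divides all coefficients, and the quotient form has discriminant D.
  There l does not divide a: otherwise l divides b and c too, and l^2 would divide D.\<close>

lemma hecke_common:
  assumes "B^2 - 4 * A * C = l^2 * D" "l^2 dvd A * s^2 - B * s + C" "l dvd A"
  obtains a b c where "A = l * a" "B = l * b" "C = l * c" "b^2 - 4 * a * c = D"
    "l dvd a * s^2 - b * s + c" "\<not> l dvd a"
proof -
  have l0: "l \<noteq> 0" using l(1) by auto
  have "B^2 = l^2 * D + 4 * A * C" using assms(1) by simp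
  then have "l dvd B^2" using assms(3) by (simp add: power2_eq_square)
  then have lB: "l dvd B" by (rule square_dvd_of_prime_dvd[OF l(1)])
  have "l dvd A * s^2 - B * s + C" using assms(2) by (metis dvd_trans dvd_triv_left power2_eq_square)
  moreover have "l dvd A * s^2 - B * s" using assms(3) lB by simp
  ultimately have lC: "l dvd C" by (simp only: dvd_add_right_iff)
  obtain a b c where abc: "A = l * a" "B = l * b" "C = l * c"
    using assms(3) lB lC by (auto elim!: dvdE)
  have "l^2 * (b^2 - 4 * a * c) = l^2 * D"
    using assms(1) unfolding abc by (simp add: square_simps)
  then have disc: "b^2 - 4 * a * c = D" using l0 by simp
  have "A * s^2 - B * s + C = l * (a * s^2 - b * s + c)"
    unfolding abc by (simp add: algebra_simps)
  then have ls: "l dvd a * s^2 - b * s + c" using assms(2) l0 by (simp add: power2_eq_square)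
  have "\<not> l dvd a"
  proof
    assume la: "l dvd a"
    have "b^2 = D + 4 * a * c" using disc by simp
    then have "l dvd b^2" using la D(1) by simp
    then have lb: "l dvd b" by (rule square_dvd_of_prime_dvd[OF l(1)])
    then have "l dvd a * s^2 - b * s" using la by simp
    then have "l dvd c" using ls by (simp only: dvd_add_right_iff)
    then have "l^2 dvd b^2 - 4 * a * c"
      using la lb unfolding power2_eq_square by (intro dvd_diff mult_dvd_mono) auto
    then show False using D(2) disc by simp
  qed
  then show ?thesis using that abc disc ls by blast
qed

text \<open>Modulo l the form, or its quotient by l, has discriminant 0. So s is a double root,
  fixed by the linear congruence 2 a s = b modulo l.\<close>

lemma hecke_unique:
  assumes d: "B^2 - 4 * A * C = l^2 * D"
    and s: "l^2 dvd A * s^2 - B * s + C" "l^2 dvd A * t^2 - B * t + C"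
    and r: "s \<in> {0..<l}" "t \<in> {0..<l}"
  shows "s = t"
proof -
  have *: "s = t" if "l dvd 2 * a * s - b" "l dvd 2 * a * t - b" "\<not> l dvd a" for a b
  proof -
    have "l dvd 2 * (a * (s - t))" using dvd_diff[OF that(1,2)] by (simp add: algebra_simps)
    then have "l dvd a * (s - t)" by (rule prime_dvd_2_mult)
    then have "l dvd s - t" using that(3) l(1) by (simp add: prime_dvd_mult_iff)
    then show ?thesis using r zdvd_imp_le[of l "s - t"] zdvd_imp_le[of l "t - s"]
      by (cases s t rule: linorder_cases) (auto simp: dvd_diff_commute)
  qed
  show ?thesis
  proof (cases "l dvd A")
    case False
    have "l dvd 2 * A * x - B" if "l^2 dvd A * x^2 - B * x + C" for x
    proof (rule square_dvd_of_prime_dvd[OF l(1)])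
      have "(2 * A * x - B)^2 = l^2 * D + 4 * A * (A * x^2 - B * x + C)"
        unfolding d[symmetric] by (simp add: square_simps)
      then have "l^2 dvd (2 * A * x - B)^2" using that by simp
      then show "l dvd (2 * A * x - B)^2" by (metis dvd_trans dvd_triv_left power2_eq_square)
    qed
    then show ?thesis using * s False by blast
  next
    case True
    obtain a b c where h: "A = l * a" "B = l * b" "C = l * c" "b^2 - 4 * a * c = D"
      "l dvd a * s^2 - b * s + c" "\<not> l dvd a"
      using hecke_common[OF d s(1) True] by blast
    have "l \<noteq> 0" using l(1) by auto
    have "A * t^2 - B * t + C = l * (a * t^2 - b * t + c)" unfolding h(1-3) by (simp add: algebra_simps)
    then have t: "l dvd a * t^2 - b * t + c" using s(2) \<open>l \<noteq> 0\<close> by (simp add: power2_eq_square)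
    have "l dvd 2 * a * x - b" if "l dvd a * x^2 - b * x + c" for x
    proof (rule square_dvd_of_prime_dvd[OF l(1)])
      have "(2 * a * x - b)^2 = D + 4 * a * (a * x^2 - b * x + c)"
        unfolding h(4)[symmetric] by (simp add: square_simps)
      then show "l dvd (2 * a * x - b)^2" using that D(1) by simp
    qed
    then show ?thesis using * h t by blast
  qed
qed

lemma hecke_exclusive:
  assumes "B^2 - 4 * A * C = l^2 * D" "l^2 dvd A * s^2 - B * s + C"
  shows "\<not> l^2 dvd A"
proof
  assume A: "l^2 dvd A"
  then have "l dvd A" by (metis dvd_trans dvd_triv_left power2_eq_square)
  from hecke_common[OF assms this] obtain a where "A = l * a" "\<not> l dvd a" by blast
  moreover have "l \<noteq> 0" using l(1) by auto
  ultimately show False using A by (simp add: power2_eq_square)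
qed

lemma hecke_root:
  assumes "\<not> l dvd a"
  obtains s where "s \<in> {0..<l}" "l dvd 2 * a * s - b"
proof -
  have "\<not> l dvd 2 * a" using assms prime_dvd_2_mult by blast
  then have "coprime (2 * a) l" using prime_imp_coprime[OF l(1)] coprime_commute by blast
  then obtain x where "[2 * a * x = b] (mod l)"
    using cong_solve_coprime_int[of "2 * a" l] by (metis cong_scalar_right mult.assoc mult_1_left)
  then have "l dvd 2 * a * x - b" by (simp add: cong_iff_dvd_diff)
  moreover have "l dvd 2 * a * (x mod l) - 2 * a * x"
    by (metis dvd_mult mod_0_imp_dvd mod_diff_left_eq right_diff_distrib diff_self mod_0)
  ultimately have "l dvd 2 * a * (x mod l) - b" using dvd_add by fastforce
  moreover have "x mod l \<in> {0..<l}" using prime_gt_0_int[OF l(1)] by simp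
  ultimately show ?thesis using that by blast
qed

text \<open>The double root modulo l works: 4 A (A s^2 - B s + C) = (2 A s - B)^2 - l^2 D if l does
  not divide A, and the same identity for the quotient form otherwise.\<close>

lemma hecke_exists:
  assumes d: "B^2 - 4 * A * C = l^2 * D" and A: "\<not> l^2 dvd A"
  shows "\<exists>s\<in>{0..<l}. l^2 dvd A * s^2 - B * s + C"
proof (cases "l dvd A")
  case False
  obtain s where s: "s \<in> {0..<l}" "l dvd 2 * A * s - B" using hecke_root[OF False] .
  have "l^2 dvd (2 * A * s - B)^2" using s(2) by (rule dvd_power_same)
  moreover have "2 * (2 * (A * (A * s^2 - B * s + C))) = (2 * A * s - B)^2 - l^2 * D"
    unfolding d[symmetric] by (simp add: square_simps)
  ultimately have h: "l^2 dvd 2 * (2 * (A * (A * s^2 - B * s + C)))" by simp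
  have "coprime (l^2) 2" "coprime (l^2) A"
    using False l(2) prime_imp_coprime[OF l(1)] by auto
  then have "l^2 dvd A * s^2 - B * s + C" using h by (simp only: coprime_dvd_mult_right_iff)
  then show ?thesis using s(1) by blast
next
  case True
  have l0: "l \<noteq> 0" using l(1) by auto
  obtain a where a: "A = l * a" using True by (elim dvdE)
  have la: "\<not> l dvd a" using A l0 by (simp add: a power2_eq_square)
  have "B^2 = l^2 * D + 4 * A * C" using d by simp
  then have "l dvd B^2" using True by (simp add: power2_eq_square)
  then have "l dvd B" by (rule square_dvd_of_prime_dvd[OF l(1)])
  then obtain b where b: "B = l * b" by (elim dvdE)
  have "l * (2 * (2 * (a * C))) = l * (l * (b^2 - D))" using d unfolding a b by (simp add: square_simps)
  then have "2 * (2 * (a * C)) = l * (b^2 - D)" using l0 by simp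
  then have "l dvd 2 * (2 * (a * C))" by simp
  then have "l dvd C" using la l(1) by (metis prime_dvd_2_mult prime_dvd_mult_iff)
  then obtain c where c: "C = l * c" by (elim dvdE)
  have "l^2 * (b^2 - 4 * a * c) = l^2 * D"
    using d unfolding a b c by (simp add: square_simps)
  then have disc: "b^2 - 4 * a * c = D" using l0 by simp
  obtain s where s: "s \<in> {0..<l}" "l dvd 2 * a * s - b" using hecke_root[OF la] .
  have "2 * (2 * (a * (a * s^2 - b * s + c))) = (2 * a * s - b)^2 - D"
    unfolding disc[symmetric] by (simp add: square_simps)
  moreover have "l dvd (2 * a * s - b)^2" using s(2) by (simp add: power2_eq_square)
  ultimately have "l dvd 2 * (2 * (a * (a * s^2 - b * s + c)))" using D(1) by simp
  then have "l dvd a * s^2 - b * s + c" using la l(1) by (metis prime_dvd_2_mult prime_dvd_mult_iff)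
  then have "l * l dvd l * (a * s^2 - b * s + c)" by simp
  then have "l^2 dvd A * s^2 - B * s + C" unfolding a b c by (simp add: square_simps)
  then show ?thesis using s(1) by blast
qed

text \<open>A form of discriminant l^2 D is the restriction of a form of discriminant D to a
  sublattice of index l in exactly one way. The l + 1 sublattices are indexed by s in {0..<l} and by
  the case in which l^2 divides A.\<close>

lemma simple_sum_hecke_split:
  "simple_sum j (l^2 * D) = (\<Sum>s\<in>{0..<l}. form_sum j D s l) + simple_sum j D"
proof -
  have l0: "l > 0" using l(1) by (rule prime_gt_0_int)
  define X where "X = {(A, B, C) \<in> simple_forms (l^2 * D). \<not> l^2 dvd A}"
  define Y where "Y = {(A, B, C) \<in> simple_forms (l^2 * D). l^2 dvd A}"
  define S where "S = Sigma {0..<l} (\<lambda>s. indef_forms D s l)"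
  \<comment> \<open>The restriction of the form [a, b, c] to the lattice spanned by (1, 0) and (s,
    l).\<close>
  define g where "g = (\<lambda>(s, a, b, c). (a, b * l + 2 * a * s, a * s^2 + b * s * l + c * l^2))"
  have "simple_sum j (l^2 * D) = (\<Sum>(A, B, C)\<in>X \<union> Y. C ^ j)"
    unfolding simple_sum_def by (rule sum.cong) (auto simp: X_def Y_def)
  also have "\<dots> = (\<Sum>(A, B, C)\<in>X. C ^ j) + (\<Sum>(A, B, C)\<in>Y. C ^ j)"
    by (rule sum.union_disjoint)
      (auto simp: X_def Y_def intro: finite_subset[OF _ finite_simple_forms[of "l^2 * D"]])
  also have "(\<Sum>(A, B, C)\<in>Y. C ^ j) = simple_sum j D"
    unfolding simple_sum_def
  proof (rule sum.reindex_bij_witness[of _ "\<lambda>(a, b, c). (l^2 * a, l * b, c)" "\<lambda>(A, B, C). (A div l^2, B div l, C)"], goal_cases)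
    case (1 z)
    then obtain A B C where z: "z = (A, B, C)" and h: "(A, B, C) \<in> simple_forms (l^2 * D)" "l^2 dvd A"
      by (auto simp: Y_def)
    have "B^2 = l^2 * D + 4 * A * C" using h(1) by (simp add: simple_forms_def)
    then have "l^2 dvd B^2" using h(2) by simp
    then have "l dvd B" by simp
    then show ?case using h(2) by (simp add: z)
  next
    case (2 z)
    then obtain A B C where z: "z = (A, B, C)" and h: "(A, B, C) \<in> simple_forms (l^2 * D)" "l^2 dvd A"
      by (auto simp: Y_def)
    have d: "B^2 - 4 * A * C = l^2 * D" "A < 0" "0 < C" using h(1) by (auto simp: simple_forms_def)
    then have "B^2 = l^2 * D + 4 * A * C" by simp
    then have "l^2 dvd B^2" using h(2) by simp
    then have "l dvd B" by simp
    then obtain b where b: "B = l * b" by (elim dvdE)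
    obtain a where a: "A = l^2 * a" using h(2) by (elim dvdE)
    have "l^2 * (b^2 - 4 * a * C) = l^2 * D" using d(1) unfolding a b by (simp add: square_simps)
    then have "b^2 - 4 * a * C = D" using l0 by simp
    moreover have "a < 0" using d(2) l0 by (simp add: a mult_less_0_iff)
    ultimately show ?case using l0 d(3) by (simp add: z a b simple_forms_def)
  next
    case (3 z)
    then show ?case using l0 by (auto simp: simple_forms_def)
  next
    case (4 z)
    then obtain a b c where z: "z = (a, b, c)" and h: "b^2 - 4 * a * c = D" "a < 0" "0 < c"
      by (auto simp: simple_forms_def)
    have "(l * b)^2 - 4 * (l^2 * a) * c = l^2 * D"
      unfolding h(1)[symmetric] by (simp add: square_simps)
    then show ?case using h l0 by (simp add: z Y_def simple_forms_def mult_less_0_iff)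
  qed auto
  also have "(\<Sum>(A, B, C)\<in>X. C ^ j) = (\<Sum>(s, a, b, c)\<in>S. (a * s^2 + b * s * l + c * l^2) ^ j)"
  proof -
    have inj: "inj_on g S"
    proof (rule inj_onI)
      fix x y assume xy: "x \<in> S" "y \<in> S" "g x = g y"
      obtain s a b c where x: "x = (s, a, b, c)" by (cases x)
      obtain t a' b' c' where y: "y = (t, a', b', c')" by (cases y)
      have h: "s \<in> {0..<l}" "t \<in> {0..<l}" "b^2 - 4 * a * c = D"
        using xy(1,2) by (auto simp: S_def x y indef_forms_def)
      have e: "a' = a" "b' * l + 2 * a' * t = b * l + 2 * a * s"
        "a' * t^2 + b' * t * l + c' * l^2 = a * s^2 + b * s * l + c * l^2"
        using xy(3) by (auto simp: g_def x y)
      define B where "B = b * l + 2 * a * s"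
      define C where "C = a * s^2 + b * s * l + c * l^2"
      have "B^2 - 4 * a * C = l^2 * D"
        unfolding h(3)[symmetric] B_def C_def by (simp add: square_simps)
      moreover have "a * s^2 - B * s + C = l^2 * c"
        unfolding B_def C_def by (simp add: square_simps)
      moreover have "a * t^2 - B * t + C = l^2 * c'"
        unfolding B_def C_def e(2,3)[symmetric] e(1) by (simp add: square_simps)
      ultimately have st: "s = t" using h(1,2) by (intro hecke_unique[of B a C s t]) auto
      then have "b' = b" using e(1,2) l0 by simp
      moreover have "c' = c" using e st \<open>b' = b\<close> l0 by simp
      ultimately show "x = y" using e(1) st by (simp add: x y)
    qed
    have im: "g ` S = X"
    proof (rule subset_antisym; rule subsetI)
      fix z assume "z \<in> g ` S"
      then obtain s a b c where z: "z = g (s, a, b, c)" and h: "b^2 - 4 * a * c = D" "a < 0"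
        "0 < a * s^2 + b * s * l + c * l^2"
        by (auto simp: S_def indef_forms_def)
      define B where "B = b * l + 2 * a * s"
      define C where "C = a * s^2 + b * s * l + c * l^2"
      have d: "B^2 - 4 * a * C = l^2 * D"
        unfolding h(1)[symmetric] B_def C_def by (simp add: square_simps)
      have "a * s^2 - B * s + C = l^2 * c"
        unfolding B_def C_def by (simp add: square_simps)
      then have "\<not> l^2 dvd a" by (intro hecke_exclusive[OF d, of s]) simp
      then show "z \<in> X" using d h(2,3) by (simp add: z g_def X_def simple_forms_def B_def C_def)
    next
      fix z assume "z \<in> X"
      then obtain A B C where z: "z = (A, B, C)" and d: "B^2 - 4 * A * C = l^2 * D" "A < 0" "0 < C"
        and nd: "\<not> l^2 dvd A"
        by (auto simp: X_def simple_forms_def)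
      obtain s where s: "s \<in> {0..<l}" "l^2 dvd A * s^2 - B * s + C" using hecke_exists[OF d(1) nd] by blast
      have "(2 * A * s - B)^2 = l^2 * D + 4 * A * (A * s^2 - B * s + C)"
        unfolding d(1)[symmetric] by (simp add: square_simps)
      then have "l^2 dvd (2 * A * s - B)^2" using s(2) by simp
      then have "l dvd 2 * A * s - B" by simp
      then obtain b where b: "2 * A * s - B = l * b" by (elim dvdE)
      obtain c where c: "A * s^2 - B * s + C = l^2 * c" using s(2) by (elim dvdE)
      have B: "B = (- b) * l + 2 * A * s" using b by (simp add: algebra_simps)
      have C: "C = A * s^2 + (- b) * s * l + c * l^2" using c unfolding B by (simp add: square_simps)
      have "l^2 * ((- b)^2 - 4 * A * c) = l^2 * D"
        using d(1) unfolding C B by (simp add: square_simps)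
      then have "(- b)^2 - 4 * A * c = D" using l0 by simp
      then have "(s, A, - b, c) \<in> S" using s(1) d(2,3) C by (simp add: S_def indef_forms_def)
      moreover have "z = g (s, A, - b, c)" using B C by (simp add: z g_def)
      ultimately show "z \<in> g ` S" by (rule rev_image_eqI)
    qed
    show ?thesis
      unfolding im[symmetric] sum.reindex[OF inj] by (intro sum.cong) (auto simp: g_def)
  qed
  also have "\<dots> = (\<Sum>s\<in>{0..<l}. form_sum j D s l)"
    unfolding S_def form_sum_def by (subst sum.Sigma) (auto simp: finite_indef_forms)
  finally show ?thesis .
qed

lemma not_square_of_prime_exactly_dvd: "b^2 \<noteq> D"
proof
  assume "b^2 = D"
  then have "l dvd b" using D(1) square_dvd_of_prime_dvd[OF l(1)] by blast
  then have "l^2 dvd D" using \<open>b^2 = D\<close> dvd_power_same by blast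
  then show False using D(2) by simp
qed

lemma simple_sum_hecke:
  assumes "j = 1 \<or> j = 3"
  shows "simple_sum j (l^2 * D) = (1 + l ^ (2 * j + 1)) * simple_sum j D"
proof -
  have "form_sum j D s l = l ^ (2 * j) * simple_sum j D" for s
    using assms form_sum_1[OF not_square_of_prime_exactly_dvd] form_sum_3[OF not_square_of_prime_exactly_dvd]
    by auto
  moreover have "int (nat l) = l" using prime_gt_0_int[OF l(1)] by simp
  ultimately show ?thesis
    unfolding simple_sum_hecke_split by (simp add: algebra_simps)
qed

end

text \<open>A square x^2 < n and a divisor d of (n - x^2) / 4 correspond to the form
  [-(n - x^2) / (4 d), x, d] of discriminant n.\<close>

lemma theta3_mult_V4_divisor_series_nth:
  "fps_nth (theta3 * fps_V 4 (divisor_series j)) n = simple_sum j (int n)"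
proof -
  define N where "N x = nat (int n - x^2)" for x
  have "fps_nth (theta3 * fps_V 4 (divisor_series j)) n
      = (\<Sum>x\<in>{x. x^2 \<le> int n}. \<Sum>d | 4 * d dvd N x \<and> N x > 0. int d ^ j)"
    unfolding theta3_def sq_series_mult_nth
  proof (intro sum.cong refl)
    fix x assume "x \<in> {x. x^2 \<le> int n}"
    have "fps_nth (fps_V 4 (divisor_series j)) m = (\<Sum>d | 4 * d dvd m \<and> m > 0. int d ^ j)" for m
    proof (cases "4 dvd m")
      case True
      then obtain k where "m = 4 * k" by (elim dvdE)
      then show ?thesis by (simp add: fps_V_nth divisor_series_def)
    next
      case False
      then have "{d. 4 * d dvd m \<and> m > 0} = {}" by (auto dest: dvd_mult_left)
      then have "(\<Sum>d | 4 * d dvd m \<and> m > 0. int d ^ j) = 0" by (simp only: sum.empty)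
      then show ?thesis using False by (simp add: fps_V_nth)
    qed
    then show "1 * fps_nth (fps_V 4 (divisor_series j)) (nat (int n - x^2)) = (\<Sum>d | 4 * d dvd N x \<and> N x > 0. int d ^ j)"
      by (simp add: N_def)
  qed
  also have "\<dots> = (\<Sum>(x, d)\<in>Sigma {x. x^2 \<le> int n} (\<lambda>x. {d. 4 * d dvd N x \<and> N x > 0}). int d ^ j)"
  proof (rule sum.Sigma)
    have "finite {d. 4 * d dvd N x \<and> N x > 0}" for x
      by (rule finite_subset[of _ "{..N x}"]) (auto dest: dvd_imp_le)
    then show "\<forall>x\<in>{x. x^2 \<le> int n}. finite {d. 4 * d dvd N x \<and> N x > 0}" by simp
  qed (rule finite_square_le)
  also have "\<dots> = simple_sum j (int n)"
    unfolding simple_sum_def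
  proof (rule sum.reindex_bij_witness[of _ "\<lambda>(a, b, c). (b, nat c)" "\<lambda>(x, d). (- ((int n - x^2) div (4 * int d)), x, int d)"], goal_cases)
    case (2 z)
    then obtain x d where z: "z = (x, d)" and d: "4 * d dvd N x" "N x > 0" by auto
    then obtain k where k: "N x = 4 * d * k" by (elim dvdE)
    then have e: "int n - x^2 = 4 * int d * int k" using d(2) unfolding N_def
      by (metis int_nat_eq of_nat_mult of_nat_numeral zero_less_nat_eq less_imp_le)
    have "d > 0" "k > 0" using k d(2) by (auto intro: gr0I)
    then show ?case using e by (simp add: z simple_forms_def algebra_simps)
  next
    case (3 z)
    then obtain a b c where z: "z = (a, b, c)" and h: "b^2 - 4 * a * c = int n" "a < 0" "0 < c"
      by (auto simp: simple_forms_def)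
    have e: "int n - b^2 = (4 * c) * (- a)" using h(1) by (simp add: algebra_simps)
    then have "(int n - b^2) div (4 * c) = - a" using h(3) by (simp only: nonzero_mult_div_cancel_left)
    then show ?case using h(3) by (simp add: z)
  next
    case (4 z)
    then obtain a b c where z: "z = (a, b, c)" and h: "b^2 - 4 * a * c = int n" "a < 0" "0 < c"
      by (auto simp: simple_forms_def)
    have e: "int n - b^2 = (4 * c) * (- a)" using h(1) by (simp add: algebra_simps)
    moreover have pos: "(4 * c) * (- a) > 0" using h(2,3) by (intro mult_pos_pos) auto
    moreover have "b^2 < int n" using e pos by linarith
    moreover have "4 * nat c dvd N b"
    proof -
      have "int (N b) = int (4 * nat c) * (- a)" using e h(2,3) pos by (simp add: N_def)
      then show ?thesis by (metis dvd_triv_left int_dvd_int_iff)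
    qed
    ultimately show ?case by (simp add: z N_def)
  qed auto
  finally show ?thesis .
qed

lemma even_square_int_iff: "x^2 = int n \<Longrightarrow> even x \<longleftrightarrow> even n"
  by (metis even_of_nat even_power zero_less_numeral)

lemma theta3_nth_4_mult: "fps_nth theta3 (4 * n) = fps_nth theta3 n"
proof -
  have "(\<Sum>x\<in>{x. x^2 = int (4 * n)}. 1) = (\<Sum>x\<in>{x. x^2 = int n}. 1 :: int)"
  proof (rule sum.reindex_bij_witness[of _ "\<lambda>x. 2 * x" "\<lambda>x. x div 2"])
    fix x assume "x \<in> {x. x^2 = int (4 * n)}"
    then have x: "x^2 = int (4 * n)" by simp
    then have "even x" using even_square_int_iff[of x "4 * n"] by simp
    then show "2 * (x div 2) = x" "x div 2 \<in> {x. x^2 = int n}"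
      using x by (auto elim!: evenE simp: power_mult_distrib)
  qed auto
  then show ?thesis by (simp add: theta3_def sq_series_def)
qed

text \<open>As theta3 is fixed by U_4, applying U_4 to the product in the previous lemma undoes V_4
  and passes from discriminant n to 4 n.\<close>

lemma theta3_mult_divisor_series_nth:
  "fps_nth (theta3 * divisor_series j) n = simple_sum j (4 * int n)"
proof -
  have "fps_U 4 theta3 = theta3" by (rule fps_ext) (simp add: theta3_nth_4_mult)
  then have "fps_U 4 (fps_V 4 (divisor_series j) * theta3) = divisor_series j * theta3"
    using fps_U_V_mult[of 4 "divisor_series j" theta3] by simp
  then have "fps_nth (theta3 * divisor_series j) n = fps_nth (fps_U 4 (theta3 * fps_V 4 (divisor_series j))) n"
    by (simp only: mult.commute)
  then show ?thesis by (simp add: theta3_mult_V4_divisor_series_nth)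
qed

section \<open>Hecke relations for five squares and for weight 9/2\<close>

lemma theta3_nth_eq_0: "(\<And>x. x^2 \<noteq> int n) \<Longrightarrow> fps_nth theta3 n = 0"
  by (simp add: theta3_def sq_series_def)

lemma theta3_nth_mod_4:
  assumes "fps_nth theta3 n \<noteq> 0" "\<not> 4 dvd n"
  shows "n mod 4 = 1"
proof -
  obtain x where x: "x^2 = int n" using theta3_nth_eq_0 assms(1) by blast
  have "odd x"
  proof
    assume "even x"
    then have "4 dvd int n" unfolding x[symmetric] by (auto elim!: evenE simp: power_mult_distrib)
    then show False using assms(2) by presburger
  qed
  then obtain y where y: "x = 2 * y + 1" by (elim oddE)
  have "int n = 4 * (y^2 + y) + 1" unfolding x[symmetric] y by (simp add: square_simps)
  then show ?thesis by presburger
qed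

lemma theta3_plus_theta4: "theta3 + theta4 = 2 * fps_V 4 theta3"
proof (rule fps_ext)
  fix n
  have s: "fps_nth theta4 n = (if even n then 1 else - 1) * fps_nth theta3 n"
    unfolding theta3_def theta4_def sq_series_def fps_nth_Abs_fps sum_distrib_left
    by (intro sum.cong refl) (auto simp: even_square_int_iff)
  show "fps_nth (theta3 + theta4) n = fps_nth (2 * fps_V 4 theta3) n"
  proof (cases "4 dvd n")
    case True
    then obtain k where k: "n = 4 * k" by (elim dvdE)
    show ?thesis using s by (simp add: k fps_V_nth theta3_nth_4_mult numeral_fps_const)
  next
    case False
    then have "odd n" if "fps_nth theta3 n \<noteq> 0" using theta3_nth_mod_4[OF that False] by presburger
    then show ?thesis using False by (cases "fps_nth theta3 n = 0") (simp_all add: s fps_V_nth numeral_fps_const)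
  qed
qed

definition fps_supp4 :: "nat \<Rightarrow> int fps \<Rightarrow> bool" where
  "fps_supp4 r f \<longleftrightarrow> (\<forall>n. fps_nth f n \<noteq> 0 \<longrightarrow> n mod 4 = r mod 4)"

lemma fps_supp4_mult:
  assumes "fps_supp4 r f" "fps_supp4 s g"
  shows "fps_supp4 (r + s) (f * g)"
  unfolding fps_supp4_def
proof (intro allI impI)
  fix n assume "fps_nth (f * g) n \<noteq> 0"
  then obtain i where i: "i \<in> {0..n}" "fps_nth f i * fps_nth g (n - i) \<noteq> 0"
    unfolding fps_mult_nth by (meson sum.not_neutral_contains_not_neutral)
  then have "i mod 4 = r mod 4" "(n - i) mod 4 = s mod 4" using assms by (auto simp: fps_supp4_def)
  then have "(i + (n - i)) mod 4 = (r + s) mod 4" by (metis mod_add_cong)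
  then show "n mod 4 = (r + s) mod 4" using i(1) by simp
qed

lemma fps_supp4_power: "fps_supp4 r f \<Longrightarrow> fps_supp4 (j * r) (f ^ j)"
proof (induction j)
  case (Suc j)
  then show ?case using fps_supp4_mult[of r f "j * r" "f ^ j"] by simp
qed (simp add: fps_supp4_def)

text \<open>Write theta3 = V + R with V = theta3(q^4); the exponents of R are 1 modulo 4. In the
  expansion of (V + R)^5 only R^0 and R^4 survive U_4, and 5 * 16 = 80.\<close>

lemma fps_U4_theta3_pow5: "fps_U 4 (theta3 ^ 5) = theta3 ^ 5 + 80 * theta3 * modular_F"
proof -
  define R where "R = theta3 - fps_V 4 theta3"
  define V where "V = fps_V 4 theta3"
  have "fps_supp4 1 R"
    unfolding fps_supp4_def
  proof (intro allI impI)
    fix n assume n: "fps_nth R n \<noteq> 0"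
    have "\<not> 4 dvd n" using n by (auto simp: R_def fps_V_nth theta3_nth_4_mult elim!: dvdE)
    moreover from this have "fps_nth theta3 n \<noteq> 0" using n by (simp add: R_def fps_V_nth)
    ultimately show "n mod 4 = 1 mod 4" using theta3_nth_mod_4 by simp
  qed
  then have supp: "fps_supp4 j (R ^ j)" for j using fps_supp4_power[of 1 R j] by simp
  have U0: "fps_U 4 (R ^ j) = 0" if "\<not> 4 dvd j" for j
  proof (rule fps_ext)
    fix n
    have "(4 * n) mod 4 \<noteq> j mod 4" using that by presburger
    then show "fps_nth (fps_U 4 (R ^ j)) n = fps_nth 0 n"
      using supp[of j] by (auto simp: fps_supp4_def)
  qed
  \<comment> \<open>Here R = (theta3 - theta4) / 2. The factor 1 is the second factor in
    \<open>fps_U_V_mult\<close>.\<close>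
  have R4: "R ^ 4 = fps_V 4 (16 * modular_F) * 1"
  proof -
    have "64 * fps_V 4 modular_F = fps_V 2 (64 * fps_V 2 modular_F)"
      by (simp add: fps_V_mult fps_V_V)
    also have "\<dots> = (fps_V 2 thA - theta3 * theta4)^2"
      unfolding V2_modular_F theta_landen_mult by (simp add: fps_V_simps)
    finally have "16 * (16 * fps_V 4 modular_F) = 16 * R ^ 4"
      using theta_landen_add theta3_plus_theta4 R_def by Groebner_Basis.algebra
    then have "16 * fps_V 4 modular_F = R ^ 4" by (rule fps_numeral_cancel)
    then show ?thesis by (simp add: fps_V_simps)
  qed
  have U4: "fps_U 4 (R ^ 4) = 16 * modular_F"
    unfolding R4 by (subst fps_U_V_mult) (auto intro!: fps_ext)
  have UV: "fps_U 4 (numeral c * V ^ k * g) = numeral c * theta3 ^ k * fps_U 4 g"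
    "fps_U 4 (V ^ k * g) = theta3 ^ k * fps_U 4 g" for c k g
    using fps_U_V_mult[of 4 "numeral c * theta3 ^ k" g] fps_U_V_mult[of 4 "theta3 ^ k" g]
    by (simp_all add: V_def fps_V_simps)
  have "theta3 = V + R" by (simp add: V_def R_def)
  then have "theta3 ^ 5 = V ^ 5 * R ^ 0 + (5 * V ^ 4) * R ^ 1 + (10 * V ^ 3) * R ^ 2 + (10 * V ^ 2) * R ^ 3
      + (5 * V ^ 1) * R ^ 4 + V ^ 0 * R ^ 5"
    by Groebner_Basis.algebra
  then have "fps_U 4 (theta3 ^ 5) = theta3 ^ 5 * fps_U 4 (R ^ 0) + 5 * theta3 ^ 4 * fps_U 4 (R ^ 1)
     + 10 * theta3 ^ 3 * fps_U 4 (R ^ 2) + 10 * theta3 ^ 2 * fps_U 4 (R ^ 3)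
     + 5 * theta3 ^ 1 * fps_U 4 (R ^ 4) + theta3 ^ 0 * fps_U 4 (R ^ 5)"
    by (simp only: fps_U_add UV)
  moreover have "fps_U 4 (R ^ 0) = 1" by (rule fps_ext) simp
  moreover have "fps_U 4 (R ^ 1) = 0" "fps_U 4 (R ^ 2) = 0" "fps_U 4 (R ^ 3) = 0" "fps_U 4 (R ^ 5) = 0"
    by (rule U0; simp)+
  ultimately show ?thesis using U4 by simp
qed

text \<open>Coprimality of n and l puts c l^3 n into the form l^2 D with l exactly dividing D. The
  case c = 4 serves the discriminants 4 N of \<open>theta3_mult_divisor_series_nth\<close>.\<close>

lemma prime_cube_exactly_dvd:
  fixes l n c :: nat
  assumes "prime l" "odd l" "coprime n l" "c = 1 \<or> c = 4"
  shows "int l dvd int (c * l * n)" "\<not> (int l)^2 dvd int (c * l * n)"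
    "int (c * l ^ 3 * n) = (int l)^2 * int (c * l * n)"
proof -
  have l0: "l > 0" using assms(1) by (rule prime_gt_0_nat)
  have l1: "l \<noteq> 1" using assms(1) by auto
  have "coprime l 4" using assms(2) coprime_power_right_iff[of l 2 2] by simp
  then have "coprime l (c * n)" using assms(3,4) by (auto simp: coprime_commute)
  then have nd: "\<not> l dvd c * n" using l1 by (metis coprime_absorb_left nat_dvd_1_iff_1 is_unit_gcd coprime_iff_gcd_eq_1 gcd_nat.absorb1)
  show "\<not> (int l)^2 dvd int (c * l * n)"
  proof
    assume "(int l)^2 dvd int (c * l * n)"
    then have "l * l dvd l * (c * n)"
      by (metis int_dvd_int_iff mult.assoc mult.commute of_nat_mult power2_eq_square)
    then show False using nd l0 by simp
  qed
qed (simp_all add: power2_eq_square power3_eq_cube)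

lemma theta3_nth_prime_cube:
  fixes l n :: nat
  assumes "prime l" "odd l" "coprime n l"
  shows "fps_nth theta3 (l ^ 3 * n) = 0"
proof (rule theta3_nth_eq_0, rule notI)
  fix x assume x: "x^2 = int (l ^ 3 * n)"
  have l: "prime (int l)" "odd (int l)" using assms by simp_all
  note D = prime_cube_exactly_dvd[OF assms, of 1, simplified]
  have l0: "int l \<noteq> 0" using l(1) by auto
  have e: "x^2 = (int l)^2 * (int l * int n)" using x by (simp add: power2_eq_square power3_eq_cube)
  then have "(int l)^2 dvd x^2" by simp
  then have "int l dvd x" by simp
  then obtain y where "x = int l * y" by (elim dvdE)
  then have "y^2 = int l * int n" using e l0 by (simp add: power_mult_distrib)
  moreover have "y^2 \<noteq> int l * int n"
    by (rule not_square_of_prime_exactly_dvd[OF l]) (use D in simp_all)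
  ultimately show False by simp
qed

lemma simple_sum_prime_cube:
  fixes l n c :: nat
  assumes "prime l" "odd l" "coprime n l" "c = 1 \<or> c = 4" "j = 1 \<or> j = 3"
  shows "1 + int l ^ (2 * j + 1) dvd simple_sum j (int (c * l ^ 3 * n))"
proof -
  have "simple_sum j ((int l)^2 * int (c * l * n)) = (1 + int l ^ (2 * j + 1)) * simple_sum j (int (c * l * n))"
    by (rule simple_sum_hecke) (use assms prime_cube_exactly_dvd[OF assms(1-4)] in simp_all)
  then show ?thesis
    unfolding prime_cube_exactly_dvd(3)[OF assms(1-4)] by (metis dvd_triv_left)
qed

text \<open>Jacobi's formula splits theta3^5 into theta3, which vanishes at the non-square l^3 n,
  and two sums over forms, of discriminants 4 l^3 n and l^3 n.\<close>

lemma theta3_pow5_dvd: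
  fixes l n :: nat
  assumes "prime l" "odd l" "coprime n l"
  shows "1 + int l ^ 3 dvd fps_nth (theta3 ^ 5) (l ^ 3 * n)"
proof -
  have "theta3 ^ 5 = theta3 * thA^2" by Groebner_Basis.algebra
  also have "\<dots> = theta3 + 8 * (theta3 * divisor_series 1) - 32 * (theta3 * fps_V 4 (divisor_series 1))"
    unfolding jacobi_four_squares by (simp add: algebra_simps)
  finally have "fps_nth (theta3 ^ 5) (l ^ 3 * n)
     = 8 * simple_sum 1 (int (4 * l ^ 3 * n)) - 32 * simple_sum 1 (int (1 * l ^ 3 * n))"
    by (simp add: numeral_fps_const theta3_mult_divisor_series_nth[unfolded One_nat_def] theta3_mult_V4_divisor_series_nth[unfolded One_nat_def]
        theta3_nth_prime_cube[OF assms] mult.assoc)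
  then show ?thesis
    using simple_sum_prime_cube[OF assms, of 4 1] simple_sum_prime_cube[OF assms, of 1 1] by simp
qed

lemma theta3_eisen4_dvd:
  fixes l n :: nat
  assumes "prime l" "odd l" "coprime n l"
  shows "1 + int l ^ 7 dvd fps_nth (theta3 * (8 * eisen4 + 4 * fps_V 4 eisen4)) (l ^ 3 * n)"
proof -
  have "fps_V 4 eisen4 = 1 + 240 * fps_V 4 (divisor_series 3)"
    by (simp add: eisen4_def fps_V_simps)
  then have "theta3 * (8 * eisen4 + 4 * fps_V 4 eisen4)
      = 12 * theta3 + 1920 * (theta3 * divisor_series 3) + 960 * (theta3 * fps_V 4 (divisor_series 3))"
    unfolding eisen4_def by Groebner_Basis.algebra
  then have "fps_nth (theta3 * (8 * eisen4 + 4 * fps_V 4 eisen4)) (l ^ 3 * n)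
     = 1920 * simple_sum 3 (int (4 * l ^ 3 * n)) + 960 * simple_sum 3 (int (1 * l ^ 3 * n))"
    by (simp add: numeral_fps_const theta3_mult_divisor_series_nth theta3_mult_V4_divisor_series_nth
        theta3_nth_prime_cube[OF assms] mult.assoc)
  then show ?thesis
    using simple_sum_prime_cube[OF assms, of 4 3] simple_sum_prime_cube[OF assms, of 1 3] by simp
qed

lemma overpartition_count_cong_0:
  assumes "fps_cong m (fps_U m theta3_inv) f" "int m dvd fps_nth f N"
  shows "m dvd overpartition_count (m * N)"
proof -
  have "int m dvd fps_nth theta3_inv (m * N) - fps_nth f N"
    using assms(1) by (simp add: fps_cong_iff)
  then have "int m dvd fps_nth theta3_inv (m * N)" using assms(2) by (metis dvd_add diff_add_cancel)
  then have "int m dvd (- 1) ^ (m * N) * int (overpartition_count (m * N))"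
    unfolding theta3_inv_def fps_nth_compose_linear by (simp add: overpartition_series_def)
  then have "int m dvd int (overpartition_count (m * N))"
    by (cases "even (m * N)") simp_all
  then show ?thesis by simp
qed

section \<open>Quaternions and sums of three squares\<close>

text \<open>With rational coordinates the Hurwitz and Lipschitz orders are subsets of one ring in
  which division by a norm is possible.\<close>

datatype quat = Quat (qre: rat) (qi: rat) (qj: rat) (qk: rat)

lemma quat_eq_iff: "x = y \<longleftrightarrow> qre x = qre y \<and> qi x = qi y \<and> qj x = qj y \<and> qk x = qk y"
  by (cases x; cases y) simp

instantiation quat :: ring_1
begin

definition "0 = Quat 0 0 0 0"
definition "1 = Quat 1 0 0 0"
definition "x + y = Quat (qre x + qre y) (qi x + qi y) (qj x + qj y) (qk x + qk y)"
definition "x - y = Quat (qre x - qre y) (qi x - qi y) (qj x - qj y) (qk x - qk y)"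
definition "- x = Quat (- qre x) (- qi x) (- qj x) (- qk x)"
definition "x * y = Quat
  (qre x * qre y - qi x * qi y - qj x * qj y - qk x * qk y)
  (qre x * qi y + qi x * qre y + qj x * qk y - qk x * qj y)
  (qre x * qj y - qi x * qk y + qj x * qre y + qk x * qi y)
  (qre x * qk y + qi x * qj y - qj x * qi y + qk x * qre y)"

lemmas quat_defs = zero_quat_def one_quat_def plus_quat_def minus_quat_def uminus_quat_def times_quat_def

instance
  by standard (simp_all add: quat_defs algebra_simps)

end

definition qcnj :: "quat \<Rightarrow> quat" where "qcnj x = Quat (qre x) (- qi x) (- qj x) (- qk x)"
definition nrm :: "quat \<Rightarrow> rat" where "nrm x = (qre x)^2 + (qi x)^2 + (qj x)^2 + (qk x)^2"
definition qr :: "rat \<Rightarrow> quat" where "qr r = Quat r 0 0 0"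

lemma qcnj_qcnj [simp]: "qcnj (qcnj x) = x"
  by (simp add: qcnj_def)

lemma qcnj_mult: "qcnj (x * y) = qcnj y * qcnj x"
  and qcnj_qr [simp]: "qcnj (qr r) = qr r"
  by (simp_all add: qcnj_def quat_defs qr_def)

lemma mult_qcnj: "x * qcnj x = qr (nrm x)"
  and qcnj_mult_self: "qcnj x * x = qr (nrm x)"
  by (simp_all add: qcnj_def quat_defs qr_def nrm_def square_simps)

lemma qr_commute: "x * qr r = qr r * x"
  by (simp add: quat_defs qr_def)

lemma qr_mult: "qr (r * s) = qr r * qr s"
  and qr_1 [simp]: "qr 1 = 1"
  by (simp_all add: quat_defs qr_def)

lemma qr_left_commute: "x * (qr r * y) = qr r * (x * y)"
  by (metis mult.assoc qr_commute)

text \<open>Rewrite rules that collect central scalars in front; \<open>NO_MATCH\<close> keeps two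
  scalars from being exchanged forever.\<close>

lemma qr_normalize:
  "NO_MATCH (qr s) x \<Longrightarrow> x * qr r = qr r * x"
  "NO_MATCH (qr s) x \<Longrightarrow> x * (qr r * y) = qr r * (x * y)"
  by (rule qr_commute, rule qr_left_commute)

lemma nrm_mult: "nrm (x * y) = nrm x * nrm y"
  by (simp add: nrm_def quat_defs square_simps)

lemma nrm_qcnj [simp]: "nrm (qcnj x) = nrm x"
  and nrm_qr [simp]: "nrm (qr r) = r^2"
  and nrm_minus [simp]: "nrm (- x) = nrm x"
  and nrm_1 [simp]: "nrm 1 = 1"
  by (simp_all add: nrm_def qcnj_def quat_defs qr_def)

lemma nrm_nonneg: "nrm x \<ge> 0"
  by (simp add: nrm_def)

lemma nrm_eq_0_iff: "nrm x = 0 \<longleftrightarrow> x = 0"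
  by (auto simp: nrm_def quat_eq_iff quat_defs add_nonneg_eq_0_iff)

lemma qr_cancel: "r \<noteq> 0 \<Longrightarrow> qr r * x = qr r * y \<Longrightarrow> x = y"
  by (simp add: quat_eq_iff quat_defs qr_def)

text \<open>The coordinates are taken with respect to the basis \<open>(1 + i + j + k) / 2, i, j, k\<close>.\<close>

abbreviation hurwitz_quat :: "int \<Rightarrow> int \<Rightarrow> int \<Rightarrow> int \<Rightarrow> quat" where
  "hurwitz_quat a b c d \<equiv> Quat (of_int a / 2) (of_int a / 2 + of_int b)
     (of_int a / 2 + of_int c) (of_int a / 2 + of_int d)"

definition hurwitz :: "quat set" where
  "hurwitz = {x. \<exists>a b c d :: int. x = hurwitz_quat a b c d}"

definition lipschitz :: "quat set" where
  "lipschitz = {x. \<exists>a b c d :: int. x = Quat (of_int a) (of_int b) (of_int c) (of_int d)}"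

lemma hurwitzI: "x = hurwitz_quat a b c d
    \<Longrightarrow> x \<in> hurwitz"
  by (auto simp: hurwitz_def)

lemma hurwitzE:
  assumes "x \<in> hurwitz"
  obtains a b c d where "x = hurwitz_quat a b c d"
  using assms by (auto simp: hurwitz_def)

lemma lipschitz_subset_hurwitz: "x \<in> lipschitz \<Longrightarrow> x \<in> hurwitz"
proof -
  assume "x \<in> lipschitz"
  then obtain a b c d :: int where x: "x = Quat (of_int a) (of_int b) (of_int c) (of_int d)"
    by (auto simp: lipschitz_def)
  show ?thesis by (rule hurwitzI[of _ "2 * a" "b - a" "c - a" "d - a"]) (simp add: x)
qed

lemma lipschitz_mult: "x \<in> lipschitz \<Longrightarrow> y \<in> lipschitz \<Longrightarrow> x * y \<in> lipschitz"
proof -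
  assume "x \<in> lipschitz" "y \<in> lipschitz"
  then obtain a b c d a' b' c' d' :: int where
    "x = Quat (of_int a) (of_int b) (of_int c) (of_int d)" "y = Quat (of_int a') (of_int b') (of_int c') (of_int d')"
    by (auto simp: lipschitz_def)
  then show ?thesis
    unfolding lipschitz_def
    by (auto simp: quat_defs simp flip: of_int_mult of_int_add of_int_diff)
qed

lemma lipschitz_add: "x \<in> lipschitz \<Longrightarrow> y \<in> lipschitz \<Longrightarrow> x + y \<in> lipschitz"
  by (auto simp: lipschitz_def quat_defs simp flip: of_int_add)

lemma one_lipschitz: "1 \<in> lipschitz"
  unfolding lipschitz_def by (auto simp: quat_defs intro!: exI[of _ 1] exI[of _ 0])

lemma hurwitz_add: assumes "x \<in> hurwitz" "y \<in> hurwitz" shows "x + y \<in> hurwitz"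
proof -
  obtain a b c d where x: "x = hurwitz_quat a b c d"
    using assms(1) by (rule hurwitzE)
  obtain a' b' c' d' where y: "y = hurwitz_quat a' b' c' d'"
    using assms(2) by (rule hurwitzE)
  show ?thesis
    by (rule hurwitzI[of _ "a + a'" "b + b'" "c + c'" "d + d'"]) (simp add: x y quat_defs add_divide_distrib)
qed

lemma hurwitz_minus: assumes "x \<in> hurwitz" shows "- x \<in> hurwitz"
proof -
  obtain a b c d where x: "x = hurwitz_quat a b c d"
    using assms by (rule hurwitzE)
  show ?thesis by (rule hurwitzI[of _ "- a" "- b" "- c" "- d"]) (simp add: x quat_defs)
qed

lemma hurwitz_diff: "x \<in> hurwitz \<Longrightarrow> y \<in> hurwitz \<Longrightarrow> x - y \<in> hurwitz"
  using hurwitz_add[of x "- y"] hurwitz_minus[of y] by simp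

lemma hurwitz_qcnj: assumes "x \<in> hurwitz" shows "qcnj x \<in> hurwitz"
proof -
  obtain a b c d where x: "x = hurwitz_quat a b c d"
    using assms by (rule hurwitzE)
  show ?thesis by (rule hurwitzI[of _ a "- a - b" "- a - c" "- a - d"]) (simp add: x qcnj_def)
qed

lemma hurwitz_mult: assumes "x \<in> hurwitz" "y \<in> hurwitz" shows "x * y \<in> hurwitz"
proof -
  obtain a b c d where x: "x = hurwitz_quat a b c d"
    using assms(1) by (rule hurwitzE)
  obtain a' b' c' d' where y: "y = hurwitz_quat a' b' c' d'"
    using assms(2) by (rule hurwitzE)
  define s where "s = b * b' + c * c' + d * d'"
  show ?thesis
    by (rule hurwitzI[of _ "- a * a' - a * (b' + c' + d') - a' * (b + c + d) - 2 * s"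
        "a * a' + a * b' + a' * b + a * d' + a' * c + c * d' - d * c' + s"
        "a * a' + a * c' + a' * c + a * b' + a' * d + d * b' - b * d' + s"
        "a * a' + a * d' + a' * d + a * c' + a' * b + b * c' - c * b' + s"])
      (simp add: x y s_def quat_defs field_simps)
qed

lemma qr_of_int_hurwitz: "qr (of_int m) \<in> hurwitz"
  by (rule hurwitzI[of _ "2 * m" "- m" "- m" "- m"]) (simp add: qr_def)

lemma qr_of_nat_hurwitz: "qr (of_nat m) \<in> hurwitz"
  using qr_of_int_hurwitz[of "int m"] by simp

lemma one_hurwitz: "1 \<in> hurwitz"
  using one_lipschitz by (rule lipschitz_subset_hurwitz)

lemma zero_hurwitz: "0 \<in> hurwitz"
  using hurwitz_diff[OF one_hurwitz one_hurwitz] by simp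

lemmas hurwitz_closed = hurwitz_add hurwitz_minus hurwitz_diff hurwitz_qcnj hurwitz_mult
  qr_of_int_hurwitz one_hurwitz

lemma nrm_hurwitz: assumes "x \<in> hurwitz" obtains n :: nat where "nrm x = of_nat n"
proof -
  obtain a b c d where x: "x = hurwitz_quat a b c d"
    using assms by (rule hurwitzE)
  define m where "m = a^2 + a * (b + c + d) + b^2 + c^2 + d^2"
  have m: "nrm x = of_int m" by (simp add: x nrm_def m_def field_simps power2_eq_square)
  then have "m \<ge> 0" using nrm_nonneg[of x] by simp
  then have "nrm x = of_nat (nat m)" using m by simp
  then show ?thesis by (rule that)
qed

text \<open>The real part is rounded to a half-integer first, with error at most 1/4; this fixes the
  parity for the other coordinates, whose errors are at most 1/2. The norm is at most 1/16 + 3/4 <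
  1.\<close>

lemma hurwitz_approx: "\<exists>h\<in>hurwitz. nrm (x - h) < 1"
proof -
  define a where "a = round (2 * qre x)"
  define b where "b = round (qi x - of_int a / 2)"
  define c where "c = round (qj x - of_int a / 2)"
  define d where "d = round (qk x - of_int a / 2)"
  define h where "h = hurwitz_quat a b c d"
  have sq: "y^2 \<le> z^2" if "\<bar>y\<bar> \<le> z" for y z :: rat using that by (metis abs_ge_zero power2_abs power_mono)
  have "\<bar>of_int a - 2 * qre x\<bar> \<le> 1 / 2" unfolding a_def by (rule of_int_round_abs_le)
  then have 0: "(qre x - of_int a / 2)^2 \<le> (1 / 4)^2" by (intro sq) linarith
  have "\<bar>of_int b - (qi x - of_int a / 2)\<bar> \<le> 1 / 2" unfolding b_def by (rule of_int_round_abs_le)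
  then have 1: "(qi x - (of_int a / 2 + of_int b))^2 \<le> (1 / 2)^2" by (intro sq) linarith
  have "\<bar>of_int c - (qj x - of_int a / 2)\<bar> \<le> 1 / 2" unfolding c_def by (rule of_int_round_abs_le)
  then have 2: "(qj x - (of_int a / 2 + of_int c))^2 \<le> (1 / 2)^2" by (intro sq) linarith
  have "\<bar>of_int d - (qk x - of_int a / 2)\<bar> \<le> 1 / 2" unfolding d_def by (rule of_int_round_abs_le)
  then have 3: "(qk x - (of_int a / 2 + of_int d))^2 \<le> (1 / 2)^2" by (intro sq) linarith
  have "nrm (x - h) \<le> (1 / 4)^2 + (1 / 2)^2 + (1 / 2)^2 + (1 / 2)^2"
    using 0 1 2 3 unfolding nrm_def h_def minus_quat_def quat.sel by linarith
  also have "\<dots> < (1 :: rat)" by (simp add: power2_eq_square)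
  finally have "nrm (x - h) < 1" .
  moreover have "h \<in> hurwitz" unfolding h_def by (rule hurwitzI) (rule refl)
  ultimately show ?thesis by blast
qed

text \<open>An element of minimal norm generates the right ideal spanned by x and m, by Euclidean
  division with \<open>hurwitz_approx\<close>.\<close>

lemma hurwitz_gcd:
  assumes "x \<in> hurwitz" "m \<noteq> 0"
  obtains e u v y z where "e \<in> hurwitz" "u \<in> hurwitz" "v \<in> hurwitz" "y \<in> hurwitz" "z \<in> hurwitz"
    "e = x * u + qr (of_int m) * v" "x = e * y" "qr (of_int m) = e * z"
proof -
  define I where "I = {x * u + qr (of_int m) * v | u v. u \<in> hurwitz \<and> v \<in> hurwitz}"
  have IH: "w \<in> hurwitz" if "w \<in> I" for w
    using that assms(1) by (auto simp: I_def intro!: hurwitz_closed)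
  have I_sub: "w - e * q \<in> I" if "w \<in> I" "e \<in> I" "q \<in> hurwitz" for w e q
  proof -
    obtain u v u' v' where w: "w = x * u + qr (of_int m) * v" "u \<in> hurwitz" "v \<in> hurwitz"
      and e: "e = x * u' + qr (of_int m) * v'" "u' \<in> hurwitz" "v' \<in> hurwitz"
      using \<open>w \<in> I\<close> \<open>e \<in> I\<close> by (auto simp: I_def)
    have "w - e * q = x * (u - u' * q) + qr (of_int m) * (v - v' * q)"
      unfolding w e by (simp add: algebra_simps)
    then show ?thesis using w e that(3) unfolding I_def by (auto intro!: hurwitz_closed)
  qed
  define N where "N w = nat \<lfloor>nrm w\<rfloor>" for w
  have N: "nrm w = of_nat (N w)" if "w \<in> hurwitz" for w
    using nrm_hurwitz[OF that] by (metis N_def floor_of_nat nat_int)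
  have xI: "x \<in> I" unfolding I_def by (intro CollectI exI[of _ 1] exI[of _ 0]) (simp add: one_hurwitz zero_hurwitz)
  have mI: "qr (of_int m) \<in> I" unfolding I_def by (intro CollectI exI[of _ 0] exI[of _ 1]) (simp add: one_hurwitz zero_hurwitz)
  have "qr (of_int m) \<noteq> 0" using assms(2) by (simp add: qr_def zero_quat_def)
  then have ex: "\<exists>w. w \<in> I \<and> w \<noteq> 0" using mI by blast
  define e where "e = (ARG_MIN N w. w \<in> I \<and> w \<noteq> 0)"
  have e: "e \<in> I" "e \<noteq> 0" and min: "\<And>w. w \<in> I \<Longrightarrow> w \<noteq> 0 \<Longrightarrow> N e \<le> N w"
    using arg_min_nat_lemma[of "\<lambda>w. w \<in> I \<and> w \<noteq> 0" _ N] ex unfolding e_def by blast+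
  have nz: "nrm e \<noteq> 0" using e(2) by (simp add: nrm_eq_0_iff)
  have div: "\<exists>q\<in>hurwitz. w = e * q" if "w \<in> I" for w
  proof -
    obtain q where q: "q \<in> hurwitz" "nrm (qr (1 / nrm e) * qcnj e * w - q) < 1"
      using hurwitz_approx by blast
    have "e * (qr (1 / nrm e) * qcnj e * w) = qr (1 / nrm e) * ((e * qcnj e) * w)"
      by (simp add: mult.assoc qr_normalize)
    also have "\<dots> = qr (1 / nrm e * nrm e) * w" unfolding mult_qcnj qr_mult by (simp add: mult.assoc)
    also have "\<dots> = w" using nz by simp
    finally have "w - e * q = e * (qr (1 / nrm e) * qcnj e * w - q)" by (simp add: algebra_simps)
    then have "nrm (w - e * q) = nrm e * nrm (qr (1 / nrm e) * qcnj e * w - q)" by (simp only: nrm_mult)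
    also have "\<dots> < nrm e * 1" using q(2) nz nrm_nonneg[of e] by (intro mult_strict_left_mono) auto
    finally have "nrm (w - e * q) < nrm e" by simp
    moreover have r: "w - e * q \<in> I" using I_sub[OF that e(1) q(1)] .
    ultimately have "N (w - e * q) < N e" using N[OF IH[OF r]] N[OF IH[OF e(1)]] by simp
    then have "w - e * q = 0" using min[OF r] by force
    then show ?thesis using q(1) by auto
  qed
  from e(1) obtain u v where "e = x * u + qr (of_int m) * v" "u \<in> hurwitz" "v \<in> hurwitz" by (auto simp: I_def)
  moreover obtain y z where "x = e * y" "qr (of_int m) = e * z" "y \<in> hurwitz" "z \<in> hurwitz"
    using div[OF xI] div[OF mI] by blast
  ultimately show ?thesis using that IH[OF e(1)] by blast
qed

definition qdvd :: "nat \<Rightarrow> quat \<Rightarrow> bool" where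
  "qdvd m x \<longleftrightarrow> (\<exists>h\<in>hurwitz. x = qr (of_nat m) * h)"

text \<open>The norm of the generator e divides l^2. Norm 1 would make l divide qcnj x, as it
  divides qcnj x * x; norm l^2 would make e an associate of l. Both contradict that l does not
  divide x.\<close>

lemma hurwitz_gcd_prime:
  assumes x: "x \<in> hurwitz" "\<not> qdvd l x" and l: "prime l" and nx: "nrm x = of_nat (l * k)"
  obtains e u v y where "e \<in> hurwitz" "u \<in> hurwitz" "v \<in> hurwitz" "y \<in> hurwitz"
    "e = x * u + qr (of_nat l) * v" "x = e * y" "nrm e = of_nat l"
proof -
  have l0: "l > 0" using l by (rule prime_gt_0_nat)
  have "int l \<noteq> 0" using l0 by simp
  then obtain e u v y z where h: "e \<in> hurwitz" "u \<in> hurwitz" "v \<in> hurwitz" "y \<in> hurwitz" "z \<in> hurwitz"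
    "e = x * u + qr (of_nat l) * v" "x = e * y" "qr (of_nat l) = e * z"
    by (rule hurwitz_gcd[OF x(1), of "int l", unfolded of_int_of_nat_eq])
  obtain p where p: "nrm e = of_nat p" using nrm_hurwitz[OF h(1)] .
  obtain q where q: "nrm z = of_nat q" using nrm_hurwitz[OF h(5)] .
  have "nrm (qr (of_nat l)) = nrm e * nrm z" unfolding h(8) by (rule nrm_mult)
  then have "of_nat (l * l) = (of_nat (p * q) :: rat)" by (simp add: p q power2_eq_square)
  then have pq: "p * q = l * l" by (simp only: of_nat_eq_iff)
  have "p \<noteq> 1"
  proof
    assume "p = 1"
    then have e1: "e * qcnj e = 1" by (simp add: mult_qcnj p)
    have "qcnj x = qcnj x * (e * qcnj e)" by (simp add: e1)
    also have "\<dots> = ((qcnj x * x) * u + qcnj x * (qr (of_nat l) * v)) * qcnj e"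
      by (simp add: h(6) algebra_simps)
    also have "\<dots> = (qr (of_nat l) * (qr (of_nat k) * u) + qr (of_nat l) * (qcnj x * v)) * qcnj e"
      by (simp add: qcnj_mult_self nx qr_mult mult.assoc qr_normalize)
    also have "\<dots> = qr (of_nat l) * ((qr (of_nat k) * u + qcnj x * v) * qcnj e)"
      by (simp add: algebra_simps)
    finally have "x = qr (of_nat l) * qcnj ((qr (of_nat k) * u + qcnj x * v) * qcnj e)"
      by (metis qcnj_qcnj qcnj_mult qcnj_qr qr_commute)
    moreover have "qcnj ((qr (of_nat k) * u + qcnj x * v) * qcnj e) \<in> hurwitz"
      using qr_of_nat_hurwitz h(1-4) x(1) by (intro hurwitz_closed)
    ultimately show False using x(2) by (auto simp: qdvd_def)
  qed
  moreover have "q \<noteq> 1"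
  proof
    assume "q = 1"
    then have "z * qcnj z = 1" by (simp add: mult_qcnj q)
    then have "e = qr (of_nat l) * qcnj z" unfolding h(8) by (simp add: mult.assoc)
    then have "x = qr (of_nat l) * (qcnj z * y)" using h(7) by (simp add: mult.assoc)
    moreover have "qcnj z * y \<in> hurwitz" using h(4,5) by (intro hurwitz_closed)
    ultimately show False using x(2) by (auto simp: qdvd_def)
  qed
  ultimately have "p = l"
  proof -
    have "p dvd l ^ 2" using pq by (metis dvd_triv_left power2_eq_square)
    then obtain i where i: "i \<le> 2" "p = l ^ i" using divides_primepow_nat[OF l] by auto
    then consider "i = 0" | "i = 1" | "i = 2" by linarith
    then show ?thesis
    proof cases
      case 3
      then have "l * l * q = l * l * 1" using pq i by (simp add: power2_eq_square)
      then show ?thesis using \<open>q \<noteq> 1\<close> l0 by simp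
    qed (use i \<open>p \<noteq> 1\<close> in auto)
  qed
  then show ?thesis using that h p by blast
qed

lemma hurwitz_unit_factor:
  assumes "e = x * g" "nrm e = nrm x" "nrm x \<noteq> 0"
  shows "nrm g = 1" "x = e * qcnj g"
proof -
  show g: "nrm g = 1" using assms nrm_mult[of x g] by simp
  show "x = e * qcnj g" unfolding assms(1) by (simp add: mult.assoc mult_qcnj g)
qed

lemma lipschitz_associate:
  assumes "e \<in> hurwitz"
  shows "\<exists>u\<in>hurwitz. nrm u = 1 \<and> e * u \<in> lipschitz"
proof -
  obtain a b c d where e: "e = hurwitz_quat a b c d"
    using assms by (rule hurwitzE)
  show ?thesis
  proof (cases "even a")
    case True
    then obtain a' where a: "a = 2 * a'" by (elim evenE)
    have "e = Quat (of_int a') (of_int (a' + b)) (of_int (a' + c)) (of_int (a' + d))"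
      by (simp add: e a)
    then have "e \<in> lipschitz" unfolding lipschitz_def by blast
    then show ?thesis by (intro bexI[of _ 1]) (auto simp: one_hurwitz)
  next
    case False
    text \<open>Subtracting a unit with half-integral coordinates leaves twice a Lipschitz quaternion.\<close>
    have dec: "\<exists>s t :: int. s \<in> {1, - 1} \<and> a + 2 * y = s + 4 * t" for y
    proof -
      have "odd (a + 2 * y)" using False by simp
      then have "(a + 2 * y) mod 4 = 1 \<or> (a + 2 * y) mod 4 = 3" by presburger
      then show ?thesis
      proof
        assume "(a + 2 * y) mod 4 = 1"
        then have "a + 2 * y = 1 + 4 * ((a + 2 * y) div 4)" by presburger
        then show ?thesis by blast
      next
        assume "(a + 2 * y) mod 4 = 3"
        then have "a + 2 * y = - 1 + 4 * ((a + 2 * y) div 4 + 1)" by presburger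
        then show ?thesis by blast
      qed
    qed
    obtain s0 t0 where 0: "s0 \<in> {1, - 1}" "a = s0 + 4 * t0" using dec[of 0] by auto
    obtain s1 t1 where 1: "s1 \<in> {1, - 1}" "a + 2 * b = s1 + 4 * t1" using dec by blast
    obtain s2 t2 where 2: "s2 \<in> {1, - 1}" "a + 2 * c = s2 + 4 * t2" using dec by blast
    obtain s3 t3 where 3: "s3 \<in> {1, - 1}" "a + 2 * d = s3 + 4 * t3" using dec by blast
    define w where "w = Quat (of_int s0 / 2) (of_int s1 / 2) (of_int s2 / 2) (of_int s3 / 2)"
    define r where "r = Quat (of_int t0) (of_int t1) (of_int t2) (of_int t3)"
    have half: "of_int a / 2 + of_int y = of_int s / 2 + 2 * (of_int t :: rat)" if "a + 2 * y = s + 4 * t" for y s t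
    proof -
      have "(of_int (a + 2 * y) :: rat) = of_int (s + 4 * t)" using that by simp
      then show ?thesis by simp
    qed
    have e': "e = w + qr 2 * r"
      using half[OF 1(2)] half[OF 2(2)] half[OF 3(2)] half[of 0 s0 t0] 0(2)
      by (simp add: e w_def r_def quat_defs qr_def)
    have nw: "nrm w = 1" using 0(1) 1(1) 2(1) 3(1) by (auto simp: w_def nrm_def power2_eq_square)
    have wh: "w \<in> hurwitz"
    proof -
      have ev: "even (s1 - s0)" "even (s2 - s0)" "even (s3 - s0)" using 0(1) 1(1) 2(1) 3(1) by auto
      then obtain k1 k2 k3 where "s1 - s0 = 2 * k1" "s2 - s0 = 2 * k2" "s3 - s0 = 2 * k3"
        unfolding dvd_def by blast
      then have "s1 = s0 + 2 * k1" "s2 = s0 + 2 * k2" "s3 = s0 + 2 * k3" by simp_all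
      then show ?thesis by (intro hurwitzI[of _ s0 k1 k2 k3]) (simp add: w_def)
    qed
    \<comment> \<open>The part w qcnj w is 1, and the factor 2 in front of r makes
      \<open>qcnj w\<close> integral.\<close>
    have "e * qcnj w = 1 + r * (qr 2 * qcnj w)"
      by (simp add: e' distrib_right mult_qcnj nw mult.assoc qr_normalize)
    moreover have "qr 2 * qcnj w = Quat (of_int s0) (of_int (- s1)) (of_int (- s2)) (of_int (- s3))"
      by (simp add: w_def qcnj_def quat_defs qr_def)
    then have "qr 2 * qcnj w \<in> lipschitz" unfolding lipschitz_def by blast
    moreover have "r \<in> lipschitz" unfolding lipschitz_def r_def by blast
    ultimately have "e * qcnj w \<in> lipschitz" by (simp add: lipschitz_add lipschitz_mult one_lipschitz)
    then show ?thesis using hurwitz_qcnj[OF wh] nw by (intro bexI[of _ "qcnj w"]) auto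
  qed
qed

text \<open>The real part of 2 x u has the parity of a (p - q - r - s), and p - q - r - s is odd
  with the norm of x. So a is even and u has integral coordinates.\<close>

lemma lipschitz_unit_of_mult:
  assumes x: "x \<in> lipschitz" "nrm x = of_nat l" "odd l" and u: "u \<in> hurwitz" "x * u \<in> lipschitz"
  shows "u \<in> lipschitz"
proof -
  obtain a b c d where u': "u = hurwitz_quat a b c d"
    using u(1) by (rule hurwitzE)
  obtain p q r s :: int where x': "x = Quat (of_int p) (of_int q) (of_int r) (of_int s)"
    using x(1) by (auto simp: lipschitz_def)
  obtain m :: int where m: "qre (x * u) = of_int m" using u(2) by (auto simp: lipschitz_def)
  have "of_int (p\<^sup>2 + q\<^sup>2 + r\<^sup>2 + s\<^sup>2) = (of_int (int l) :: rat)" using x(2) by (simp add: nrm_def x')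
  then have "p\<^sup>2 + q\<^sup>2 + r\<^sup>2 + s\<^sup>2 = int l" by (simp only: of_int_eq_iff)
  then have "odd (p\<^sup>2 + q\<^sup>2 + r\<^sup>2 + s\<^sup>2)" using x(3) by simp
  then have odd: "odd (p - q - r - s)" by simp
  have "of_int (a * (p - q - r - s)) = (of_int (2 * (m + q * b + r * c + s * d)) :: rat)"
    using m by (simp add: u' x' quat_defs field_simps)
  then have "a * (p - q - r - s) = 2 * (m + q * b + r * c + s * d)" by (simp only: of_int_eq_iff)
  then have "even (a * (p - q - r - s))" by simp
  then have "even a" using odd by simp
  then obtain a' where a: "a = 2 * a'" by (elim evenE)
  have "u = Quat (of_int a') (of_int (a' + b)) (of_int (a' + c)) (of_int (a' + d))"
    by (simp add: u' a)
  then show ?thesis unfolding lipschitz_def by blast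
qed

section \<open>Conjugation of pure quaternions by quaternions of norm l\<close>

definition pure_lipschitz :: "nat \<Rightarrow> quat set" where
  "pure_lipschitz n = {x \<in> lipschitz. qre x = 0 \<and> nrm x = of_nat n}"

definition lipschitz_nrm :: "nat \<Rightarrow> quat set" where
  "lipschitz_nrm n = {x \<in> lipschitz. nrm x = of_nat n}"

text \<open>Since \<open>nrm x\<close> is l, the condition says v = x w qcnj x for a Hurwitz
  quaternion w.\<close>

definition hecke_left :: "nat \<Rightarrow> quat \<Rightarrow> quat set" where
  "hecke_left l v = {x \<in> lipschitz_nrm l. \<exists>w\<in>hurwitz. qcnj x * v * x = qr (of_nat (l ^ 2)) * w}"

lemma qcnj_pure: "qre x = 0 \<Longrightarrow> qcnj x = - x"
  by (simp add: qcnj_def quat_defs)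

context
  fixes l n :: nat
  assumes l: "prime l" "odd l" and n: "l dvd n" "\<not> l ^ 2 dvd n"
begin

lemma l_pos: "l > 0"
  using l(1) by (rule prime_gt_0_nat)

lemma qr_l_cancel: "qr (of_nat l) * x = qr (of_nat l) * y \<Longrightarrow> x = y"
  using qr_cancel[of "of_nat l" x y] l_pos by (metis of_nat_0_less_iff less_irrefl)

lemma qr_l2: "qr (of_nat (l ^ 2)) * x = qr (of_nat l) * (qr (of_nat l) * x)"
  by (simp add: power2_eq_square qr_mult mult.assoc)

lemma mult_qcnj_l:
  assumes "nrm x = of_nat l"
  shows "x * (qcnj x * y) = qr (of_nat l) * y" "qcnj x * (x * y) = qr (of_nat l) * y"
  using mult_qcnj[of x] qcnj_mult_self[of x] assms by (simp_all add: mult.assoc[symmetric])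

text \<open>Here y divides both x and l = y qcnj y from the left, hence also e; as y and e have
  equal norms, the quotient is a unit.\<close>

lemma common_divisor_unit:
  assumes e: "e = x * u + qr (of_nat l) * v" "nrm e = of_nat l" "u \<in> hurwitz" "v \<in> hurwitz"
    and y: "nrm y = of_nat l" "y \<in> hurwitz" "x = y * z" "z \<in> hurwitz"
  obtains g where "g \<in> hurwitz" "nrm g = 1" "y = e * g" "e = y * qcnj g"
proof -
  have "e = y * (z * u + qcnj y * v)"
    by (simp add: e(1) y(3) distrib_left mult.assoc mult_qcnj_l[OF y(1)])
  moreover have "z * u + qcnj y * v \<in> hurwitz" using e y by (intro hurwitz_closed)
  ultimately show ?thesis
    using hurwitz_unit_factor[of e y "z * u + qcnj y * v"] e(2) y(1) l_pos that[of "qcnj (z * u + qcnj y * v)"]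
    by (auto intro: hurwitz_qcnj)
qed

text \<open>All admissible x are right associates of one e. If l does not divide v, then e is the
  left gcd of v and l. If v = l v', then e is the left gcd of v' and l, and the condition on x
  weakens to v' x = x w.\<close>

lemma hecke_left_generator:
  assumes v: "v \<in> pure_lipschitz (l ^ 2 * n)"
  obtains e where "e \<in> hurwitz" "nrm e = of_nat l" "\<exists>w\<in>hurwitz. qcnj e * v * e = qr (of_nat (l ^ 2)) * w"
    "\<And>x. x \<in> hecke_left l v \<Longrightarrow> \<exists>g\<in>hurwitz. nrm g = 1 \<and> x = e * g"
proof (cases "qdvd l v")
  case False
  obtain k where k: "n = l * k" using n(1) by (elim dvdE)
  have vh: "v \<in> hurwitz" and pure: "qcnj v = - v" and nv: "nrm v = of_nat (l * (l * n))"
    using v by (auto simp: pure_lipschitz_def lipschitz_subset_hurwitz qcnj_pure power2_eq_square)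
  obtain e u z y where e: "e \<in> hurwitz" "u \<in> hurwitz" "z \<in> hurwitz" "y \<in> hurwitz"
    "e = v * u + qr (of_nat l) * z" "v = e * y" "nrm e = of_nat l"
    using hurwitz_gcd_prime[OF vh False l(1) nv] by metis
  have ny: "nrm y = of_nat (l * n)" using nv nrm_mult[of e y] l_pos unfolding e(6)[symmetric] e(7) by simp
  \<comment> \<open>Purity of v turns the left factor e into a right factor, which makes y e
    divisible by l.\<close>
  have "v = - (qcnj y * qcnj e)" using pure unfolding e(6) qcnj_mult by (metis add.inverse_inverse)
  then have "y * e = - (y * (qcnj y * (qcnj e * u))) + y * (qr (of_nat l) * z)"
    by (subst e(5)) (simp add: distrib_left right_diff_distrib mult.assoc)
  also have "y * (qcnj y * (qcnj e * u)) = qr (of_nat l) * (qr (of_nat n) * (qcnj e * u))"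
    by (simp add: mult.assoc[symmetric] mult_qcnj ny qr_mult)
  also have "- \<dots> + y * (qr (of_nat l) * z) = qr (of_nat l) * (- (qr (of_nat n) * (qcnj e * u)) + y * z)"
    by (simp add: distrib_left right_diff_distrib qr_normalize)
  finally have ye: "y * e = qr (of_nat l) * (- (qr (of_nat n) * (qcnj e * u)) + y * z)" .
  have "qcnj e * v * e = qr (of_nat l) * (y * e)"
    by (subst e(6)) (simp add: mult.assoc mult_qcnj_l[OF e(7)])
  then have "qcnj e * v * e = qr (of_nat (l ^ 2)) * (- (qr (of_nat n) * (qcnj e * u)) + y * z)"
    unfolding ye qr_l2 .
  moreover have "- (qr (of_nat n) * (qcnj e * u)) + y * z \<in> hurwitz"
    using qr_of_nat_hurwitz e(1-4) by (intro hurwitz_closed)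
  moreover have "\<exists>g\<in>hurwitz. nrm g = 1 \<and> x = e * g" if "x \<in> hecke_left l v" for x
  proof -
    obtain w where w: "w \<in> hurwitz" "qcnj x * v * x = qr (of_nat (l ^ 2)) * w"
      and x: "x \<in> lipschitz" "nrm x = of_nat l"
      using \<open>x \<in> hecke_left l v\<close> unfolding hecke_left_def lipschitz_nrm_def by blast
    have "x * (qcnj x * v * x) * qcnj x = qr (of_nat l) * (qr (of_nat l) * v)"
      by (simp add: mult.assoc mult_qcnj_l[OF x(2)] mult_qcnj x(2) qr_normalize)
    moreover have "x * (qcnj x * v * x) * qcnj x = qr (of_nat l) * (qr (of_nat l) * (x * (w * qcnj x)))"
      unfolding w(2) qr_l2 by (simp add: mult.assoc qr_normalize)
    ultimately have "v = x * (w * qcnj x)" by (metis qr_l_cancel)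
    then show ?thesis
      using common_divisor_unit[OF e(5) e(7) e(2,3) x(2) lipschitz_subset_hurwitz[OF x(1)]] w(1) x(1)
      by (metis hurwitz_qcnj hurwitz_mult lipschitz_subset_hurwitz)
  qed
  ultimately show ?thesis using that[of e] e(1,7) by blast
next
  case True
  obtain k where k: "n = l * k" using n(1) by (elim dvdE)
  have lk: "\<not> l dvd k" using n(2) l_pos by (simp add: k power2_eq_square)
  obtain v' where v': "v' \<in> hurwitz" "v = qr (of_nat l) * v'" using True by (auto simp: qdvd_def)
  have pv: "qcnj v = - v" and nv: "nrm v = of_nat (l ^ 2 * n)"
    using v by (auto simp: pure_lipschitz_def qcnj_pure)
  have "qr (of_nat l) * qcnj v' = qr (of_nat l) * (- v')"
    using pv unfolding v'(2) qcnj_mult by (simp add: qr_normalize)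
  then have pure: "qcnj v' = - v'" by (rule qr_l_cancel)
  have nv': "nrm v' = of_nat (l * k)"
    using nv l_pos unfolding v'(2) nrm_mult by (simp add: k power2_eq_square)
  \<comment> \<open>The norm of v' is n, and l^2 does not divide n.\<close>
  have nd: "\<not> qdvd l v'"
  proof
    assume "qdvd l v'"
    then obtain h where h: "h \<in> hurwitz" "v' = qr (of_nat l) * h" by (auto simp: qdvd_def)
    obtain m where m: "nrm h = of_nat m" using nrm_hurwitz[OF h(1)] .
    have "of_nat (l * k) = (of_nat (l * (l * m)) :: rat)"
      using nv' unfolding h(2) nrm_mult by (auto simp: m power2_eq_square)
    then have "l * k = l * (l * m)" by (simp only: of_nat_eq_iff)
    then show False using lk l_pos by simp
  qed
  obtain e u z y where e: "e \<in> hurwitz" "u \<in> hurwitz" "z \<in> hurwitz" "y \<in> hurwitz"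
    "e = v' * u + qr (of_nat l) * z" "v' = e * y" "nrm e = of_nat l"
    using hurwitz_gcd_prime[OF v'(1) nd l(1) nv'] by metis
  have "qcnj e * v * e = qr (of_nat l) * (qcnj e * (e * (y * e)))"
    unfolding v'(2) by (subst e(6)) (simp add: mult.assoc qr_normalize)
  then have "qcnj e * v * e = qr (of_nat (l ^ 2)) * (y * e)"
    by (simp only: mult_qcnj_l[OF e(7)] qr_l2)
  moreover have "y * e \<in> hurwitz" using e(1,4) by (intro hurwitz_closed)
  moreover have "\<exists>g\<in>hurwitz. nrm g = 1 \<and> x = e * g" if "x \<in> hecke_left l v" for x
  proof -
    obtain w where w: "w \<in> hurwitz" "qcnj x * v * x = qr (of_nat (l ^ 2)) * w"
      and x: "x \<in> lipschitz" "nrm x = of_nat l"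
      using \<open>x \<in> hecke_left l v\<close> unfolding hecke_left_def lipschitz_nrm_def by blast
    have xh: "x \<in> hurwitz" using x(1) by (rule lipschitz_subset_hurwitz)
    have "qr (of_nat l) * (qcnj x * (v' * x)) = qr (of_nat l) * (qr (of_nat l) * w)"
      using w(2) unfolding v'(2) qr_l2 by (simp add: mult.assoc qr_normalize)
    then have cw: "qcnj x * (v' * x) = qr (of_nat l) * w" by (rule qr_l_cancel)
    have "qr (of_nat l) * (v' * x) = qr (of_nat l) * (x * w)"
      using arg_cong[OF cw, of "\<lambda>t. x * t"] by (simp add: mult_qcnj_l[OF x(2)] qr_normalize)
    then have vx: "v' * x = x * w" by (rule qr_l_cancel)
    show ?thesis
    \<comment> \<open>If l does not divide v' x, both x and e are associated with the left gcd of v'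
      x and l. If it does, conjugation shows that l divides qcnj x * v', so x divides v' from the
      left.\<close>
    proof (cases "qdvd l (v' * x)")
      case False
      have "nrm (v' * x) = of_nat (l * (l * k))" by (simp add: nrm_mult nv' x(2))
      from hurwitz_gcd_prime[OF hurwitz_mult[OF v'(1) xh] False l(1) this]
      obtain e' u' z' where e': "e' = v' * x * u' + qr (of_nat l) * z'" "nrm e' = of_nat l"
        "u' \<in> hurwitz" "z' \<in> hurwitz" by metis
      obtain g where g: "g \<in> hurwitz" "nrm g = 1" "x = e' * g"
        using common_divisor_unit[OF e' x(2) xh vx w(1)] by metis
      have "e' = v' * (x * u') + qr (of_nat l) * z'" by (simp add: e'(1) mult.assoc)
      from common_divisor_unit[OF this e'(2) hurwitz_mult[OF xh e'(3)] e'(4) e(7) e(1) e(6) e(4)]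
      obtain g' where g': "g' \<in> hurwitz" "nrm g' = 1" "e' = e * qcnj g'" by metis
      have "x = e * (qcnj g' * g)" using g(3) g'(3) by (simp add: mult.assoc)
      moreover have "qcnj g' * g \<in> hurwitz" "nrm (qcnj g' * g) = 1"
        using g g' by (auto simp: nrm_mult intro!: hurwitz_closed)
      ultimately show ?thesis by blast
    next
      case True
      then obtain h where h: "h \<in> hurwitz" "v' * x = qr (of_nat l) * h" by (auto simp: qdvd_def)
      have "- (qcnj x * v') = qr (of_nat l) * qcnj h"
        using arg_cong[OF h(2), of qcnj] unfolding qcnj_mult pure by (simp add: qr_normalize)
      then have "qcnj x * v' = qr (of_nat l) * (- qcnj h)" by (metis add.inverse_inverse mult_minus_right)
      then have "qr (of_nat l) * v' = qr (of_nat l) * (x * (- qcnj h))"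
        using mult_qcnj_l(1)[OF x(2), of v'] by (simp add: qr_normalize)
      then have "v' = x * (- qcnj h)" by (rule qr_l_cancel)
      from common_divisor_unit[OF e(5) e(7) e(2,3) x(2) xh this] h(1)
      show ?thesis by (metis hurwitz_qcnj hurwitz_minus)
    qed
  qed
  ultimately show ?thesis using that[of e] e(1,7) by blast
qed

text \<open>Choose a Lipschitz associate x of the generator. Its odd norm forces the unit between x
  and any other element to be Lipschitz, so the set is x times the Lipschitz units.\<close>

lemma card_hecke_left:
  assumes "v \<in> pure_lipschitz (l ^ 2 * n)"
  shows "card (hecke_left l v) = card (lipschitz_nrm 1)"
proof -
  obtain e w where e: "e \<in> hurwitz" "nrm e = of_nat l" "w \<in> hurwitz" "qcnj e * v * e = qr (of_nat (l ^ 2)) * w"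
    and gen: "\<And>x. x \<in> hecke_left l v \<Longrightarrow> \<exists>g\<in>hurwitz. nrm g = 1 \<and> x = e * g"
    using hecke_left_generator[OF assms] by metis
  obtain u where u: "u \<in> hurwitz" "nrm u = 1" "e * u \<in> lipschitz" using lipschitz_associate[OF e(1)] by blast
  define x where "x = e * u"
  have x: "x \<in> lipschitz" "nrm x = of_nat l" using u by (simp_all add: x_def nrm_mult e(2))
  have uu: "u * (qcnj u * y) = y" for y using mult_qcnj[of u] u(2) by (simp add: mult.assoc[symmetric])
  have "hecke_left l v = (\<lambda>g. x * g) ` lipschitz_nrm 1"
  proof (rule subset_antisym; rule subsetI)
    fix y assume y: "y \<in> hecke_left l v"
    then obtain g where g: "g \<in> hurwitz" "nrm g = 1" "y = e * g" using gen by blast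
    have "y = x * (qcnj u * g)" by (simp add: x_def g(3) mult.assoc uu)
    moreover have "qcnj u * g \<in> lipschitz"
    proof (rule lipschitz_unit_of_mult[OF x l(2)])
      show "qcnj u * g \<in> hurwitz" using u(1) g(1) by (intro hurwitz_closed)
      show "x * (qcnj u * g) \<in> lipschitz"
        using y \<open>y = x * (qcnj u * g)\<close> by (simp add: hecke_left_def lipschitz_nrm_def)
    qed
    moreover have "nrm (qcnj u * g) = 1" by (simp add: nrm_mult u(2) g(2))
    ultimately show "y \<in> (\<lambda>g. x * g) ` lipschitz_nrm 1" by (auto simp: lipschitz_nrm_def)
  next
    fix y assume "y \<in> (\<lambda>g. x * g) ` lipschitz_nrm 1"
    then obtain g where g: "g \<in> lipschitz" "nrm g = 1" "y = x * g" by (auto simp: lipschitz_nrm_def)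
    have "qcnj y * v * y = qcnj (u * g) * (qcnj e * v * e) * (u * g)"
      by (simp add: g(3) x_def qcnj_mult mult.assoc)
    also have "\<dots> = qr (of_nat (l ^ 2)) * (qcnj (u * g) * w * (u * g))"
      unfolding e(4) by (simp add: mult.assoc qr_normalize)
    finally have "qcnj y * v * y = qr (of_nat (l ^ 2)) * (qcnj (u * g) * w * (u * g))" .
    moreover have "qcnj (u * g) * w * (u * g) \<in> hurwitz"
      using u(1) lipschitz_subset_hurwitz[OF g(1)] e(3) by (intro hurwitz_closed)
    ultimately show "y \<in> hecke_left l v"
      using g x by (auto simp: hecke_left_def lipschitz_nrm_def nrm_mult lipschitz_mult)
  qed
  moreover have "inj_on (\<lambda>g. x * g) (lipschitz_nrm 1)"
  proof (rule inj_onI)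
    fix g g' assume "x * g = x * g'"
    then have "qcnj x * (x * g) = qcnj x * (x * g')" by simp
    then show "g = g'" unfolding mult_qcnj_l[OF x(2)] by (rule qr_l_cancel)
  qed
  ultimately show ?thesis by (simp add: card_image)
qed

lemma hecke_bij:
  "bij_betw (\<lambda>(x, w). (x * w * qcnj x, x)) (lipschitz_nrm l \<times> pure_lipschitz n)
     (Sigma (pure_lipschitz (l ^ 2 * n)) (hecke_left l))"
proof (rule bij_betwI[where g = "\<lambda>(v, x). (x, qr (1 / of_nat (l ^ 2)) * (qcnj x * v * x))"])
  have pureI: "qre (x * w * qcnj x) = 0" if "qre w = 0" for x w
    using that by (simp add: quat_defs qcnj_def algebra_simps)
  have pureI': "qre (qcnj x * w * x) = 0" if "qre w = 0" for x w
    using that by (simp add: quat_defs qcnj_def algebra_simps)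
  have inv: "qr (1 / of_nat (l ^ 2)) * (qr (of_nat (l ^ 2)) * w) = w" for w
  proof -
    have "qr (1 / of_nat (l ^ 2)) * qr (of_nat (l ^ 2)) = 1" using l_pos by (simp add: qr_mult[symmetric])
    then show ?thesis by (simp add: mult.assoc[symmetric])
  qed
  have lip_qcnj: "qcnj x \<in> lipschitz" if "x \<in> lipschitz" for x
    using that unfolding lipschitz_def by (auto simp: qcnj_def simp flip: of_int_minus)
  have conj_back: "qcnj x * (x * w * qcnj x) * x = qr (of_nat (l ^ 2)) * w" if "nrm x = of_nat l" for x w
    unfolding qr_l2 by (simp add: mult.assoc mult_qcnj_l[OF that] qcnj_mult_self that qr_normalize)
  show "(\<lambda>(x, w). (x * w * qcnj x, x)) \<in> lipschitz_nrm l \<times> pure_lipschitz n \<rightarrow> Sigma (pure_lipschitz (l ^ 2 * n)) (hecke_left l)"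
  proof (rule funcsetI, clarify, intro conjI)
    fix x w assume x: "x \<in> lipschitz_nrm l" and w: "w \<in> pure_lipschitz n"
    show "x * w * qcnj x \<in> pure_lipschitz (l ^ 2 * n)"
      using x w by (auto simp: lipschitz_nrm_def pure_lipschitz_def pureI nrm_mult lip_qcnj power2_eq_square intro!: lipschitz_mult)
    show "x \<in> hecke_left l (x * w * qcnj x)"
      using x w conj_back[of x w] by (auto simp: hecke_left_def lipschitz_nrm_def pure_lipschitz_def lipschitz_subset_hurwitz)
  qed
  show "(\<lambda>(v, x). (x, qr (1 / of_nat (l ^ 2)) * (qcnj x * v * x))) \<in> Sigma (pure_lipschitz (l ^ 2 * n)) (hecke_left l) \<rightarrow> lipschitz_nrm l \<times> pure_lipschitz n"
  proof (rule funcsetI, clarify, intro conjI)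
    fix v x assume v: "v \<in> pure_lipschitz (l ^ 2 * n)" and x: "x \<in> hecke_left l v"
    show "x \<in> lipschitz_nrm l" using x by (simp add: hecke_left_def)
    obtain w where w: "w \<in> hurwitz" "qcnj x * v * x = qr (of_nat (l ^ 2)) * w" and nx: "nrm x = of_nat l"
      using x by (auto simp: hecke_left_def lipschitz_nrm_def)
    have "qre (qr (of_nat (l ^ 2)) * w) = 0" unfolding w(2)[symmetric]
      using v by (intro pureI') (simp add: pure_lipschitz_def)
    then have pw: "qre w = 0" using l_pos by (simp add: quat_defs qr_def)
    obtain a b c d where w': "w = hurwitz_quat a b c d"
      using w(1) by (rule hurwitzE)
    \<comment> \<open>A Hurwitz quaternion with real part 0 has integral coordinates, so w is
      Lipschitz.\<close>
    have "a = 0" using pw by (simp add: w')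
    then have "w = Quat (of_int 0) (of_int b) (of_int c) (of_int d)" by (simp add: w')
    then have "w \<in> lipschitz" unfolding lipschitz_def by blast
    moreover have "nrm (qcnj x * v * x) = of_nat (l ^ 2) * of_nat (l ^ 2 * n)"
      using v nx by (simp add: nrm_mult pure_lipschitz_def power2_eq_square)
    then have "nrm w = of_nat n" using l_pos unfolding w(2) nrm_mult by (simp add: power2_eq_square)
    ultimately show "qr (1 / of_nat (l ^ 2)) * (qcnj x * v * x) \<in> pure_lipschitz n"
      unfolding w(2) inv using pw by (simp add: pure_lipschitz_def)
  qed
  show "(\<lambda>(v, x). (x, qr (1 / of_nat (l ^ 2)) * (qcnj x * v * x))) ((\<lambda>(x, w). (x * w * qcnj x, x)) z) = z"
    if "z \<in> lipschitz_nrm l \<times> pure_lipschitz n" for z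
    using that conj_back inv by (auto simp: lipschitz_nrm_def)
  show "(\<lambda>(x, w). (x * w * qcnj x, x)) ((\<lambda>(v, x). (x, qr (1 / of_nat (l ^ 2)) * (qcnj x * v * x))) z) = z"
    if z: "z \<in> Sigma (pure_lipschitz (l ^ 2 * n)) (hecke_left l)" for z
  proof -
    obtain v x where vx: "z = (v, x)" by (cases z)
    have nx: "nrm x = of_nat l" using z by (auto simp: vx hecke_left_def lipschitz_nrm_def)
    have "x * (qr (1 / of_nat (l ^ 2)) * (qcnj x * v * x)) * qcnj x
        = qr (1 / of_nat (l ^ 2)) * (x * (qcnj x * (v * (x * qcnj x))))"
      by (simp add: mult.assoc qr_normalize)
    also have "x * (qcnj x * (v * (x * qcnj x))) = qr (of_nat (l ^ 2)) * v"
      unfolding qr_l2 by (simp add: mult_qcnj_l[OF nx] mult_qcnj nx qr_normalize)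
    finally show ?thesis unfolding inv by (simp only: vx prod.case)
  qed
qed

end

section \<open>Counting representations by three and four squares\<close>

definition squares1 :: "int \<Rightarrow> int set" where
  "squares1 k = {x. x\<^sup>2 = k}"

definition squares2 :: "int \<Rightarrow> (int \<times> int) set" where
  "squares2 k = {(x, y). x\<^sup>2 + y\<^sup>2 = k}"

definition squares3 :: "int \<Rightarrow> (int \<times> int \<times> int) set" where
  "squares3 k = {(x, y, z). x\<^sup>2 + y\<^sup>2 + z\<^sup>2 = k}"

definition squares4 :: "int \<Rightarrow> (int \<times> int \<times> int \<times> int) set" where
  "squares4 k = {(x, y, z, w). x\<^sup>2 + y\<^sup>2 + z\<^sup>2 + w\<^sup>2 = k}"

lemma theta3_mult_nth_card:
  assumes f: "\<And>k. fps_nth f k = int (card (A (int k)))" and fin: "\<And>k. finite (A k)"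
    and B: "\<And>k. B k = Sigma {x. x\<^sup>2 \<le> k} (\<lambda>x. A (k - x\<^sup>2))"
  shows "fps_nth (theta3 * f) n = int (card (B (int n)))" "finite (B k)"
proof -
  have "fps_nth (theta3 * f) n = (\<Sum>x\<in>{x. x\<^sup>2 \<le> int n}. int (card (A (int n - x\<^sup>2))))"
    unfolding theta3_def sq_series_mult_nth by (intro sum.cong refl) (simp add: f)
  also have "\<dots> = int (card (B (int n)))"
    unfolding B by (subst card_SigmaI) (auto simp: finite_square_le fin)
  finally show "fps_nth (theta3 * f) n = int (card (B (int n)))" .
  show "finite (B k)" unfolding B by (intro finite_SigmaI finite_square_le fin)
qed

lemma theta3_pow3_nth: "fps_nth (theta3 ^ 3) n = int (card (squares3 (int n)))"
  and finite_squares3: "finite (squares3 k)"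
  and theta3_pow4_nth: "fps_nth (thA\<^sup>2) n = int (card (squares4 (int n)))"
  and finite_squares4: "finite (squares4 k)"
proof -
  have 1: "fps_nth theta3 k = int (card (squares1 (int k)))" for k
    by (simp add: theta3_def sq_series_def squares1_def)
  have f1: "finite (squares1 k)" for k unfolding squares1_def by (rule finite_square_eq)
  have le: "x\<^sup>2 \<le> k" if "x\<^sup>2 + y = k" "y \<ge> 0" for x y k :: int using that by simp
  have "squares2 k = Sigma {x. x\<^sup>2 \<le> k} (\<lambda>x. squares1 (k - x\<^sup>2))" for k
    by (auto simp: squares1_def squares2_def algebra_simps intro!: le)
  note 2 = theta3_mult_nth_card[where A = squares1, OF 1 f1 this]
  have "squares3 k = Sigma {x. x\<^sup>2 \<le> k} (\<lambda>x. squares2 (k - x\<^sup>2))" for k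
    by (auto simp: squares2_def squares3_def algebra_simps intro!: le[of _ "_ + _"])
  note 3 = theta3_mult_nth_card[where A = squares2, OF 2 this]
  have "squares4 k = Sigma {x. x\<^sup>2 \<le> k} (\<lambda>x. squares3 (k - x\<^sup>2))" for k
    by (auto simp: squares3_def squares4_def algebra_simps intro!: le[of _ "_ + (_ + _)"])
  note 4 = theta3_mult_nth_card[where A = squares3, OF 3 this]
  have p: "theta3 ^ 3 = theta3 * (theta3 * theta3)" "thA\<^sup>2 = theta3 * (theta3 * (theta3 * theta3))"
    by (simp_all add: power3_eq_cube power2_eq_square mult.assoc)
  show "fps_nth (theta3 ^ 3) n = int (card (squares3 (int n)))" "finite (squares3 k)"
    "fps_nth (thA\<^sup>2) n = int (card (squares4 (int n)))" "finite (squares4 k)"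
    unfolding p by (rule 3 4)+
qed

lemma of_nat_eq_of_int_iff: "(of_int a :: rat) = of_nat n \<longleftrightarrow> a = int n"
  by (metis of_int_eq_iff of_int_of_nat_eq)

lemma pure_lipschitz_eq_image:
  "pure_lipschitz n = (\<lambda>(x, y, z). Quat 0 (of_int x) (of_int y) (of_int z)) ` squares3 (int n)"
proof -
  have "x\<^sup>2 + y\<^sup>2 + z\<^sup>2 = int n \<longleftrightarrow> (of_int x)\<^sup>2 + (of_int y)\<^sup>2 + (of_int z)\<^sup>2 = (of_nat n :: rat)" for x y z
    using of_nat_eq_of_int_iff[of "x\<^sup>2 + y\<^sup>2 + z\<^sup>2" n] by simp
  then show ?thesis
    by (force simp: pure_lipschitz_def lipschitz_def squares3_def nrm_def image_iff
        intro: exI[of _ "0 :: int"])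
qed

lemma lipschitz_nrm_eq_image:
  "lipschitz_nrm n = (\<lambda>(x, y, z, w). Quat (of_int x) (of_int y) (of_int z) (of_int w)) ` squares4 (int n)"
proof -
  have "x\<^sup>2 + y\<^sup>2 + z\<^sup>2 + w\<^sup>2 = int n \<longleftrightarrow> (of_int x)\<^sup>2 + (of_int y)\<^sup>2 + (of_int z)\<^sup>2 + (of_int w)\<^sup>2 = (of_nat n :: rat)" for x y z w
    using of_nat_eq_of_int_iff[of "x\<^sup>2 + y\<^sup>2 + z\<^sup>2 + w\<^sup>2" n] by simp
  then show ?thesis
    by (force simp: lipschitz_nrm_def lipschitz_def squares4_def nrm_def image_iff)
qed

lemma card_pure_lipschitz: "int (card (pure_lipschitz n)) = fps_nth (theta3 ^ 3) n"
  unfolding theta3_pow3_nth pure_lipschitz_eq_image by (subst card_image) (auto simp: inj_on_def)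

lemma finite_pure_lipschitz: "finite (pure_lipschitz n)"
  unfolding pure_lipschitz_eq_image by (intro finite_imageI finite_squares3)

lemma card_lipschitz_nrm: "int (card (lipschitz_nrm n)) = fps_nth (thA\<^sup>2) n"
  unfolding theta3_pow4_nth lipschitz_nrm_eq_image by (subst card_image) (auto simp: inj_on_def)

lemma finite_lipschitz_nrm: "finite (lipschitz_nrm n)"
  unfolding lipschitz_nrm_eq_image by (intro finite_imageI finite_squares4)

text \<open>Counting the pairs of \<open>hecke_bij\<close> twice gives r_4(l) r_3(n) = r_3(l^2 n)
  r_4(1), and Jacobi's formula gives r_4(l) = 8 (l + 1) and r_4(1) = 8.\<close>

lemma theta3_pow3_hecke:
  assumes l: "prime l" "odd l" and n: "l dvd n" "\<not> l ^ 2 dvd n"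
  shows "fps_nth (theta3 ^ 3) (l ^ 2 * n) = (int l + 1) * fps_nth (theta3 ^ 3) n"
proof -
  let ?S = "Sigma (pure_lipschitz (l ^ 2 * n)) (hecke_left l)"
  have fin: "finite (hecke_left l v)" for v
    by (rule finite_subset[OF _ finite_lipschitz_nrm[of l]]) (auto simp: hecke_left_def)
  have "card (lipschitz_nrm l \<times> pure_lipschitz n) = card ?S"
    by (rule bij_betw_same_card[OF hecke_bij[OF l n]])
  also have "\<dots> = (\<Sum>v\<in>pure_lipschitz (l ^ 2 * n). card (hecke_left l v))"
    by (rule card_SigmaI) (simp_all add: finite_pure_lipschitz fin)
  also have "\<dots> = card (pure_lipschitz (l ^ 2 * n)) * card (lipschitz_nrm 1)"
    using card_hecke_left[OF l n] by simp
  finally have "int (card (lipschitz_nrm l)) * int (card (pure_lipschitz n))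
      = int (card (pure_lipschitz (l ^ 2 * n))) * int (card (lipschitz_nrm 1))"
    by (simp add: card_cartesian_product flip: of_nat_mult)
  then have e: "fps_nth (thA\<^sup>2) l * fps_nth (theta3 ^ 3) n = fps_nth (theta3 ^ 3) (l ^ 2 * n) * fps_nth (thA\<^sup>2) 1"
    by (simp only: card_pure_lipschitz card_lipschitz_nrm)
  have l1: "l > 1" using l(1) by (rule prime_gt_1_nat)
  have "{d. d dvd l} = {1, l}" using l(1) by (auto simp: prime_nat_iff)
  then have "fps_nth (divisor_series 1) l = 1 + int l" using l1 by (simp add: divisor_series_def)
  moreover have "\<not> 4 dvd l" using l(2) by presburger
  ultimately have "fps_nth (thA\<^sup>2) l = 8 * (1 + int l)"
    using l1 unfolding jacobi_four_squares by (simp add: numeral_fps_const fps_V_nth)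
  moreover have "fps_nth (thA\<^sup>2) 1 = 8"
    unfolding jacobi_four_squares by (simp add: numeral_fps_const fps_V_nth divisor_series_def)
  ultimately have "8 * fps_nth (theta3 ^ 3) (l ^ 2 * n) = 8 * ((int l + 1) * fps_nth (theta3 ^ 3) n)"
    using e by (simp add: algebra_simps)
  then show ?thesis by simp
qed

section \<open>The congruence\<close>

theorem theorem1p2:
  fixes m k l n :: nat
  assumes "m \<in> {3, 5, 7, 11}"
    and "k = (if m = 3 then 5 else m - 2)"
    and "prime l" and "odd l"
    and "[int l ^ (k - 2) = - 1] (mod int m)"
    and "n > 0" and "coprime n l"
  shows "[overpartition_count (m * l ^ 3 * n) = 0] (mod m)"
proof -
  note l = \<open>prime l\<close> \<open>odd l\<close>
  have dvd: "int m dvd 1 + int l ^ (k - 2)"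
    using assms(5) by (simp add: cong_iff_dvd_diff add.commute)
  have "m dvd overpartition_count (m * (l ^ 3 * n))"
  proof -
    consider "m = 3" | "m = 5" | "m = 7" | "m = 11" using assms(1) by blast
    then show ?thesis
    proof cases
      case 1
      then have "int m dvd fps_nth (theta3 ^ 5) (l ^ 3 * n)"
        using dvd assms(2) theta3_pow5_dvd[OF l assms(7)] by (auto intro: dvd_trans)
      then show ?thesis using overpartition_count_cong_0 fps_U_inv_3 1 by blast
    next
      case 2
      have "\<not> l dvd n" using assms(7) l(1) by (metis coprime_absorb_left nat_dvd_1_iff_1 not_prime_1 coprime_commute is_unit_gcd gcd_nat.absorb1)
      then have "l dvd l * n" "\<not> l ^ 2 dvd l * n"
        using prime_gt_0_nat[OF l(1)] by (simp_all add: power2_eq_square)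
      then have "fps_nth (theta3 ^ 3) (l ^ 2 * (l * n)) = (int l + 1) * fps_nth (theta3 ^ 3) (l * n)"
        by (rule theta3_pow3_hecke[OF l])
      moreover have "l ^ 2 * (l * n) = l ^ 3 * n" by (simp add: power2_eq_square power3_eq_cube)
      moreover have "int m dvd int l + 1" using dvd assms(2) 2 by (simp add: add.commute)
      ultimately have "int m dvd fps_nth (theta3 ^ 3) (l ^ 3 * n)" by (metis dvd_mult2)
      then show ?thesis using overpartition_count_cong_0 fps_U_inv_5 2 by blast
    next
      case 3
      \<comment> \<open>The form for m = 7 is U_4(theta3^5), so the relation for theta3^5 is used at
        l^3 (4 n).\<close>
      have "coprime (4 * n) l"
        using l(2) assms(7) coprime_power_left_iff[of 2 2 l] by simp
      from theta3_pow5_dvd[OF l this]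
      have "int m dvd fps_nth (theta3 ^ 5) (l ^ 3 * (4 * n))"
        using dvd assms(2) 3 by (auto intro: dvd_trans)
      then have "int m dvd fps_nth (fps_U 4 (theta3 ^ 5)) (l ^ 3 * n)"
        by (simp add: mult.left_commute)
      then show ?thesis
        using overpartition_count_cong_0 fps_U_inv_7 3 unfolding fps_U4_theta3_pow5 by blast
    next
      case 4
      then have "int m dvd fps_nth (theta3 * (8 * eisen4 + 4 * fps_V 4 eisen4)) (l ^ 3 * n)"
        using dvd assms(2) theta3_eisen4_dvd[OF l assms(7)] by (auto intro: dvd_trans)
      then show ?thesis using overpartition_count_cong_0 fps_U_inv_11_eisen4 4 by blast
    qed
  qed
  then show ?thesis by (simp add: cong_0_iff mult.assoc)
qed

end
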